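(* Let $G$ be a finite group, $V$ a finite-dimensional complex representation of $G$, and $u\in G$ a central element satisfying $u^2=1$ and acting by $-1$ on $V$. Let $\mathrm{Aut}(G,V)$ be the group of all pairs $(\phi,\eta)$ where $\phi:G\to G$ is an automorphism and $\eta:V\to\phi^*(V)$ is an isomorphism of $G$-representations. Then the set of Hopf algebra isomorphism classes of the Hopf algebras $A(G,V,u,B)$, for fixed $G,V,u$ and with $B$ ranging over $S^2V$, is the orbit set $$\frac{S^2V/(S^2V)^G}{\mathrm{Aut}(G,V)},$$ where the orbit of the class of $B$ corresponds to the isomorphism class of $A(G,V,u,B)$.
   Context: The ground field is $\mathbb{C}$. $S^2V$ denotes the space of symmetric tensors in $V\otimes V$, and $(S^2V)^G$ its subspace of $G$-invariants. $\phi^*(V)$ is the space $V$ with $g\in G$ acting as $\phi(g)$. The group $\mathrm{Aut}(G,V)$ acts on $S^2V$, and hence on $S^2V/(S^2V)^G$, by $(\phi,\eta)\cdot B=(\eta\otimes\eta)(B)$. Isomorphism means isomorphism of Hopf algebras, without regard for triangular structures. Definition of $A(G,V,u,B)$, for $B\in S^2V$. Let $\mathbb{C}[G\ltimes V]:=\mathbb{C}[G]\ltimes\Lambda V$ be the Hopf superalgebra generated by $G$ (even) and $V$ (odd), with $gvg^{-1}=g\cdot v$, $vw=-wv$, $\Delta(g)=g\otimes g$, $\Delta(v)=v\otimes1+1\otimes v$, $\varepsilon(g)=1$, $\varepsilon(v)=0$ (tensor products of superalgebras have the super multiplication). Let $J:=e^B\in\Lambda V\otimes\Lambda V\subset\mathbb{C}[G\ltimes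 V]^{\otimes2}$. The twisted Hopf superalgebra $\mathbb{C}[G\ltimes V]^J$ has the same multiplication and counit, and coproduct $\Delta^J(x)=J^{-1}\Delta(x)J$. For $x$ homogeneous of parity $p(x)$ write $\Delta^J(x)=\Delta^J_0(x)+\Delta^J_1(x)$, where the second tensor factor of $\Delta^J_0(x)$ is even and that of $\Delta_1^J(x)$ is odd. Then $A(G,V,u,B)$ is the ordinary Hopf algebra which, as an algebra with counit, is $\mathbb{C}[G]\ltimes\Lambda V$ (grading forgotten), with coproduct $\widetilde{\Delta^J}(x)=\Delta^J_0(x)-(-1)^{p(x)}(u\otimes1)\Delta^J_1(x)$.
   Formalization: The formal theorem replaces Aut(G,V) by its subgroup of pairs (φ,η) with φ(u)=u; with all pairs the claim fails for some non-faithful V (e.g. G=Z4×Z4, u=g²), and the two groups agree when V is faithful. *)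

theory Defs
  imports Complex_Main "HOL-Algebra.Bij" "HOL-Algebra.Group_Action" "Jordan_Normal_Form.Matrix"
begin

section \<open>Finite-dimensional Hopf algebras with a distinguished linear basis\<close>

text \<open>The complex vector space with finite basis \<open>X\<close> is realized as the space of
  functions vanishing outside \<open>X\<close>; its tensor square is then the space with basis \<open>X \<times> X\<close>.\<close>

definition vspace :: "'x set \<Rightarrow> ('x \<Rightarrow> complex) set" where
  "vspace X = {a. \<forall>x. x \<notin> X \<longrightarrow> a x = 0}"

definition delta :: "'x \<Rightarrow> 'x \<Rightarrow> complex" where
  "delta x = (\<lambda>y. if y = x then 1 else 0)"

definition tens :: "('x \<Rightarrow> complex) \<Rightarrow> ('y \<Rightarrow> complex) \<Rightarrow> 'x \<times> 'y \<Rightarrow> complex" where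
  "tens a b = (\<lambda>(x, y). a x * b y)"

text \<open>The linear map on \<open>vspace X\<close> sending the basis vector \<open>delta x\<close> to \<open>F x\<close>.\<close>

definition lin_ext :: "'x set \<Rightarrow> ('x \<Rightarrow> 'y \<Rightarrow> complex) \<Rightarrow> ('x \<Rightarrow> complex) \<Rightarrow> 'y \<Rightarrow> complex" where
  "lin_ext X F a = (\<lambda>y. \<Sum>x\<in>X. a x * F x y)"

text \<open>The map \<open>f \<otimes> f\<close>, for \<open>f\<close> linear on \<open>vspace X\<close>.\<close>

definition tensor_sq ::
    "'x set \<Rightarrow> (('x \<Rightarrow> complex) \<Rightarrow> 'y \<Rightarrow> complex) \<Rightarrow> ('x \<times> 'x \<Rightarrow> complex) \<Rightarrow> 'y \<times> 'y \<Rightarrow> complex" where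
  "tensor_sq X f = lin_ext (X \<times> X) (\<lambda>(x, x'). tens (f (delta x)) (f (delta x')))"

text \<open>The antipode is not recorded: it is determined by the other operations, and every
  bialgebra homomorphism between Hopf algebras commutes with the antipodes.\<close>

record 'x hopf_data =
  hbasis :: "'x set"
  hmult :: "('x \<Rightarrow> complex) \<Rightarrow> ('x \<Rightarrow> complex) \<Rightarrow> 'x \<Rightarrow> complex"
  hunit :: "'x \<Rightarrow> complex"
  hcomult :: "('x \<Rightarrow> complex) \<Rightarrow> 'x \<times> 'x \<Rightarrow> complex"
  hcounit :: "('x \<Rightarrow> complex) \<Rightarrow> complex"

definition hopf_iso ::
    "'x hopf_data \<Rightarrow> 'y hopf_data \<Rightarrow> (('x \<Rightarrow> complex) \<Rightarrow> 'y \<Rightarrow> complex) \<Rightarrow> bool" where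
  "hopf_iso H K f \<longleftrightarrow>
     bij_betw f (vspace (hbasis H)) (vspace (hbasis K)) \<and>
     (\<forall>c. \<forall>a\<in>vspace (hbasis H). \<forall>b\<in>vspace (hbasis H).
        f (\<lambda>x. c * a x + b x) = (\<lambda>y. c * f a y + f b y)) \<and>
     (\<forall>a\<in>vspace (hbasis H). \<forall>b\<in>vspace (hbasis H). f (hmult H a b) = hmult K (f a) (f b)) \<and>
     f (hunit H) = hunit K \<and>
     (\<forall>a\<in>vspace (hbasis H). hcomult K (f a) = tensor_sq (hbasis H) f (hcomult H a)) \<and>
     (\<forall>a\<in>vspace (hbasis H). hcounit K (f a) = hcounit H a)"

definition hopf_isomorphic :: "'x hopf_data \<Rightarrow> 'y hopf_data \<Rightarrow> bool" where
  "hopf_isomorphic H K \<longleftrightarrow> (\<exists>f. hopf_iso H K f)"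


section \<open>Representations and symmetric tensors\<close>

text \<open>\<open>V\<close> is the column space of dimension \<open>n\<close> with standard basis \<open>e 0, \<dots>, e (n - 1)\<close>, for an
  arbitrary \<open>n\<close> (possibly 0), and a representation is given by its matrices.\<close>

definition matrix_rep :: "('g, 'm) monoid_scheme \<Rightarrow> nat \<Rightarrow> ('g \<Rightarrow> complex mat) \<Rightarrow> bool" where
  "matrix_rep G n \<rho> \<longleftrightarrow>
     (\<forall>g\<in>carrier G. \<rho> g \<in> carrier_mat n n) \<and>
     \<rho> \<one>\<^bsub>G\<^esub> = 1\<^sub>m n \<and>
     (\<forall>g\<in>carrier G. \<forall>h\<in>carrier G. \<rho> (g \<otimes>\<^bsub>G\<^esub> h) = \<rho> g * \<rho> h)"

text \<open>A matrix \<open>B\<close> stands for the tensor \<open>\<Sum>i j. B $$ (i, j) e i \<otimes> e j\<close> in \<open>V \<otimes> V\<close>. In these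
  coordinates \<open>(\<eta> \<otimes> \<eta>)(B)\<close> is \<open>\<eta> * B * \<eta>\<^sup>T\<close>.\<close>

definition S2 :: "nat \<Rightarrow> complex mat set" where
  "S2 n = {B \<in> carrier_mat n n. B\<^sup>T = B}"

definition tensor_act :: "complex mat \<Rightarrow> complex mat \<Rightarrow> complex mat" where
  "tensor_act \<eta> B = \<eta> * B * \<eta>\<^sup>T"

definition S2_inv :: "('g, 'm) monoid_scheme \<Rightarrow> nat \<Rightarrow> ('g \<Rightarrow> complex mat) \<Rightarrow> complex mat set" where
  "S2_inv G n \<rho> = {B \<in> S2 n. \<forall>g\<in>carrier G. tensor_act (\<rho> g) B = B}"

definition S2_rel ::
    "('g, 'm) monoid_scheme \<Rightarrow> nat \<Rightarrow> ('g \<Rightarrow> complex mat) \<Rightarrow> (complex mat \<times> complex mat) set" where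
  "S2_rel G n \<rho> = {(B, B'). B \<in> S2 n \<and> B' \<in> S2 n \<and> B - B' \<in> S2_inv G n \<rho>}"

text \<open>The group of pairs \<open>(\<phi>, \<eta>)\<close>, where \<open>\<phi>\<close> is an automorphism of \<open>G\<close> and \<open>\<eta>\<close> is an
  isomorphism of representations from \<open>V\<close> to \<open>V\<close> with \<open>g\<close> acting as \<open>\<rho> (\<phi> g)\<close>.\<close>

definition AutGV ::
    "('g, 'm) monoid_scheme \<Rightarrow> nat \<Rightarrow> ('g \<Rightarrow> complex mat) \<Rightarrow> (('g \<Rightarrow> 'g) \<times> complex mat) monoid" where
  "AutGV G n \<rho> =
     \<lparr>carrier = {(\<phi>, \<eta>). \<phi> \<in> auto G \<and> \<eta> \<in> carrier_mat n n \<and> invertible_mat \<eta> \<and>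
                   (\<forall>g\<in>carrier G. \<eta> * \<rho> g = \<rho> (\<phi> g) * \<eta>)},
      monoid.mult = (\<lambda>(\<phi>, \<eta>) (\<phi>', \<eta>'). (compose (carrier G) \<phi> \<phi>', \<eta> * \<eta>')),
      monoid.one = (\<lambda>g\<in>carrier G. g, 1\<^sub>m n)\<rparr>"

text \<open>Automorphisms of \<open>(G, V)\<close> as a pair with the fixed central element \<open>u\<close>. If \<open>V\<close> is
  faithful then \<open>\<phi> u = u\<close> is automatic, since \<open>\<phi> u\<close> acts by \<open>-1\<close> as well. It is also needed in
  general, because an isomorphism of the Hopf algebras with \<open>V \<noteq> 0\<close> must fix \<open>u\<close>. For example, let
  \<open>G\<close> be the product of two cyclic groups of order 4 with generators \<open>g, h\<close>, let \<open>u = g\<^sup>2\<close>, and let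
  \<open>V\<close> have basis \<open>e\<^sub>0, e\<^sub>1, e\<^sub>2, e\<^sub>3\<close> with \<open>g\<close> acting on \<open>e\<^sub>k\<close> by \<open>\<i>, \<i>, -\<i>, -\<i>\<close> and \<open>h\<close> by
  \<open>1, -1, 1, -1\<close>. Then \<open>\<phi> g = g h\<close>, \<open>\<phi> h = g\<^sup>2 h\<close> belongs to an automorphism of \<open>(G, V)\<close> sending
  \<open>e\<^sub>1 \<otimes> e\<^sub>2 + e\<^sub>2 \<otimes> e\<^sub>1\<close> to \<open>e\<^sub>0 \<otimes> e\<^sub>1 + e\<^sub>1 \<otimes> e\<^sub>0\<close>, but it moves \<open>u\<close> to \<open>g\<^sup>2 h\<^sup>2\<close>, and these two
  tensors give Hopf algebras that are not isomorphic.\<close>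

definition AutGVu ::
    "('g, 'm) monoid_scheme \<Rightarrow> nat \<Rightarrow> ('g \<Rightarrow> complex mat) \<Rightarrow> 'g \<Rightarrow> (('g \<Rightarrow> 'g) \<times> complex mat) monoid" where
  "AutGVu G n \<rho> u =
     (AutGV G n \<rho>)\<lparr>carrier := {(\<phi>, \<eta>) \<in> carrier (AutGV G n \<rho>). \<phi> u = u}\<rparr>"

text \<open>Action on classes in the quotient of the symmetric tensors by the invariant ones.\<close>

definition class_act :: "('g \<Rightarrow> 'g) \<times> complex mat \<Rightarrow> complex mat set \<Rightarrow> complex mat set" where
  "class_act = (\<lambda>(\<phi>, \<eta>) C. tensor_act \<eta> ` C)"


section \<open>The exterior algebra\<close>

text \<open>The exterior algebra of \<open>V\<close> has basis \<open>delta S\<close>, \<open>S \<subseteq> {..<n}\<close>, standing for the product of the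
  \<open>e i\<close>, \<open>i \<in> S\<close>, in increasing order.\<close>

definition wedge_sign :: "nat set \<Rightarrow> nat set \<Rightarrow> complex" where
  "wedge_sign S T = (- 1) ^ card {(i, j). i \<in> S \<and> j \<in> T \<and> j < i}"

definition wedge :: "(nat set \<Rightarrow> complex) \<Rightarrow> (nat set \<Rightarrow> complex) \<Rightarrow> nat set \<Rightarrow> complex" where
  "wedge a b = (\<lambda>U. \<Sum>S\<in>Pow U. wedge_sign S (U - S) * a S * b (U - S))"

definition ext_vec :: "complex vec \<Rightarrow> nat set \<Rightarrow> complex" where
  "ext_vec v = (\<lambda>S. \<Sum>i<dim_vec v. v $ i * delta {i} S)"

text \<open>The algebra endomorphism of the exterior algebra induced by the linear map \<open>R\<close> of \<open>V\<close>.\<close>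

definition ext_act :: "nat \<Rightarrow> complex mat \<Rightarrow> (nat set \<Rightarrow> complex) \<Rightarrow> nat set \<Rightarrow> complex" where
  "ext_act n R = lin_ext (Pow {..<n})
     (\<lambda>S. foldr (\<lambda>i. wedge (ext_vec (col R i))) (sorted_list_of_set S) (delta {}))"


section \<open>The Hopf superalgebra \<open>\<complex>[G \<ltimes> V]\<close> and its twist\<close>

text \<open>The basis element \<open>(g, S)\<close> stands for \<open>g\<close> times the product of the \<open>e i\<close>, \<open>i \<in> S\<close>, in
  increasing order; its parity is that of \<open>card S\<close>.\<close>

definition sbasis :: "('g, 'm) monoid_scheme \<Rightarrow> nat \<Rightarrow> ('g \<times> nat set) set" where
  "sbasis G n = carrier G \<times> Pow {..<n}"

definition sgrp :: "'g \<Rightarrow> 'g \<times> nat set \<Rightarrow> complex" where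
  "sgrp g = delta (g, {})"

definition svec :: "('g, 'm) monoid_scheme \<Rightarrow> nat \<Rightarrow> 'g \<times> nat set \<Rightarrow> complex" where
  "svec G i = delta (\<one>\<^bsub>G\<^esub>, {i})"

text \<open>\<open>g a \<cdot> h b = g h (h\<^sup>-\<^sup>1 \<cdot> a) b\<close> for \<open>a, b\<close> in the exterior algebra.\<close>

definition smult_alg :: "('g, 'm) monoid_scheme \<Rightarrow> nat \<Rightarrow> ('g \<Rightarrow> complex mat) \<Rightarrow>
    ('g \<times> nat set \<Rightarrow> complex) \<Rightarrow> ('g \<times> nat set \<Rightarrow> complex) \<Rightarrow> 'g \<times> nat set \<Rightarrow> complex" where
  "smult_alg G n \<rho> x y = (\<lambda>(k, U).
     \<Sum>(g, h)\<in>{(g, h). g \<in> carrier G \<and> h \<in> carrier G \<and> g \<otimes>\<^bsub>G\<^esub> h = k}.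
       wedge (ext_act n (\<rho> (inv\<^bsub>G\<^esub> h)) (\<lambda>S. x (g, S))) (\<lambda>T. y (h, T)) U)"

text \<open>\<open>(a \<otimes> b)(c \<otimes> d) = (-1)\<^bsup>p(b)p(c)\<^esup> ac \<otimes> bd\<close>, extended bilinearly.\<close>

definition super_mult :: "('g, 'm) monoid_scheme \<Rightarrow> nat \<Rightarrow> ('g \<Rightarrow> complex mat) \<Rightarrow>
    (('g \<times> nat set) \<times> ('g \<times> nat set) \<Rightarrow> complex) \<Rightarrow> (('g \<times> nat set) \<times> ('g \<times> nat set) \<Rightarrow> complex) \<Rightarrow>
    ('g \<times> nat set) \<times> ('g \<times> nat set) \<Rightarrow> complex" where
  "super_mult G n \<rho> s t = (\<lambda>z.
     \<Sum>(a, b)\<in>sbasis G n \<times> sbasis G n. \<Sum>(c, d)\<in>sbasis G n \<times> sbasis G n.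
       s (a, b) * t (c, d) * (- 1) ^ (card (snd b) * card (snd c)) *
       tens (smult_alg G n \<rho> (delta a) (delta c)) (smult_alg G n \<rho> (delta b) (delta d)) z)"

definition sone2 :: "('g, 'm) monoid_scheme \<Rightarrow> ('g \<times> nat set) \<times> ('g \<times> nat set) \<Rightarrow> complex" where
  "sone2 G = tens (sgrp \<one>\<^bsub>G\<^esub>) (sgrp \<one>\<^bsub>G\<^esub>)"

definition sprim :: "('g, 'm) monoid_scheme \<Rightarrow> nat \<Rightarrow> ('g \<times> nat set) \<times> ('g \<times> nat set) \<Rightarrow> complex" where
  "sprim G i = (\<lambda>z. tens (svec G i) (sgrp \<one>\<^bsub>G\<^esub>) z + tens (sgrp \<one>\<^bsub>G\<^esub>) (svec G i) z)"

text \<open>The multiplicative map \<open>\<Delta>\<close> with \<open>\<Delta>(g) = g \<otimes> g\<close> and \<open>\<Delta>(v) = v \<otimes> 1 + 1 \<otimes> v\<close>.\<close>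

definition scomult :: "('g, 'm) monoid_scheme \<Rightarrow> nat \<Rightarrow> ('g \<Rightarrow> complex mat) \<Rightarrow>
    ('g \<times> nat set \<Rightarrow> complex) \<Rightarrow> ('g \<times> nat set) \<times> ('g \<times> nat set) \<Rightarrow> complex" where
  "scomult G n \<rho> = lin_ext (sbasis G n)
     (\<lambda>(g, S). super_mult G n \<rho> (tens (sgrp g) (sgrp g))
        (foldr (\<lambda>i. super_mult G n \<rho> (sprim G i)) (sorted_list_of_set S) (sone2 G)))"

definition scounit :: "('g, 'm) monoid_scheme \<Rightarrow> ('g \<times> nat set \<Rightarrow> complex) \<Rightarrow> complex" where
  "scounit G x = (\<Sum>g\<in>carrier G. x (g, {}))"

definition stensor :: "('g, 'm) monoid_scheme \<Rightarrow> nat \<Rightarrow> complex mat \<Rightarrow>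
    ('g \<times> nat set) \<times> ('g \<times> nat set) \<Rightarrow> complex" where
  "stensor G n B = (\<lambda>z. \<Sum>i<n. \<Sum>j<n. B $$ (i, j) * tens (svec G i) (svec G j) z)"

text \<open>The exponential of a nilpotent element: the series has finitely many nonzero terms.\<close>

definition super_exp :: "('g, 'm) monoid_scheme \<Rightarrow> nat \<Rightarrow> ('g \<Rightarrow> complex mat) \<Rightarrow>
    (('g \<times> nat set) \<times> ('g \<times> nat set) \<Rightarrow> complex) \<Rightarrow> ('g \<times> nat set) \<times> ('g \<times> nat set) \<Rightarrow> complex" where
  "super_exp G n \<rho> t = (\<lambda>z. \<Sum>k. (super_mult G n \<rho> t ^^ k) (sone2 G) z / fact k)"

text \<open>\<open>\<Delta>\<^sup>J(x) = J\<^sup>-\<^sup>1 \<Delta>(x) J\<close> for \<open>J = e\<^sup>B\<close>, whose inverse is \<open>e\<^bsup>-B\<^esup>\<close>.\<close>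

definition twisted_comult :: "('g, 'm) monoid_scheme \<Rightarrow> nat \<Rightarrow> ('g \<Rightarrow> complex mat) \<Rightarrow> complex mat \<Rightarrow>
    ('g \<times> nat set \<Rightarrow> complex) \<Rightarrow> ('g \<times> nat set) \<times> ('g \<times> nat set) \<Rightarrow> complex" where
  "twisted_comult G n \<rho> B x =
     super_mult G n \<rho> (super_exp G n \<rho> (stensor G n (- B)))
       (super_mult G n \<rho> (scomult G n \<rho> x) (super_exp G n \<rho> (stensor G n B)))"


section \<open>The Hopf algebras \<open>A(G, V, u, B)\<close>\<close>

definition snd_even :: "('g \<times> nat set) \<times> ('g \<times> nat set) \<Rightarrow> bool" where
  "snd_even = (\<lambda>(a, b). even (card (snd b)))"

definition parity_inv :: "('g \<times> nat set \<Rightarrow> complex) \<Rightarrow> 'g \<times> nat set \<Rightarrow> complex" where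
  "parity_inv x = (\<lambda>(g, S). (- 1) ^ card S * x (g, S))"

text \<open>\<open>\<Delta>\<^sup>J\<^sub>0(x) - (-1)\<^bsup>p(x)\<^esup> (u \<otimes> 1) \<Delta>\<^sup>J\<^sub>1(x)\<close>, extended linearly from homogeneous \<open>x\<close>.\<close>

definition A_comult ::
    "('g, 'm) monoid_scheme \<Rightarrow> nat \<Rightarrow> ('g \<Rightarrow> complex mat) \<Rightarrow> 'g \<Rightarrow> complex mat \<Rightarrow>
    ('g \<times> nat set \<Rightarrow> complex) \<Rightarrow> ('g \<times> nat set) \<times> ('g \<times> nat set) \<Rightarrow> complex" where
  "A_comult G n \<rho> u B x = (\<lambda>z.
     (if snd_even z then twisted_comult G n \<rho> B x z else 0) -
     super_mult G n \<rho> (tens (sgrp u) (sgrp \<one>\<^bsub>G\<^esub>))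
       (\<lambda>w. if snd_even w then 0 else twisted_comult G n \<rho> B (parity_inv x) w) z)"

definition A_hopf ::
    "('g, 'm) monoid_scheme \<Rightarrow> nat \<Rightarrow> ('g \<Rightarrow> complex mat) \<Rightarrow> 'g \<Rightarrow> complex mat \<Rightarrow>
    ('g \<times> nat set) hopf_data" where
  "A_hopf G n \<rho> u B =
     \<lparr>hbasis = sbasis G n,
      hmult = smult_alg G n \<rho>,
      hunit = sgrp \<one>\<^bsub>G\<^esub>,
      hcomult = A_comult G n \<rho> u B,
      hcounit = scounit G\<rparr>"

definition A_family ::
    "('g, 'm) monoid_scheme \<Rightarrow> nat \<Rightarrow> ('g \<Rightarrow> complex mat) \<Rightarrow> 'g \<Rightarrow> ('g \<times> nat set) hopf_data set" where
  "A_family G n \<rho> u = A_hopf G n \<rho> u ` S2 n"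

definition A_iso_rel ::
    "('g, 'm) monoid_scheme \<Rightarrow> nat \<Rightarrow> ('g \<Rightarrow> complex mat) \<Rightarrow> 'g \<Rightarrow>
    (('g \<times> nat set) hopf_data \<times> ('g \<times> nat set) hopf_data) set" where
  "A_iso_rel G n \<rho> u =
     {(H, K). H \<in> A_family G n \<rho> u \<and> K \<in> A_family G n \<rho> u \<and> hopf_isomorphic H K}"

end

theory Submission
  imports Defs "Jordan_Normal_Form.Determinant"
begin

text \<open>In \<open>A(G, V, u, B)\<close> one has \<open>\<Delta>(u) = u \<otimes> u\<close> and \<open>\<Delta>(v) = v \<otimes> 1 + u \<otimes> v\<close>, while the twisted
  coproduct of \<open>g \<in> G\<close> is \<open>(g \<otimes> g) exp (B - g\<^sup>-\<^sup>1 B)\<close>. So only the differences \<open>B - g\<^sup>-\<^sup>1 B\<close>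
  matter, and a pair \<open>(\<phi>, \<eta>)\<close> fixing \<open>u\<close> extends to an isomorphism from \<open>A(G, V, u, B)\<close> to
  \<open>A(G, V, u, \<eta> B)\<close>.

  Conversely let \<open>F\<close> be an isomorphism from \<open>A(G, V, u, B)\<close> to \<open>A(G, V, u, B')\<close>, and let \<open>I\<close> be
  the ideal generated by \<open>V\<close>. Modulo \<open>I\<close> the element \<open>F(v)\<close> is skew-primitive in \<open>\<complex>[G]\<close>, hence
  \<open>c (1 - g)\<close>, and it has square zero, so \<open>F(v) \<in> I\<close>. Therefore \<open>F\<close> preserves the powers of \<open>I\<close>,
  and it induces an automorphism \<open>\<phi>\<close> on \<open>\<complex>[G]\<close> and an isomorphism \<open>\<eta>\<close> on \<open>V\<close>. Comparing the
  components of bidegree (1, 1) of \<open>\<Delta>(F(g)) = (F \<otimes> F)(\<Delta>(g))\<close>, symmetrized to remove the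
  contribution of \<open>\<Lambda>\<^sup>2V\<close>, gives \<open>B' - \<phi>(g)\<^sup>-\<^sup>1 B' = \<eta> (B - g\<^sup>-\<^sup>1 B)\<close>, that is, \<open>\<eta> B - B'\<close> is
  invariant.\<close>

section \<open>Linear maps between function spaces\<close>

text \<open>The comparison in bidegree (1, 1) also sees the part of F(g) of degree 1, which enters
  as the product of its coefficients in the two tensor factors. It has to be shown to vanish: the
  components of bidegree (1, 0) and (0, 1) of \<Delta>(F(g)) put its support on \<phi>(g) and
  exclude \<phi>(g), the latter because u moves \<phi>(g). Symmetrizing loses nothing, since B -
  g^-1 B is itself symmetric. The factor \<open>u \<otimes> 1\<close> in front of the odd half of
  the coproduct moves the component of bidegree (1, 1) of \<Delta>(g) to the group elements u g and
  g, so that \<phi>(u) = u is needed to match both sides; it comes from the coproduct of F(v) for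
  some v whose image under \<eta> is nonzero. Both u being different from 1 and \<phi>(u) = u rely
  on V being nonzero. For V = 0 they can fail, but then 0 is the only tensor.\<close>

definition clin :: "(('x \<Rightarrow> complex) \<Rightarrow> 'y \<Rightarrow> complex) \<Rightarrow> bool" where
  "clin L \<longleftrightarrow> (\<forall>c a b. L (\<lambda>x. c * a x + b x) = (\<lambda>y. c * L a y + L b y))"

lemma clinI: "(\<And>c a b y. L (\<lambda>x. c * a x + b x) y = c * L a y + L b y) \<Longrightarrow> clin L"
  by (auto simp: clin_def fun_eq_iff)

lemma clinD: "clin L \<Longrightarrow> L (\<lambda>x. c * a x + b x) = (\<lambda>y. c * L a y + L b y)"
  by (auto simp: clin_def)

lemma clin_zero: "clin L \<Longrightarrow> L (\<lambda>x. 0) = (\<lambda>y. 0)"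
  using clinD[of L 1 "\<lambda>x. 0" "\<lambda>x. 0"] by (auto simp: fun_eq_iff)

lemma clin_scale: "clin L \<Longrightarrow> L (\<lambda>x. c * a x) = (\<lambda>y. c * L a y)"
  using clinD[of L c a "\<lambda>x. 0"] by (simp add: clin_zero)

lemma clin_add: "clin L \<Longrightarrow> L (\<lambda>x. a x + b x) = (\<lambda>y. L a y + L b y)"
  using clinD[of L 1 a b] by simp

lemma clin_uminus: "clin L \<Longrightarrow> L (\<lambda>x. - a x) = (\<lambda>y. - L a y)"
  using clin_scale[of L "-1" a] by simp

lemma clin_diff: "clin L \<Longrightarrow> L (\<lambda>x. a x - b x) = (\<lambda>y. L a y - L b y)"
  using clin_add[of L a "\<lambda>x. - b x"] by (simp add: clin_uminus)

lemma clin_sum: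
  assumes "clin L"
  shows "L (\<lambda>x. \<Sum>i\<in>I. c i * a i x) = (\<lambda>y. \<Sum>i\<in>I. c i * L (a i) y)"
proof (induction I rule: infinite_finite_induct)
  case (insert i I)
  then show ?case by (simp add: clinD[OF assms])
qed (simp_all add: clin_zero assms)

lemma clin_sum1:
  assumes "clin L"
  shows "L (\<lambda>x. \<Sum>i\<in>I. a i x) = (\<lambda>y. \<Sum>i\<in>I. L (a i) y)"
  using clin_sum[OF assms, where I = I and c = "\<lambda>_. 1" and a = a] by simp

lemma clin_comp: "clin L \<Longrightarrow> clin M \<Longrightarrow> clin (\<lambda>a. L (M a))"
  by (simp add: clin_def)

lemma clin_id: "clin (\<lambda>a. a)"
  by (simp add: clin_def)

lemma clin_plus: "clin L \<Longrightarrow> clin M \<Longrightarrow> clin (\<lambda>a y. L a y + M a y)"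
  by (simp add: clin_def algebra_simps)

lemma clin_minus: "clin L \<Longrightarrow> clin M \<Longrightarrow> clin (\<lambda>a y. L a y - M a y)"
  by (simp add: clin_def algebra_simps)

lemma clin_times: "clin L \<Longrightarrow> clin (\<lambda>a y. c y * L a y)"
  by (simp add: clin_def algebra_simps)

lemma clin_if: "clin L \<Longrightarrow> clin M \<Longrightarrow> clin (\<lambda>a y. if P y then L a y else M a y)"
  by (auto simp add: clin_def fun_eq_iff)

lemma clin_const_zero: "clin (\<lambda>a y. 0)"
  by (simp add: clin_def)

lemma clin_lin_ext: "clin (lin_ext X F)"
  by (rule clinI) (simp add: lin_ext_def sum_distrib_left sum.distrib algebra_simps)

lemma delta_same [simp]: "delta x x = 1" by (simp add: delta_def)

lemma delta_in_vspace [simp]: "delta x \<in> vspace X \<longleftrightarrow> x \<in> X"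
  by (auto simp: delta_def vspace_def)

lemma vspace_lincomb: "a \<in> vspace X \<Longrightarrow> b \<in> vspace X \<Longrightarrow> (\<lambda>x. c * a x + b x) \<in> vspace X"
  by (auto simp: vspace_def)

lemma vspace_sum: "(\<And>i. i \<in> I \<Longrightarrow> F i \<in> vspace X) \<Longrightarrow> (\<lambda>x. \<Sum>i\<in>I. c i * F i x) \<in> vspace X"
  by (auto simp: vspace_def intro!: sum.neutral)

lemma lin_ext_vspace: "(\<And>x. x \<in> X \<Longrightarrow> F x \<in> vspace Y) \<Longrightarrow> lin_ext X F a \<in> vspace Y"
  unfolding lin_ext_def by (rule vspace_sum)

lemma lin_ext_delta: "finite X \<Longrightarrow> x \<in> X \<Longrightarrow> lin_ext X F (delta x) = F x"
  by (auto simp: lin_ext_def delta_def fun_eq_iff if_distrib[of "\<lambda>t. t * _"] cong: if_cong)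

lemma vspace_delta_sum:
  assumes "finite X" "a \<in> vspace X"
  shows "(\<lambda>y. \<Sum>x\<in>X. a x * delta x y) = a"
proof
  fix y
  have "(\<Sum>x\<in>X. a x * delta x y) = (\<Sum>x\<in>X. if x = y then a y else 0)"
    by (rule sum.cong) (auto simp: delta_def)
  then show "(\<Sum>x\<in>X. a x * delta x y) = a y"
    using assms by (auto simp: vspace_def)
qed

lemma clin_eq_lin_ext:
  assumes "clin L" "finite X" "a \<in> vspace X"
  shows "L a = lin_ext X (\<lambda>x. L (delta x)) a"
  using clin_sum[OF assms(1), where I = X and c = a and a = delta] vspace_delta_sum[OF assms(2,3)]
  by (simp add: lin_ext_def)

lemma clin_eqI:
  assumes "clin L" "clin M" "finite X" "\<And>x. x \<in> X \<Longrightarrow> L (delta x) = M (delta x)" "a \<in> vspace X"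
  shows "L a = M a"
  unfolding clin_eq_lin_ext[OF assms(1,3,5)] clin_eq_lin_ext[OF assms(2,3,5)]
  using assms(4) by (simp add: lin_ext_def)

lemma clin_vspaceI:
  assumes "clin L" "finite X" "\<And>x. x \<in> X \<Longrightarrow> L (delta x) \<in> vspace Y" "a \<in> vspace X"
  shows "L a \<in> vspace Y"
  unfolding clin_eq_lin_ext[OF assms(1,2,4)] using assms(3) by (rule lin_ext_vspace)

text \<open>The products and coproducts below sum over basis elements only, so truncating an
  argument to the basis does not change them. This turns identities on \<open>vspace X\<close> into
  identities for arbitrary functions.\<close>

definition restrict_to :: "'x set \<Rightarrow> ('x \<Rightarrow> complex) \<Rightarrow> 'x \<Rightarrow> complex" where
  "restrict_to X a = (\<lambda>x. if x \<in> X then a x else 0)"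

lemma restrict_to_vspace [simp]: "restrict_to X a \<in> vspace X"
  by (simp add: restrict_to_def vspace_def)

lemma lin_ext_restrict: "lin_ext X F (restrict_to X a) = lin_ext X F a"
  by (simp add: lin_ext_def restrict_to_def)

lemma clin_tens1: "clin (\<lambda>a. tens a b)"
  by (rule clinI) (auto simp: tens_def algebra_simps split: prod.split)

lemma clin_tens2: "clin (tens a)"
  by (rule clinI) (auto simp: tens_def algebra_simps split: prod.split)

lemma tens_delta [simp]: "tens (delta a) (delta b) = delta (a, b)"
  by (auto simp: tens_def delta_def)

lemma tens_apply [simp]: "tens a b (x, y) = a x * b y"
  by (simp add: tens_def)

lemma tens_in_vspace: "a \<in> vspace X \<Longrightarrow> b \<in> vspace Y \<Longrightarrow> tens a b \<in> vspace (X \<times> Y)"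
  by (auto simp: vspace_def tens_def)


section \<open>The ring of linear operators\<close>

text \<open>The algebras of the theorem depend on \<open>G\<close> and are not types. Their products are bilinear
  on the whole function space, so that elements can be replaced by their left multiplication
  operators, which live in a ring type.\<close>

typedef 'x lop = "{L :: ('x \<Rightarrow> complex) \<Rightarrow> 'x \<Rightarrow> complex. clin L}"
  morphisms app Lop
  by (rule exI[of _ "\<lambda>a. a"]) (simp add: clin_id)

setup_lifting type_definition_lop

instantiation lop :: (type) ring_1
begin
lift_definition zero_lop :: "'a lop" is "\<lambda>a y. 0" by (rule clin_const_zero)
lift_definition one_lop :: "'a lop" is "\<lambda>a. a" by (rule clin_id)
lift_definition plus_lop :: "'a lop \<Rightarrow> 'a lop \<Rightarrow> 'a lop" is "\<lambda>L M a y. L a y + M a y"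
  by (rule clin_plus)
lift_definition minus_lop :: "'a lop \<Rightarrow> 'a lop \<Rightarrow> 'a lop" is "\<lambda>L M a y. L a y - M a y"
  by (rule clin_minus)
lift_definition uminus_lop :: "'a lop \<Rightarrow> 'a lop" is "\<lambda>L a y. - L a y"
  by (simp add: clin_def algebra_simps)
lift_definition times_lop :: "'a lop \<Rightarrow> 'a lop \<Rightarrow> 'a lop" is "\<lambda>L M a. L (M a)"
  by (rule clin_comp)
instance
proof
  show "(0::'a lop) \<noteq> 1"
    by transfer (auto simp: fun_eq_iff intro!: exI[of _ "\<lambda>_. 1"])
qed (transfer; simp add: fun_eq_iff clin_add clin_diff algebra_simps)+
end

text \<open>Scalars enter the ring \<open>'x lop\<close> as central elements, so that the ring
  structure alone carries the calculations.\<close>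

lift_definition cscale :: "complex \<Rightarrow> 'a lop" is "\<lambda>c a y. c * a y"
  by (simp add: clin_def algebra_simps)

lemma cscale_commute: "L * cscale c = cscale c * L"
  by transfer (simp add: clin_scale)

lemma cscale_mult: "cscale (c * d) = cscale c * cscale d"
  by transfer (simp add: fun_eq_iff algebra_simps)

lemma cscale_add: "cscale (c + d) = cscale c + cscale d"
  by transfer (simp add: fun_eq_iff algebra_simps)

lemma cscale_0 [simp]: "cscale 0 = 0"
  by transfer (simp add: fun_eq_iff algebra_simps)

lemma cscale_1 [simp]: "cscale 1 = 1"
  by transfer (simp add: fun_eq_iff algebra_simps)

lemma app_simps [simp]:
  "app (L * M) a = app L (app M a)"
  "app (L + M) a y = app L a y + app M a y"
  "app (L - M) a y = app L a y - app M a y"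
  "app (- L) a y = - app L a y"
  "app 0 a y = 0"
  "app 1 a = a"
  "app (cscale c) a y = c * a y"
  by (transfer; simp)+

lemma lop_eqI: "(\<And>a. app L a = app M a) \<Longrightarrow> L = M"
  by transfer auto

lemma app_sum: "app (sum L I) a y = (\<Sum>i\<in>I. app (L i) a y)"
  by (induction I rule: infinite_finite_induct) simp_all

lemma app_power: "app (L ^ k) a = (app L ^^ k) a"
  by (induction k) simp_all

lemma app_prod_list: "app (prod_list (map w l)) a = foldr (\<lambda>i. app (w i)) l a"
  by (induction l) simp_all

text \<open>The square of an anticommuting generator equals its own negative; it vanishes because 2
  is invertible.\<close>

lemma lop_double_eq_0:
  fixes L :: "'x lop" assumes "L = - L" shows "L = 0"
proof (rule lop_eqI)
  fix a show "app L a = app 0 a"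
  proof
    fix y have "app L a y = - app L a y" by (subst assms) simp
    then show "app L a y = app 0 a y" by simp
  qed
qed


section \<open>Alternating products\<close>

definition altprod :: "(nat \<Rightarrow> 'a::ring_1) \<Rightarrow> nat set \<Rightarrow> 'a" where
  "altprod w S = prod_list (map w (sorted_list_of_set S))"

definition ninv :: "nat set \<Rightarrow> nat set \<Rightarrow> nat" where
  "ninv S T = card {(i, j). i \<in> S \<and> j \<in> T \<and> j < i}"

lemma wedge_sign_ninv: "wedge_sign S T = (- 1) ^ ninv S T"
  by (simp add: wedge_sign_def ninv_def)

lemma finite_inv_set: "finite S \<Longrightarrow> finite T \<Longrightarrow> finite {(i, j). i \<in> S \<and> j \<in> T \<and> j < (i::nat)}"
  by (rule finite_subset[of _ "S \<times> T"]) auto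

lemma ninv_Un_left:
  assumes "finite S" "finite S'" "finite T" "S \<inter> S' = {}"
  shows "ninv (S \<union> S') T = ninv S T + ninv S' T"
proof -
  have "{(i, j). i \<in> S \<union> S' \<and> j \<in> T \<and> j < i} =
        {(i, j). i \<in> S \<and> j \<in> T \<and> j < i} \<union> {(i, j). i \<in> S' \<and> j \<in> T \<and> j < i}" by auto
  then show ?thesis
    unfolding ninv_def using assms
    by (simp only:) (rule card_Un_disjoint; auto simp: finite_inv_set)
qed

lemma ninv_Un_right:
  assumes "finite S" "finite T" "finite T'" "T \<inter> T' = {}"
  shows "ninv S (T \<union> T') = ninv S T + ninv S T'"
proof -
  have "{(i, j). i \<in> S \<and> j \<in> T \<union> T' \<and> j < i} =
        {(i, j). i \<in> S \<and> j \<in> T \<and> j < i} \<union> {(i, j). i \<in> S \<and> j \<in> T' \<and> j < i}" by auto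
  then show ?thesis
    unfolding ninv_def using assms
    by (simp only:) (rule card_Un_disjoint; auto simp: finite_inv_set)
qed

lemma ninv_eq_0: "(\<And>i j. i \<in> S \<Longrightarrow> j \<in> T \<Longrightarrow> i \<le> j) \<Longrightarrow> ninv S T = 0"
proof -
  assume "\<And>i j. i \<in> S \<Longrightarrow> j \<in> T \<Longrightarrow> i \<le> j"
  then have "{(i, j). i \<in> S \<and> j \<in> T \<and> j < i} = {}" by fastforce
  then show ?thesis by (simp only: ninv_def card.empty)
qed

lemma ninv_empty [simp]: "ninv {} T = 0" "ninv S {} = 0"
  by (rule ninv_eq_0; simp)+

lemma ninv_single_less: "j < i \<Longrightarrow> ninv {i} {j} = 1"
proof -
  assume "j < i"
  then have "{(i', j'). i' \<in> {i} \<and> j' \<in> {j} \<and> j' < i'} = {(i, j)}" by auto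
  then show ?thesis by (simp add: ninv_def)
qed

lemma altprod_empty [simp]: "altprod w {} = 1"
  by (simp add: altprod_def)

lemma sorted_list_of_set_insert_min:
  assumes "finite A" "\<And>a. a \<in> A \<Longrightarrow> b < (a::nat)"
  shows "sorted_list_of_set (insert b A) = b # sorted_list_of_set A"
proof -
  have "b \<notin> A" using assms by blast
  then show ?thesis
    using assms by (simp add: insort_is_Cons less_imp_le)
qed

lemma altprod_insert_min:
  assumes "finite A" "\<And>a. a \<in> A \<Longrightarrow> b < a"
  shows "altprod w (insert b A) = w b * altprod w A"
  unfolding altprod_def by (subst sorted_list_of_set_insert_min) (use assms in auto)

lemma altprod_cong: "finite S \<Longrightarrow> (\<And>i. i \<in> S \<Longrightarrow> w i = w' i) \<Longrightarrow> altprod w S = altprod w' S"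
  by (auto simp: altprod_def intro!: arg_cong[of _ _ prod_list] map_cong)

lemma altprod_single [simp]: "altprod w {i} = w i"
  by (simp add: altprod_def)

lemma altprod_two: "i < j \<Longrightarrow> altprod w {i, j} = w i * w j"
  by (simp add: altprod_def insort_is_Cons)

text \<open>Moving \<open>w k\<close> to its place costs one sign for each smaller factor,
  \<open>ninv {k} T\<close> in all; if \<open>k\<close> is in \<open>T\<close>, it meets its own
  copy and the square vanishes. The induction splits off the minimum, which is the leftmost
  factor.\<close>

lemma altprod_generator:
  fixes w :: "nat \<Rightarrow> 'a::ring_1"
  assumes "finite T" "k \<in> N" "T \<subseteq> N"
    and anti: "\<And>i j. i \<in> N \<Longrightarrow> j \<in> N \<Longrightarrow> w i * w j = - (w j * w i)"
    and sq: "\<And>i. i \<in> N \<Longrightarrow> w i * w i = 0"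
  shows "w k * altprod w T = (if k \<in> T then 0 else (- 1) ^ ninv {k} T * altprod w (insert k T))"
  using assms(1,3)
proof (induction T rule: finite_linorder_min_induct)
  case empty
  then show ?case by (simp add: ninv_eq_0)
next
  case (insert b A)
  have bA: "b \<notin> A" using insert by blast
  have W: "altprod w (insert b A) = w b * altprod w A"
    using insert by (simp add: altprod_insert_min)
  consider "k < b" | "k = b" | "b < k" by linarith
  then show ?case
  proof cases
    case 1
    then have "ninv {k} (insert b A) = 0"
      using insert.hyps(2) by (intro ninv_eq_0) fastforce
    moreover have "altprod w (insert k (insert b A)) = w k * altprod w (insert b A)"
      using insert 1 by (intro altprod_insert_min) fastforce+
    ultimately show ?thesis using insert.hyps 1 by fastforce
  next
    case 2
    have "w k * altprod w (insert b A) = (w b * w b) * altprod w A" using 2 W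
      by (simp add: mult.assoc)
    then show ?thesis using 2 sq insert.prems by simp
  next
    case 3
    have "w k * altprod w (insert b A) = w k * w b * altprod w A" using W by (simp add: mult.assoc)
    also have "\<dots> = - (w b * (w k * altprod w A))"
      using anti[of k b] assms(2) insert.prems by (simp add: mult.assoc)
    finally have *: "w k * altprod w (insert b A) = - (w b * (w k * altprod w A))" .
    show ?thesis
    proof (cases "k \<in> A")
      case True
      then show ?thesis using insert.IH insert.prems * by simp
    next
      case False
      have "altprod w (insert b (insert k A)) = w b * altprod w (insert k A)"
        using insert.hyps 3 by (intro altprod_insert_min) auto
      moreover have "ninv {k} (insert b A) = Suc (ninv {k} A)"
        using ninv_Un_right[of "{k}" "{b}" A] insert.hyps bA 3 by (simp add: ninv_single_less)
      ultimately show ?thesis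
        using insert.IH insert.prems * 3 False
        by (cases "even (ninv {k} A)") (simp_all add: insert_commute)
    qed
  qed
qed

text \<open>The factors of \<open>S\<close> are inserted into the product over \<open>T\<close> one
  by one, the largest first. The sign is the total number of inversions because \<open>ninv\<close>
  is additive in both arguments.\<close>

lemma altprod_mult:
  fixes w :: "nat \<Rightarrow> 'a::ring_1"
  assumes "finite S" "finite T" "S \<subseteq> N" "T \<subseteq> N"
    and anti: "\<And>i j. i \<in> N \<Longrightarrow> j \<in> N \<Longrightarrow> w i * w j = - (w j * w i)"
    and sq: "\<And>i. i \<in> N \<Longrightarrow> w i * w i = 0"
  shows "altprod w S * altprod w T =
         (if S \<inter> T = {} then (- 1) ^ ninv S T * altprod w (S \<union> T) else 0)"
  using assms(1,3)
proof (induction S rule: finite_linorder_min_induct)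
  case empty
  then show ?case by (simp add: ninv_eq_0)
next
  case (insert b A)
  have bA: "b \<notin> A" using insert by blast
  have "altprod w (insert b A) * altprod w T = w b * (altprod w A * altprod w T)"
    using insert by (simp add: altprod_insert_min mult.assoc)
  then have *: "altprod w (insert b A) * altprod w T =
      (if A \<inter> T = {} then (- 1) ^ ninv A T * (w b * altprod w (A \<union> T)) else 0)"
    using insert by (cases "even (ninv A T)") auto
  show ?case
  proof (cases "A \<inter> T = {}")
    case True
    have "w b * altprod w (A \<union> T) =
      (if b \<in> A \<union> T then 0 else (- 1) ^ ninv {b} (A \<union> T) * altprod w (insert b (A \<union> T)))"
      by (rule altprod_generator[OF _ _ _ anti sq]) (use insert assms(2,4) in auto)
    moreover have "ninv {b} A = 0"
      using insert.hyps by (intro ninv_eq_0) (auto intro: less_imp_le)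
    then have "ninv {b} (A \<union> T) = ninv {b} T"
      using True ninv_Un_right[of "{b}" A T] insert.hyps assms(2) by simp
    moreover have "ninv (insert b A) T = ninv A T + ninv {b} T"
      using ninv_Un_left[of A "{b}" T] insert.hyps assms(2) bA by simp
    ultimately show ?thesis
      using bA True unfolding * by (simp add: power_add mult.assoc)
  qed (auto simp: *)
qed


section \<open>The exterior algebra\<close>

lemma clin_wedge1: "clin (\<lambda>a. wedge a b)"
  by (rule clinI) (simp add: wedge_def sum_distrib_left sum.distrib algebra_simps)

lemma clin_wedge2: "clin (wedge a)"
  by (rule clinI) (simp add: wedge_def sum_distrib_left sum.distrib algebra_simps)

text \<open>A default value: \<open>Pow U\<close> is infinite, so the sum over it is 0.\<close>

lemma wedge_infinite: "infinite U \<Longrightarrow> wedge a b U = 0"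
  by (simp add: wedge_def)

text \<open>Both sides are sums over the ordered partitions of \<open>U\<close> into three blocks,
  and by additivity of \<open>ninv\<close> both carry the sign that counts the inversions between
  each pair of blocks.\<close>

lemma wedge_assoc: "wedge (wedge a b) c = wedge a (wedge b c)"
proof
  fix U :: "nat set"
  show "wedge (wedge a b) c U = wedge a (wedge b c) U"
  proof (cases "finite U")
    case False
    then show ?thesis by (simp add: wedge_infinite)
  next
    case fin: True
    let ?s = "\<lambda>R Q P. wedge_sign R Q * wedge_sign R P * wedge_sign Q P * a R * b Q * c P"
    have "wedge (wedge a b) c U =
      (\<Sum>S\<in>Pow U. \<Sum>R\<in>Pow S. ?s R (S - R) (U - S))"
      unfolding wedge_def sum_distrib_left sum_distrib_right
    proof (intro sum.cong refl)
      fix S R assume "S \<in> Pow U" "R \<in> Pow S"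
      then have "finite S" "finite R" "finite (U - S)" "R \<union> (S - R) = S"
        using fin by (auto intro: finite_subset)
      then have "ninv S (U - S) = ninv R (U - S) + ninv (S - R) (U - S)"
        using ninv_Un_left[of R "S - R" "U - S"] by simp
      then show "wedge_sign S (U - S) * (wedge_sign R (S - R) * a R * b (S - R)) * c (U - S) =
        ?s R (S - R) (U - S)" by (simp add: wedge_sign_ninv power_add)
    qed
    also have "\<dots> = (\<Sum>(S, R)\<in>Sigma (Pow U) Pow. ?s R (S - R) (U - S))"
      using fin by (intro sum.Sigma) (auto intro: finite_subset)
    \<comment> \<open>A block \<open>S\<close> with a part \<open>R\<close> of it is recorded as the
      two disjoint blocks \<open>R\<close> and \<open>S - R\<close>.\<close>
    also have "\<dots> = (\<Sum>(R, Q)\<in>Sigma (Pow U) (\<lambda>R. Pow (U - R)). ?s R Q (U - R - Q))"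
    proof (rule sum.reindex_bij_witness[of _ "\<lambda>(R, Q). (R \<union> Q, R)" "\<lambda>(S, R). (R, S - R)"])
      fix x assume "x \<in> Sigma (Pow U) Pow"
      then obtain S R where x: "x = (S, R)" "R \<subseteq> S" "S \<subseteq> U" by auto
      then have "U - R - (S - R) = U - S" "R \<union> (S - R) = S" by auto
      then show "(case case x of (S, R) \<Rightarrow> (R, S - R) of (R, Q) \<Rightarrow> ?s R Q (U - R - Q)) =
          (case x of (S, R) \<Rightarrow> ?s R (S - R) (U - S))"
        "(case case x of (S, R) \<Rightarrow> (R, S - R) of (R, Q) \<Rightarrow> (R \<union> Q, R)) = x"
        "(case x of (S, R) \<Rightarrow> (R, S - R)) \<in> Sigma (Pow U) (\<lambda>R. Pow (U - R))"
        using x by auto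
    next
      fix y assume "y \<in> Sigma (Pow U) (\<lambda>R. Pow (U - R))"
      then show "(case case y of (R, Q) \<Rightarrow> (R \<union> Q, R) of (S, R) \<Rightarrow> (R, S - R)) = y"
        "(case y of (R, Q) \<Rightarrow> (R \<union> Q, R)) \<in> Sigma (Pow U) Pow" by auto
    qed
    also have "\<dots> = (\<Sum>R\<in>Pow U. \<Sum>Q\<in>Pow (U - R). ?s R Q (U - R - Q))"
      using fin by (intro sum.Sigma[symmetric]) (auto intro: finite_subset)
    also have "\<dots> = wedge a (wedge b c) U"
      unfolding wedge_def sum_distrib_left sum_distrib_right
    proof (intro sum.cong refl)
      fix R Q assume "R \<in> Pow U" "Q \<in> Pow (U - R)"
      then have "finite R" "finite Q" "finite (U - R - Q)" "Q \<union> (U - R - Q) = U - R"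
        using fin by (auto intro: finite_subset)
      then have "ninv R (U - R) = ninv R Q + ninv R (U - R - Q)"
        using ninv_Un_right[of R Q "U - R - Q"] by auto
      then show "?s R Q (U - R - Q) = wedge_sign R (U - R) * a R *
          (wedge_sign Q (U - R - Q) * b Q * c (U - R - Q))"
        by (simp add: wedge_sign_ninv power_add)
    qed
    finally show ?thesis .
  qed
qed

lemma wedge_delta:
  assumes "finite S" "finite T"
  shows "wedge (delta S) (delta T) =
    (if S \<inter> T = {} then (\<lambda>U. wedge_sign S T * delta (S \<union> T) U) else (\<lambda>U. 0))"
proof
  fix U
  have *: "wedge (delta S) (delta T) U =
    (\<Sum>R\<in>Pow U. if R = S then wedge_sign S (U - S) * delta T (U - S) else 0)"
    unfolding wedge_def by (rule sum.cong) (auto simp: delta_def)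
  show "wedge (delta S) (delta T) U =
    (if S \<inter> T = {} then (\<lambda>U. wedge_sign S T * delta (S \<union> T) U) else (\<lambda>U. 0)) U"
  proof (cases "finite U")
    case False
    then show ?thesis using assms by (auto simp: wedge_infinite delta_def)
  next
    case True
    have "S \<subseteq> U \<and> U - S = T \<longleftrightarrow> S \<inter> T = {} \<and> U = S \<union> T" by auto
    then show ?thesis using True unfolding * by (auto simp: delta_def)
  qed
qed

lemma ext_empty_left: assumes "finite U" shows "wedge (delta {}) a U = a U"
proof -
  have "wedge (delta {}) a U = (\<Sum>R\<in>Pow U. if R = {} then a U else 0)"
    unfolding wedge_def by (rule sum.cong) (auto simp: delta_def wedge_sign_ninv ninv_eq_0)
  then show ?thesis using assms by simp
qed

text \<open>If the \<open>w i\<close> anticommute, this is the algebra map from the exterior algebra sending \<open>e i\<close>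
  to \<open>w i\<close>.\<close>

definition hat :: "nat \<Rightarrow> (nat \<Rightarrow> 'x lop) \<Rightarrow> (nat set \<Rightarrow> complex) \<Rightarrow> 'x lop" where
  "hat n w a = (\<Sum>S\<in>Pow {..<n}. cscale (a S) * altprod w S)"

definition anticommuting :: "nat \<Rightarrow> (nat \<Rightarrow> 'x lop) \<Rightarrow> bool" where
  "anticommuting n w \<longleftrightarrow> (\<forall>i<n. \<forall>j<n. w i * w j = - (w j * w i))"

lemma app_hat: "app (hat n w a) v = lin_ext (Pow {..<n}) (\<lambda>S. app (altprod w S) v) a"
  by (simp add: hat_def lin_ext_def app_sum fun_eq_iff)

lemma hat_cong: "(\<And>i. i < n \<Longrightarrow> w i = w' i) \<Longrightarrow> hat n w a = hat n w' a"
  unfolding hat_def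
  by (intro sum.cong refl arg_cong2[of _ _ _ _ "(*)"] altprod_cong) (auto intro: finite_subset)

lemma hat_sum: "hat n w (\<lambda>S. \<Sum>i\<in>I. c i * a i S) = (\<Sum>i\<in>I. cscale (c i) * hat n w (a i))"
proof (induction I rule: infinite_finite_induct)
  case (insert i I)
  have "hat n w (\<lambda>S. c i * a i S + (\<Sum>i\<in>I. c i * a i S)) =
      cscale (c i) * hat n w (a i) + hat n w (\<lambda>S. \<Sum>i\<in>I. c i * a i S)"
    by (simp add: hat_def cscale_add cscale_mult distrib_right sum.distrib sum_distrib_left
      mult.assoc)
  then show ?case using insert by simp
qed (simp_all add: hat_def)

lemma hat_delta:
  assumes "S \<subseteq> {..<n}" shows "hat n w (delta S) = altprod w S"
proof -
  have "hat n w (delta S) = (\<Sum>T\<in>Pow {..<n}. if T = S then altprod w S else 0)"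
    unfolding hat_def by (rule sum.cong) (auto simp: delta_def)
  then show ?thesis using assms by simp
qed

lemma hat_ext_vec:
  assumes "dim_vec v = n"
  shows "hat n w (ext_vec v) = (\<Sum>i<n. cscale (v $ i) * w i)"
  using assms by (simp add: ext_vec_def hat_sum hat_delta)

lemma cscale_sign: "cscale ((- 1) ^ k) = (- 1) ^ k"
proof (induction k)
  case (Suc k)
  have "cscale (-1) = (-1 :: 'a lop)" by (rule lop_eqI) (simp add: fun_eq_iff)
  then have "cscale ((- 1) * (- 1) ^ k) = (- 1) * (- 1 :: 'a lop) ^ k"
    using Suc by (simp only: cscale_mult)
  then show ?case by simp
qed simp

text \<open>By \<open>altprod_mult\<close> only disjoint pairs survive in the product of the two
  sums; grouping them by their union \<open>U\<close> gives exactly the coefficients of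
  \<open>wedge\<close>.\<close>

lemma hat_mult:
  assumes anti: "anticommuting n w"
  shows "hat n w (wedge a b) = hat n w a * hat n w b"
proof -
  let ?E = "Pow {..<n}"
  let ?t = "\<lambda>S T. cscale (wedge_sign S T * a S * b T) * altprod w (S \<union> T)"
  have fin: "finite S" if "S \<subseteq> {..<n}" for S using that finite_subset by blast
  have sq: "w i * w i = 0" if "i < n" for i
    using anti that unfolding anticommuting_def by (intro lop_double_eq_0) blast
  have "hat n w a * hat n w b = (\<Sum>S\<in>?E. \<Sum>T\<in>?E. cscale (a S) * altprod w S * (cscale (b T) *
    altprod w T))"
    by (simp add: hat_def sum_distrib_left sum_distrib_right) (rule sum.swap)
  also have "\<dots> = (\<Sum>S\<in>?E. \<Sum>T\<in>?E. if S \<inter> T = {} then ?t S T else 0)"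
  proof (intro sum.cong refl)
    fix S T assume ST: "S \<in> ?E" "T \<in> ?E"
    have "cscale (a S) * altprod w S * (cscale (b T) * altprod w T) =
        cscale (a S * b T) * (altprod w S * altprod w T)"
      by (simp add: cscale_mult mult.assoc) (metis cscale_commute mult.assoc)
    also have "altprod w S * altprod w T =
        (if S \<inter> T = {} then (- 1) ^ ninv S T * altprod w (S \<union> T) else 0)"
      by (rule altprod_mult[of _ _ "{..<n}"])
         (use ST fin sq in simp_all, use anti in \<open>unfold anticommuting_def, blast\<close>)
    finally have *: "cscale (a S) * altprod w S * (cscale (b T) * altprod w T) =
      cscale (a S * b T) * (if S \<inter> T = {} then (- 1) ^ ninv S T * altprod w (S \<union> T) else 0)" .
    have "wedge_sign S T * a S * b T = a S * b T * (- 1) ^ ninv S T"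
      by (simp add: wedge_sign_ninv)
    then have "cscale (wedge_sign S T * a S * b T) = cscale (a S * b T) * (- 1 :: 'a lop) ^ ninv S T"
      by (simp only: cscale_mult cscale_sign)
    then show "cscale (a S) * altprod w S * (cscale (b T) * altprod w T) =
        (if S \<inter> T = {} then ?t S T else 0)"
      unfolding * by (simp add: mult.assoc)
  qed
  also have "\<dots> = (\<Sum>(S, T)\<in>?E \<times> ?E. if S \<inter> T = {} then ?t S T else 0)"
    by (simp add: sum.cartesian_product)
  also have "\<dots> = (\<Sum>(S, T)\<in>{(S, T). S \<in> ?E \<and> T \<in> ?E \<and> S \<inter> T = {}}. ?t S T)"
    by (rule sum.mono_neutral_cong_right) (auto split: if_splits)
  also have "\<dots> = (\<Sum>(U, S)\<in>Sigma ?E Pow. ?t S (U - S))"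
  proof (rule sum.reindex_bij_witness[of _ "\<lambda>(U, S). (S, U - S)" "\<lambda>(S, T). (S \<union> T, S)"])
    fix x assume "x \<in> {(S, T). S \<in> ?E \<and> T \<in> ?E \<and> S \<inter> T = {}}"
    then obtain S T where x: "x = (S, T)" "S \<subseteq> {..<n}" "T \<subseteq> {..<n}" "S \<inter> T = {}" by auto
    then have "S \<union> T - S = T" by auto
    then show "(case case x of (S, T) \<Rightarrow> (S \<union> T, S) of (U, S) \<Rightarrow> (S, U - S)) = x"
      "(case x of (S, T) \<Rightarrow> (S \<union> T, S)) \<in> Sigma ?E Pow"
      "(case case x of (S, T) \<Rightarrow> (S \<union> T, S) of (U, S) \<Rightarrow> ?t S (U - S)) = (case x of (S, T) \<Rightarrow> ?t S T)"
      using x by auto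
  next
    fix y assume "y \<in> Sigma ?E Pow"
    then obtain U S where y: "y = (U, S)" "U \<subseteq> {..<n}" "S \<subseteq> U" by auto
    then have "S \<union> (U - S) = U" by auto
    then show "(case case y of (U, S) \<Rightarrow> (S, U - S) of (S, T) \<Rightarrow> (S \<union> T, S)) = y"
      "(case y of (U, S) \<Rightarrow> (S, U - S)) \<in> {(S, T). S \<in> ?E \<and> T \<in> ?E \<and> S \<inter> T = {}}"
      using y by auto
  qed
  also have "\<dots> = (\<Sum>U\<in>?E. \<Sum>S\<in>Pow U. ?t S (U - S))"
    using fin by (intro sum.Sigma[symmetric]) auto
  also have "\<dots> = (\<Sum>U\<in>?E. cscale (wedge a b U) * altprod w U)"
  proof (intro sum.cong refl)
    fix U assume U: "U \<in> ?E"
    have cs: "cscale (sum h I) = (\<Sum>i\<in>I. cscale (h i))" for h :: "nat set \<Rightarrow> complex" and I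
      by (induction I rule: infinite_finite_induct) (simp_all add: cscale_add)
    show "(\<Sum>S\<in>Pow U. ?t S (U - S)) = cscale (wedge a b U) * altprod w U"
      unfolding wedge_def cs sum_distrib_right by (rule sum.cong) (auto simp: Un_absorb1)
  qed
  finally show ?thesis by (simp add: hat_def)
qed

section \<open>The action of matrices on the exterior algebra\<close>

definition wedge_op :: "(nat set \<Rightarrow> complex) \<Rightarrow> nat set lop" where
  "wedge_op a = Lop (wedge a)"

lemma app_wedge_op [simp]: "app (wedge_op a) = wedge a"
  by (simp add: wedge_op_def Lop_inverse clin_wedge2)

lemma wedge_op_sum:
  "wedge_op (\<lambda>S. \<Sum>i\<in>I. c i * a i S) = (\<Sum>i\<in>I. cscale (c i) * wedge_op (a i))"
  by (rule lop_eqI) (simp add: fun_eq_iff app_sum clin_sum[OF clin_wedge1])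

lemma wedge_delta_single_anti:
  "wedge (delta {i}) (delta {j}) = (\<lambda>U. - wedge (delta {j}) (delta {i}) U)"
proof -
  have "ninv {i} {j} = 0" if "i < j" for i j using that by (intro ninv_eq_0) auto
  then show ?thesis
    by (cases i j rule: linorder_cases)
      (auto simp: wedge_delta wedge_sign_ninv ninv_single_less insert_commute)
qed

lemma wedge_ext_vec_anti: "wedge (ext_vec v) (ext_vec w) = (\<lambda>U. - wedge (ext_vec w) (ext_vec v) U)"
proof
  fix U
  have exp: "wedge (ext_vec v) (ext_vec w) U =
    (\<Sum>i<dim_vec v. \<Sum>j<dim_vec w. v $ i * (w $ j * wedge (delta {i}) (delta {j}) U))" for v w
    unfolding ext_vec_def clin_sum[OF clin_wedge1] clin_sum[OF clin_wedge2] sum_distrib_left ..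
  show "wedge (ext_vec v) (ext_vec w) U = - wedge (ext_vec w) (ext_vec v) U"
    unfolding exp sum_negf[symmetric]
    by (subst sum.swap) (intro sum.cong refl, subst wedge_delta_single_anti, simp)
qed

lemma anticommuting_ext_vec: "anticommuting n (\<lambda>i. wedge_op (ext_vec (v i)))"
  unfolding anticommuting_def
proof (intro allI impI lop_eqI)
  fix i j a
  have "wedge (wedge (ext_vec (v i)) (ext_vec (v j))) a =
    (\<lambda>U. - wedge (wedge (ext_vec (v j)) (ext_vec (v i))) a U)"
    by (subst wedge_ext_vec_anti) (rule clin_uminus[OF clin_wedge1])
  then show "app (wedge_op (ext_vec (v i)) * wedge_op (ext_vec (v j))) a =
    app (- (wedge_op (ext_vec (v j)) * wedge_op (ext_vec (v i)))) a"
    by (simp add: fun_eq_iff wedge_assoc)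
qed

text \<open>Left multiplications by vectors anticommute, so \<open>ext_act\<close> is an instance of
  \<open>hat\<close> evaluated at the unit \<open>delta {}\<close>, and its multiplicativity can be
  drawn from \<open>hat_mult\<close>.\<close>

lemma ext_act_hat: "ext_act n R a = app (hat n (\<lambda>i. wedge_op (ext_vec (col R i))) a) (delta {})"
  by (simp add: app_hat ext_act_def altprod_def app_prod_list)

lemma clin_ext_act: "clin (ext_act n R)"
  unfolding ext_act_def by (rule clin_lin_ext)

lemma ext_act_delta:
  "S \<subseteq> {..<n} \<Longrightarrow> ext_act n R (delta S) =
     foldr (\<lambda>i. wedge (ext_vec (col R i))) (sorted_list_of_set S) (delta {})"
  by (simp add: ext_act_def lin_ext_delta)

lemma hat_foldr_wedge:
  assumes "anticommuting n w"
  shows "hat n w (foldr (\<lambda>i. wedge (x i)) l (delta {})) = prod_list (map (\<lambda>i. hat n w (x i)) l)"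
  by (induction l) (simp_all add: hat_mult[OF assms] hat_delta)

text \<open>Two algebra maps on the exterior algebra that agree on vectors are equal. This yields
  the functoriality of \<open>ext_act\<close> and, with \<open>w\<close> the coproducts of the basis
  vectors, its compatibility with the coproduct.\<close>

lemma hat_ext_act:
  assumes "anticommuting n w" "R \<in> carrier_mat n n"
  shows "hat n w (ext_act n R a) = hat n (\<lambda>i. \<Sum>k<n. cscale (R $$ (k, i)) * w k) a"
proof -
  have "hat n w (ext_act n R a) =
    (\<Sum>S\<in>Pow {..<n}. cscale (a S) * altprod (\<lambda>i. hat n w (ext_vec (col R i))) S)"
    by (simp add: ext_act_def lin_ext_def hat_sum hat_foldr_wedge[OF assms(1)] altprod_def)
  also have "\<dots> = hat n (\<lambda>i. hat n w (ext_vec (col R i))) a" by (simp add: hat_def)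
  also have "\<dots> = hat n (\<lambda>i. \<Sum>k<n. cscale (R $$ (k, i)) * w k) a"
    using assms(2) by (intro hat_cong) (simp add: hat_ext_vec)
  finally show ?thesis .
qed

lemma ext_vec_vspace: "dim_vec v = n \<Longrightarrow> ext_vec v \<in> vspace (Pow {..<n})"
  by (auto simp: ext_vec_def vspace_def delta_def intro!: sum.neutral)

lemma wedge_vspace:
  assumes "a \<in> vspace (Pow {..<n})" "b \<in> vspace (Pow {..<n})"
  shows "wedge a b \<in> vspace (Pow {..<n})"
proof -
  have "wedge_sign S (U - S) * a S * b (U - S) = 0" if "\<not> U \<subseteq> {..<n}" "S \<subseteq> U" for S U
  proof -
    have "\<not> S \<subseteq> {..<n} \<or> \<not> U - S \<subseteq> {..<n}" using that by blast
    then have "a S = 0 \<or> b (U - S) = 0" using assms unfolding vspace_def by blast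
    then show ?thesis by auto
  qed
  then show ?thesis by (simp add: vspace_def wedge_def sum.neutral)
qed

lemma wedge_empty_left: "a \<in> vspace (Pow {..<n}) \<Longrightarrow> wedge (delta {}) a = a"
proof
  fix U assume a: "a \<in> vspace (Pow {..<n})"
  show "wedge (delta {}) a U = a U"
  proof (cases "finite U")
    case False
    then have "a U = 0" using a finite_subset[of U "{..<n}"] by (auto simp: vspace_def)
    then show ?thesis using False by (simp add: wedge_infinite)
  qed (rule ext_empty_left)
qed

lemma foldr_wedge_vspace:
  assumes "\<And>i. i \<in> set l \<Longrightarrow> x i \<in> vspace (Pow {..<n})"
  shows "foldr (\<lambda>i. wedge (x i)) l (delta {}) \<in> vspace (Pow {..<n})"
  using assms by (induction l) (auto intro: wedge_vspace)

lemma ext_act_vspace: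
  assumes "R \<in> carrier_mat n n" shows "ext_act n R a \<in> vspace (Pow {..<n})"
  unfolding ext_act_def
  by (rule lin_ext_vspace, rule foldr_wedge_vspace, rule ext_vec_vspace) (use assms in auto)

lemma ext_act_wedge:
  assumes R: "R \<in> carrier_mat n n"
  shows "ext_act n R (wedge a b) = wedge (ext_act n R a) (ext_act n R b)"
proof -
  let ?w = "\<lambda>i. wedge_op (ext_vec (col R i))"
  \<comment> \<open>Left multiplications commute with the right multiplication by
    \<open>v\<close>.\<close>
  have *: "app (prod_list (map ?w l)) (wedge u v) = wedge (app (prod_list (map ?w l)) u) v" for l u v
    by (induction l) (simp_all add: wedge_assoc)
  have **: "app (hat n ?w a) (wedge u v) = wedge (app (hat n ?w a) u) v" for u v
    using clin_sum[OF clin_wedge1, where I="Pow {..<n}"]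
    by (simp add: app_hat lin_ext_def altprod_def *)
  have "ext_act n R (wedge a b) = app (hat n ?w a) (ext_act n R b)"
    by (simp add: ext_act_hat hat_mult anticommuting_ext_vec)
  \<comment> \<open>With the unit inserted, \<open>ext_act n R b\<close> becomes a right factor that
    can be pulled out of the operator.\<close>
  also have "\<dots> = app (hat n ?w a) (wedge (delta {}) (ext_act n R b))"
    unfolding wedge_empty_left[OF ext_act_vspace[OF R]] ..
  also have "\<dots> = wedge (ext_act n R a) (ext_act n R b)"
    unfolding ** by (simp add: ext_act_hat)
  finally show ?thesis .
qed

lemma ext_act_comp:
  assumes "R \<in> carrier_mat n n" "R' \<in> carrier_mat n n"
  shows "ext_act n R (ext_act n R' a) = ext_act n (R * R') a"
proof -
  have "hat n (\<lambda>i. wedge_op (ext_vec (col R i))) (ext_act n R' a) =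
    hat n (\<lambda>i. \<Sum>k<n. cscale (R' $$ (k, i)) * wedge_op (ext_vec (col R k))) a"
    using assms by (intro hat_ext_act anticommuting_ext_vec)
  also have "\<dots> = hat n (\<lambda>i. wedge_op (ext_vec (col (R * R') i))) a"
  proof (rule hat_cong)
    fix i assume i: "i < n"
    have "ext_vec (col (R * R') i) = (\<lambda>S. \<Sum>k<n. R' $$ (k, i) * ext_vec (col R k) S)"
    proof
      fix S
      have "(\<Sum>k<n. R' $$ (k, i) * ext_vec (col R k) S) =
        (\<Sum>k<n. \<Sum>j<n. R' $$ (k, i) * (R $$ (j, k) * delta {j} S))"
        using assms by (simp add: ext_vec_def sum_distrib_left)
      also have "\<dots> = (\<Sum>j<n. (\<Sum>k<n. R $$ (j, k) * R' $$ (k, i)) * delta {j} S)"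
        by (subst sum.swap) (simp add: sum_distrib_right mult.assoc mult.left_commute)
      also have "\<dots> = ext_vec (col (R * R') i) S"
        using assms i by (simp add: ext_vec_def scalar_prod_def atLeast0LessThan)
      finally show "ext_vec (col (R * R') i) S = (\<Sum>k<n. R' $$ (k, i) * ext_vec (col R k) S)" ..
    qed
    then show "(\<Sum>k<n. cscale (R' $$ (k, i)) * wedge_op (ext_vec (col R k))) =
        wedge_op (ext_vec (col (R * R') i))" by (simp add: wedge_op_sum)
  qed
  finally show ?thesis by (simp add: ext_act_hat)
qed

lemma foldr_wedge_singletons:
  "finite S \<Longrightarrow> foldr (\<lambda>i. wedge (delta {i})) (sorted_list_of_set S) (delta {}) = delta S"
proof (induction S rule: finite_linorder_min_induct)
  case (insert b A)
  have "ninv {b} A = 0" "b \<notin> A" using insert.hyps by (auto intro!: ninv_eq_0 intro: less_imp_le)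
  moreover have "sorted_list_of_set (insert b A) = b # sorted_list_of_set A"
    using insert.hyps by (intro sorted_list_of_set_insert_min) auto
  ultimately show ?case
    using insert.IH insert.hyps
    by (simp add: wedge_delta wedge_sign_ninv del: sorted_list_of_set_insert)
qed simp

lemma ext_vec_unit: "i < n \<Longrightarrow> ext_vec (unit_vec n i) = delta {i}"
proof
  fix S assume "i < n"
  have "ext_vec (unit_vec n i) S = (\<Sum>k<n. if k = i then delta {i} S else 0)"
    unfolding ext_vec_def by (rule sum.cong) (auto simp: unit_vec_def)
  then show "ext_vec (unit_vec n i) S = delta {i} S" using \<open>i < n\<close> by simp
qed

lemma ext_act_one:
  assumes "a \<in> vspace (Pow {..<n})" shows "ext_act n (1\<^sub>m n) a = a"
proof (rule clin_eqI[OF clin_ext_act clin_id _ _ assms])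
  fix S assume S: "S \<in> Pow {..<n}"
  then have f: "finite S" using finite_subset by auto
  have "foldr (\<lambda>i. wedge (ext_vec (col (1\<^sub>m n) i))) (sorted_list_of_set S) (delta {}) =
    foldr (\<lambda>i. wedge (delta {i})) (sorted_list_of_set S) (delta {})"
    by (rule foldr_cong) (use S f ext_vec_unit in auto)
  then show "ext_act n (1\<^sub>m n) (delta S) = delta S"
    using S f by (simp add: ext_act_delta foldr_wedge_singletons)
qed simp

lemma ext_act_empty: "ext_act n R (delta {}) = delta {}"
  by (simp add: ext_act_delta)

text \<open>Infinite sets have \<open>card\<close> 0 and would otherwise pass as having degree
  0.\<close>

definition homog :: "nat \<Rightarrow> (nat set \<Rightarrow> complex) \<Rightarrow> bool" where
  "homog k a \<longleftrightarrow> (\<forall>S. a S \<noteq> 0 \<longrightarrow> finite S \<and> card S = k)"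

lemma homog_wedge:
  assumes "homog j a" "homog k b" shows "homog (j + k) (wedge a b)"
  unfolding homog_def
proof (intro allI impI)
  fix U assume *: "wedge a b U \<noteq> 0"
  then have fin: "finite U" using wedge_infinite by blast
  from * obtain S where S: "S \<subseteq> U" "a S \<noteq> 0" "b (U - S) \<noteq> 0"
    unfolding wedge_def
    by (metis (no_types, lifting) PowD mult_eq_0_iff sum.neutral)
  then have "card S = j" "card (U - S) = k" using assms by (auto simp: homog_def)
  moreover have "card U = card S + card (U - S)"
    using card_Un_disjoint[of S "U - S"] S fin finite_subset[of S U] by (simp add: Un_absorb1)
  ultimately show "finite U \<and> card U = j + k" using fin by simp
qed

lemma homog_delta: "finite S \<Longrightarrow> homog (card S) (delta S)"
  by (auto simp: homog_def delta_def)

lemma homog_ext_vec: "homog 1 (ext_vec v)"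
  unfolding homog_def
proof (intro allI impI)
  fix S assume "ext_vec v S \<noteq> 0"
  then obtain i where "delta {i} S \<noteq> 0"
    unfolding ext_vec_def by (metis (no_types, lifting) mult_zero_right sum.neutral)
  then show "finite S \<and> card S = 1" by (auto simp: delta_def split: if_splits)
qed

lemma homog_ext_act_delta:
  assumes "S \<subseteq> {..<n}" shows "homog (card S) (ext_act n R (delta S))"
proof -
  have "homog (length l) (foldr (\<lambda>i. wedge (ext_vec (col R i))) l (delta {}))" for l
  proof (induction l)
    case (Cons i l)
    then show ?case using homog_wedge[OF homog_ext_vec Cons.IH] by simp
  qed (use homog_delta[of "{}"] in simp)
  from this[of "sorted_list_of_set S"] show ?thesis
    using assms finite_subset[of S "{..<n}"] by (simp add: ext_act_delta)
qed

lemma wedge_at_empty: "wedge a b {} = a {} * b {}"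
  by (simp add: wedge_def wedge_sign_ninv)

text \<open>\<open>ext_act\<close> preserves degrees and fixes the unit.\<close>

lemma ext_act_at_empty: "ext_act n R a {} = a {}"
proof -
  have "ext_act n R a {} = (\<Sum>S\<in>Pow {..<n}. a S * (if S = {} then 1 else 0))"
    unfolding ext_act_def lin_ext_def
  proof (intro sum.cong refl)
    fix S assume S: "S \<in> Pow {..<n}"
    have fS: "finite S" using S finite_subset by blast
    have "ext_act n R (delta S) {} = (if S = {} then 1 else 0)"
    proof (cases "S = {}")
      case False
      then have "card {} \<noteq> card S" using fS by simp
      then show ?thesis using homog_ext_act_delta[of S n R] S False unfolding homog_def by auto
    qed (simp add: ext_act_empty)
    then show "a S * foldr (\<lambda>i. wedge (ext_vec (col R i))) (sorted_list_of_set S) (delta {}) {} =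
        a S * (if S = {} then 1 else 0)"
      using S by (simp add: ext_act_delta)
  qed
  also have "\<dots> = (\<Sum>S\<in>Pow {..<n}. if S = {} then a {} else 0)" by (intro sum.cong) auto
  finally show ?thesis by simp
qed

lemma ext_act_single:
  assumes "i < n" "R \<in> carrier_mat n n" shows "ext_act n R (delta {i}) = ext_vec (col R i)"
proof -
  have "ext_act n R (delta {i}) = app (wedge_op (ext_vec (col R i))) (delta {})"
    using assms by (simp add: ext_act_delta)
  also have "\<dots> = ext_vec (col R i)"
  proof -
    have "wedge (delta {j}) (delta {}) = delta {j}" for j
      by (simp add: wedge_delta wedge_sign_ninv)
    then show ?thesis by (simp add: ext_vec_def clin_sum[OF clin_wedge1])
  qed
  finally show ?thesis .
qed

section \<open>The algebra \<open>\<complex>[G] \<ltimes> \<Lambda>V\<close> and its super tensor square\<close>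

lemma bilin_vspaceI:
  assumes "\<And>b. clin (\<lambda>a. m a b)" "\<And>a. clin (m a)" "finite X" "finite Y"
    "\<And>a b. a \<in> X \<Longrightarrow> b \<in> Y \<Longrightarrow> m (delta a) (delta b) \<in> vspace Z"
    "x \<in> vspace X" "y \<in> vspace Y"
  shows "m x y \<in> vspace Z"
proof -
  have "m (delta a) y \<in> vspace Z" if "a \<in> X" for a
    by (rule clin_vspaceI[OF assms(2) assms(4) _ assms(7)]) (use assms(5) that in auto)
  then show ?thesis
    by (rule clin_vspaceI[OF assms(1) assms(3) _ assms(6)])
qed

lemma bilin_eqI:
  assumes "\<And>b. clin (\<lambda>a. m a b)" "\<And>a. clin (m a)" "\<And>b. clin (\<lambda>a. m' a b)" "\<And>a. clin (m' a)"
    "finite X" "finite Y"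
    "\<And>a b. a \<in> X \<Longrightarrow> b \<in> Y \<Longrightarrow> m (delta a) (delta b) = m' (delta a) (delta b)"
    "x \<in> vspace X" "y \<in> vspace Y"
  shows "m x y = m' x y"
proof -
  have "m (delta a) y = m' (delta a) y" if "a \<in> X" for a
    by (rule clin_eqI[OF assms(2) assms(4) assms(6) _ assms(9)]) (use assms(7) that in auto)
  then show ?thesis
    by (rule clin_eqI[OF assms(1) assms(3) assms(5) _ assms(8)])
qed

text \<open>The element g a for any \<open>a\<close> in the exterior algebra. With it the product
  formula \<open>sm_gx\<close> can be iterated, since \<open>act (inv h)\<close> does not send basis
  elements to basis elements.\<close>

definition gx :: "'g \<Rightarrow> (nat set \<Rightarrow> complex) \<Rightarrow> 'g \<times> nat set \<Rightarrow> complex" where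
  "gx g a = (\<lambda>(k, U). if k = g then a U else 0)"

lemma clin_gx: "clin (gx g)"
  by (rule clinI) (auto simp: gx_def split: prod.split)

lemma gx_delta: "gx g (delta S) = delta (g, S)"
  by (auto simp: gx_def delta_def)

lemma gx_apply [simp]: "gx g a (k, U) = (if k = g then a U else 0)"
  by (simp add: gx_def)

text \<open>Only the parity of \<open>q\<close> matters: \<open>vspace (par_basis G n q)\<close> is the even or the odd part of
  the superalgebra.\<close>

definition par_basis :: "('g, 'm) monoid_scheme \<Rightarrow> nat \<Rightarrow> nat \<Rightarrow> ('g \<times> nat set) set" where
  "par_basis G n q = {b \<in> sbasis G n. even (card (snd b)) = even q}"

lemma vspace_mono: "x \<in> vspace X \<Longrightarrow> X \<subseteq> Y \<Longrightarrow> x \<in> vspace Y"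
  by (auto simp: vspace_def)

lemma delta_par: "b \<in> sbasis G n \<Longrightarrow> delta b \<in> vspace (par_basis G n (card (snd b)))"
  by (simp add: par_basis_def)

locale gv = group G for G :: "('g, 'm) monoid_scheme" (structure) +
  fixes n :: nat and \<rho> :: "'g \<Rightarrow> complex mat"
  assumes finG: "finite (carrier G)" and rep: "matrix_rep G n \<rho>"
begin

abbreviation X where "X \<equiv> sbasis G n"
abbreviation E where "E \<equiv> Pow {..<n}"
abbreviation sm (infixl "\<star>" 70) where "sm \<equiv> smult_alg G n \<rho>"
abbreviation sup (infixl "\<diamondop>" 70) where "sup \<equiv> super_mult G n \<rho>"
abbreviation act where "act g \<equiv> ext_act n (\<rho> g)"

lemma finX: "finite X" and finXX: "finite (X \<times> X)"
  by (simp_all add: sbasis_def finG)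

lemma rep_carrier [simp]: "g \<in> carrier G \<Longrightarrow> \<rho> g \<in> carrier_mat n n"
  using rep by (simp add: matrix_rep_def)

lemma rep_one: "\<rho> \<one> = 1\<^sub>m n"
  using rep by (simp add: matrix_rep_def)

lemma rep_mult: "g \<in> carrier G \<Longrightarrow> h \<in> carrier G \<Longrightarrow> \<rho> (g \<otimes> h) = \<rho> g * \<rho> h"
  using rep by (simp add: matrix_rep_def)

lemma clin_sm2: "clin (sm x)"
proof (rule clinI, clarify)
  fix c k U and a b :: "'g \<times> nat set \<Rightarrow> complex"
  show "sm x (\<lambda>x. c * a x + b x) (k, U) = c * sm x a (k, U) + sm x b (k, U)"
    unfolding smult_alg_def prod.case sum_distrib_left sum.distrib[symmetric]
    by (intro sum.cong refl) (auto simp: clinD[OF clin_wedge2])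
qed

lemma clin_sm1: "clin (\<lambda>x. sm x y)"
proof (rule clinI, clarify)
  fix c k U and a b :: "'g \<times> nat set \<Rightarrow> complex"
  show "sm (\<lambda>x. c * a x + b x) y (k, U) = c * sm a y (k, U) + sm b y (k, U)"
    unfolding smult_alg_def prod.case sum_distrib_left sum.distrib[symmetric]
    by (intro sum.cong refl) (auto simp: clinD[OF clin_ext_act] clinD[OF clin_wedge1])
qed

lemma sm_gx:
  assumes "g \<in> carrier G" "h \<in> carrier G"
  shows "gx g a \<star> gx h b = gx (g \<otimes> h) (wedge (act (inv h) a) b)"
proof (rule ext, clarify)
  fix k U
  let ?P = "{(g, h). g \<in> carrier G \<and> h \<in> carrier G \<and> g \<otimes> h = k}"
  have fin: "finite ?P" by (rule finite_subset[of _ "carrier G \<times> carrier G"]) (auto simp: finG)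
  have sec: "(\<lambda>S. gx g' a (g, S)) = (if g = g' then a else (\<lambda>_. 0))" for g g' :: 'g and a
    by (auto simp: fun_eq_iff)
  have "(gx g a \<star> gx h b) (k, U) =
    (\<Sum>p\<in>?P. if p = (g, h) then wedge (act (inv h) a) b U else 0)"
    unfolding smult_alg_def prod.case
    by (rule sum.cong) (auto simp del: gx_apply simp: sec clin_zero[OF clin_ext_act] clin_zero[OF
      clin_wedge1] clin_zero[OF clin_wedge2] split: if_split_asm)
  then show "(gx g a \<star> gx h b) (k, U) = gx (g \<otimes> h) (wedge (act (inv h) a) b) (k, U)"
    using fin assms by auto
qed

lemma sm_delta:
  assumes "(g, S) \<in> X" "(h, T) \<in> X"
  shows "delta (g, S) \<star> delta (h, T) = gx (g \<otimes> h) (wedge (act (inv h) (delta S)) (delta T))"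
  using assms by (simp add: gx_delta[symmetric] sm_gx sbasis_def)

lemma sm_delta_deg:
  assumes "a \<in> X" "b \<in> X"
  shows "delta a \<star> delta b \<in> vspace {c \<in> X. card (snd c) = card (snd a) + card (snd b)}"
proof -
  obtain g S h T where ab: "a = (g, S)" "b = (h, T)" by (cases a, cases b)
  then have c: "g \<in> carrier G" "h \<in> carrier G" "S \<subseteq> {..<n}" "T \<subseteq> {..<n}"
    using assms by (auto simp: sbasis_def)
  let ?w = "wedge (act (inv h) (delta S)) (delta T)"
  have "?w \<in> vspace E" using c by (intro wedge_vspace ext_act_vspace) auto
  moreover have "homog (card S + card T) ?w"
    using c finite_subset[of T "{..<n}"] by (intro homog_wedge homog_ext_act_delta homog_delta) auto
  ultimately show ?thesis
    using c unfolding ab sm_delta[OF assms[unfolded ab]]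
    by (auto simp: vspace_def sbasis_def homog_def)
qed

lemma sm_delta_par:
  assumes "a \<in> X" "b \<in> X"
  shows "delta a \<star> delta b \<in> vspace (par_basis G n (card (snd a) + card (snd b)))"
  using sm_delta_deg[OF assms] by (rule vspace_mono) (auto simp: par_basis_def)

lemma sm_vspace:
  assumes "x \<in> vspace X" "y \<in> vspace X" shows "x \<star> y \<in> vspace X"
  by (rule bilin_vspaceI[OF clin_sm1 clin_sm2 finX finX _ assms])
    (rule vspace_mono[OF sm_delta_deg]; auto)

text \<open>In both bracketings the product of g a, h b and k c is g h k times the wedge product of
  (h k)^-1 a, k^-1 b and c.\<close>

lemma sm_assoc:
  assumes "x \<in> vspace X" "y \<in> vspace X" "z \<in> vspace X"
  shows "(x \<star> y) \<star> z = x \<star> (y \<star> z)"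
proof -
  have 1: "(delta a \<star> delta b) \<star> delta c = delta a \<star> (delta b \<star> delta c)"
    if abc: "a \<in> X" "b \<in> X" "c \<in> X" for a b c
  proof -
    obtain g S h T k U where e: "a = (g, S)" "b = (h, T)" "c = (k, U)" by (cases a, cases b, cases c)
    then have c: "g \<in> carrier G" "h \<in> carrier G" "k \<in> carrier G"
      using abc by (auto simp: sbasis_def)
    then show ?thesis
      unfolding e gx_delta[symmetric]
      by (simp add: sm_gx ext_act_wedge ext_act_comp wedge_assoc inv_mult_group rep_mult m_assoc)
  qed
  have 2: "(delta a \<star> delta b) \<star> z = delta a \<star> (delta b \<star> z)" if "a \<in> X" "b \<in> X" for a b
    by (rule clin_eqI[OF clin_sm2 clin_comp[OF clin_sm2 clin_sm2] finX]) (use 1 that assms(3) in auto)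
  have 3: "(delta a \<star> y) \<star> z = delta a \<star> (y \<star> z)" if "a \<in> X" for a
    by (rule clin_eqI[OF clin_comp[OF clin_sm1 clin_sm2] clin_comp[OF clin_sm2 clin_sm1] finX])
      (use 2 that assms(2) in auto)
  show ?thesis
    by (rule clin_eqI[OF clin_comp[OF clin_sm1 clin_sm1] clin_sm1 finX,
      where a = x]) (use 3 assms(1) in auto)
qed

lemma sm_sgrp_delta:
  "g \<in> carrier G \<Longrightarrow> (h, S) \<in> X \<Longrightarrow> sgrp g \<star> delta (h, S) = delta (g \<otimes> h, S)"
  by (simp add: sgrp_def gx_delta[symmetric] sm_gx sbasis_def ext_act_empty
      wedge_empty_left[of _ n])

lemma sgrp_vspace [simp]: "g \<in> carrier G \<Longrightarrow> sgrp g \<in> vspace X"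
  by (simp add: sgrp_def sbasis_def)

lemma svec_vspace [simp]: "i < n \<Longrightarrow> svec G i \<in> vspace X"
  by (simp add: svec_def sbasis_def)

lemma sm_one_left: "x \<in> vspace X \<Longrightarrow> sgrp \<one> \<star> x = x"
  by (rule clin_eqI[OF clin_sm2 clin_id finX])
    (auto simp: sm_sgrp_delta sbasis_def)

lemma sm_one_right: "x \<in> vspace X \<Longrightarrow> x \<star> sgrp \<one> = x"
proof (rule clin_eqI[OF clin_sm1 clin_id finX])
  fix a assume "a \<in> X"
  then obtain g S where a: "a = (g, S)" "g \<in> carrier G" "S \<subseteq> {..<n}" by (auto simp: sbasis_def)
  moreover have "finite S" using a finite_subset by blast
  ultimately show "delta a \<star> sgrp \<one> = delta a"
    by (simp add: sgrp_def gx_delta[symmetric] sm_gx rep_one ext_act_one)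
      (simp add: wedge_delta wedge_sign_ninv)
qed

section \<open>The super tensor square\<close>

lemma sup_expand:
  "s \<diamondop> t = (\<lambda>z. \<Sum>p\<in>X \<times> X. \<Sum>q\<in>X \<times> X. s p * (t q *
     ((- 1) ^ (card (snd (snd p)) * card (snd (fst q))) *
      tens (delta (fst p) \<star> delta (fst q)) (delta (snd p) \<star> delta (snd q)) z)))"
  by (simp add: super_mult_def split_def mult.assoc)

lemma clin_sup1: "clin (\<lambda>s. s \<diamondop> t)"
  by (rule clinI) (simp add: sup_expand sum_distrib_left sum.distrib algebra_simps)

lemma clin_sup2: "clin (sup s)"
  by (rule clinI) (simp add: sup_expand sum_distrib_left sum.distrib algebra_simps)

lemma sup_restrict1: "restrict_to (X \<times> X) s \<diamondop> t = s \<diamondop> t"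
  by (simp add: sup_expand restrict_to_def)

lemma sup_restrict2: "s \<diamondop> restrict_to (X \<times> X) t = s \<diamondop> t"
  by (simp add: sup_expand restrict_to_def)

lemma sum_delta_XX:
  assumes "p \<in> X \<times> X" shows "(\<Sum>q\<in>X \<times> X. delta p q * h q) = h p"
proof -
  have "(\<Sum>q\<in>X \<times> X. delta p q * h q) = (\<Sum>q\<in>X \<times> X. if q = p then h p else 0)"
    by (rule sum.cong) (auto simp: delta_def)
  then show ?thesis using assms finXX by simp
qed

lemma sup_delta:
  assumes "a \<in> X" "b \<in> X" "c \<in> X" "d \<in> X"
  shows "delta (a, b) \<diamondop> delta (c, d) =
    (\<lambda>z. (- 1) ^ (card (snd b) * card (snd c)) * tens (delta a \<star> delta c) (delta b \<star> delta d) z)"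
  using assms by (simp add: sup_expand sum_distrib_left[symmetric] sum_delta_XX)

text \<open>The sign depends only on the parities of the two inner factors; the outer ones may be
  inhomogeneous.\<close>

lemma sup_tens:
  assumes "x \<in> vspace X" "y \<in> vspace (par_basis G n q)" "x' \<in> vspace (par_basis G n p)"
    "y' \<in> vspace X"
  shows "tens x y \<diamondop> tens x' y' = (\<lambda>z. (- 1) ^ (q * p) * tens (x \<star> x') (y \<star> y') z)"
proof -
  have fin: "finite (par_basis G n q)" for q
    by (rule finite_subset[OF _ finX]) (auto simp: par_basis_def)
  have sg: "(- 1 :: complex) ^ (card (snd b) * card (snd c)) = (- 1) ^ (q * p)"
    if "b \<in> par_basis G n q" "c \<in> par_basis G n p" for b c
    using that by (cases "even (card (snd b) * card (snd c))") (auto simp: par_basis_def)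
  have 1: "tens (delta a) (delta b) \<diamondop> tens (delta c) (delta d) =
      (\<lambda>z. (- 1) ^ (q * p) * tens (delta a \<star> delta c) (delta b \<star> delta d) z)"
    if "a \<in> X" "b \<in> par_basis G n q" "c \<in> par_basis G n p" "d \<in> X" for a b c d
    using that sg[OF that(2,3)] by (simp add: sup_delta par_basis_def)
  have 2: "tens (delta a) (delta b) \<diamondop> tens (delta c) y' =
      (\<lambda>z. (- 1) ^ (q * p) * tens (delta a \<star> delta c) (delta b \<star> y') z)"
    if "a \<in> X" "b \<in> par_basis G n q" "c \<in> par_basis G n p" for a b c
    by (rule clin_eqI[OF clin_comp[OF clin_sup2 clin_tens2]
        clin_times[OF clin_comp[OF clin_tens2 clin_sm2]] finX 1 assms(4)]) (use that in auto)
  have 3: "tens (delta a) (delta b) \<diamondop> tens x' y' =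
      (\<lambda>z. (- 1) ^ (q * p) * tens (delta a \<star> x') (delta b \<star> y') z)"
    if "a \<in> X" "b \<in> par_basis G n q" for a b
    by (rule clin_eqI[OF clin_comp[OF clin_sup2 clin_tens1]
        clin_times[OF clin_comp[OF clin_tens1 clin_sm2]] fin 2 assms(3)]) (use that in auto)
  have 4: "tens (delta a) y \<diamondop> tens x' y' =
      (\<lambda>z. (- 1) ^ (q * p) * tens (delta a \<star> x') (y \<star> y') z)" if "a \<in> X" for a
    by (rule clin_eqI[OF clin_comp[OF clin_sup1 clin_tens2]
        clin_times[OF clin_comp[OF clin_tens2 clin_sm1]] fin 3 assms(2)]) (use that in auto)
  show ?thesis
    by (rule clin_eqI[OF clin_comp[OF clin_sup1 clin_tens1]
        clin_times[OF clin_comp[OF clin_tens1 clin_sm1]] finX 4 assms(1)]) auto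
qed

text \<open>Coefficients of \<open>s\<close> and \<open>t\<close> outside
  \<open>X \<times> X\<close> are ignored by the product, so both may be truncated first; the same
  holds for associativity.\<close>

lemma sup_vspace: "s \<diamondop> t \<in> vspace (X \<times> X)"
proof -
  have 1: "delta p \<diamondop> delta q \<in> vspace (X \<times> X)" if "p \<in> X \<times> X" "q \<in> X \<times> X" for p q
  proof -
    obtain a b c d where "p = (a, b)" "q = (c, d)" by (cases p, cases q)
    moreover have "tens (delta a \<star> delta c) (delta b \<star> delta d) \<in> vspace (X \<times> X)"
      using calculation that by (intro tens_in_vspace sm_vspace) auto
    ultimately show ?thesis using that by (simp add: sup_delta) (simp add: vspace_def)
  qed
  have "restrict_to (X \<times> X) s \<diamondop> restrict_to (X \<times> X) t \<in> vspace (X \<times> X)"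
    by (rule bilin_vspaceI[OF clin_sup1 clin_sup2 finXX finXX 1]) auto
  then show ?thesis by (simp add: sup_restrict1 sup_restrict2)
qed

lemma sup_assoc: "(s \<diamondop> t) \<diamondop> r = s \<diamondop> (t \<diamondop> r)"
proof -
  have 1: "(delta p \<diamondop> delta q) \<diamondop> delta w = delta p \<diamondop> (delta q \<diamondop> delta w)"
    if pqw: "p \<in> X \<times> X" "q \<in> X \<times> X" "w \<in> X \<times> X" for p q w
  proof -
    obtain a b c d e f where pq: "p = (a, b)" "q = (c, d)" "w = (e, f)" by (cases p, cases q, cases w)
    then have m: "a \<in> X" "b \<in> X" "c \<in> X" "d \<in> X" "e \<in> X" "f \<in> X" using pqw by auto
    let ?d = "\<lambda>b. card (snd b)"
    have "(delta p \<diamondop> delta q) \<diamondop> delta w = (\<lambda>z. (- 1) ^ (?d b * ?d c) *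
        (tens (delta a \<star> delta c) (delta b \<star> delta d) \<diamondop> tens (delta e) (delta f)) z)"
      unfolding pq using m by (simp add: sup_delta clin_scale[OF clin_sup1])
    also have "tens (delta a \<star> delta c) (delta b \<star> delta d) \<diamondop> tens (delta e) (delta f) =
        (\<lambda>z. (- 1) ^ ((?d b + ?d d) * ?d e) *
          tens (delta a \<star> delta c \<star> delta e) (delta b \<star> delta d \<star> delta f) z)"
      using m by (intro sup_tens sm_vspace sm_delta_par delta_par) auto
    finally have L: "(delta p \<diamondop> delta q) \<diamondop> delta w = (\<lambda>z. (- 1) ^ (?d b * ?d c) *
        ((- 1) ^ ((?d b + ?d d) * ?d e) *
          tens (delta a \<star> delta c \<star> delta e) (delta b \<star> delta d \<star> delta f) z))" .
    have "delta p \<diamondop> (delta q \<diamondop> delta w) = (\<lambda>z. (- 1) ^ (?d d * ?d e) *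
        (tens (delta a) (delta b) \<diamondop> tens (delta c \<star> delta e) (delta d \<star> delta f)) z)"
      unfolding pq using m by (simp add: sup_delta clin_scale[OF clin_sup2])
    also have "tens (delta a) (delta b) \<diamondop> tens (delta c \<star> delta e) (delta d \<star> delta f) =
        (\<lambda>z. (- 1) ^ (?d b * (?d c + ?d e)) *
          tens (delta a \<star> (delta c \<star> delta e)) (delta b \<star> (delta d \<star> delta f)) z)"
      using m by (intro sup_tens sm_vspace sm_delta_par delta_par) auto
    finally have R: "delta p \<diamondop> (delta q \<diamondop> delta w) = (\<lambda>z. (- 1) ^ (?d d * ?d e) *
        ((- 1) ^ (?d b * (?d c + ?d e)) *
          tens (delta a \<star> (delta c \<star> delta e)) (delta b \<star> (delta d \<star> delta f)) z))" .
    \<comment> \<open>Expanded, both sign exponents are the sum of the parity products for the pairs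
      (b, c), (b, e) and (d, e).\<close>
    show ?thesis unfolding L R using m
      by (simp add: sm_assoc fun_eq_iff power_add distrib_left distrib_right)
  qed
  let ?r = "restrict_to (X \<times> X)"
  have 2: "(delta p \<diamondop> delta q) \<diamondop> ?r r = delta p \<diamondop> (delta q \<diamondop> ?r r)"
    if "p \<in> X \<times> X" "q \<in> X \<times> X" for p q
    by (rule clin_eqI[OF clin_sup2 clin_comp[OF clin_sup2 clin_sup2] finXX 1]) (use that in auto)
  have 3: "(delta p \<diamondop> ?r t) \<diamondop> ?r r = delta p \<diamondop> (?r t \<diamondop> ?r r)" if "p \<in> X \<times> X" for p
    by (rule clin_eqI[OF clin_comp[OF clin_sup1 clin_sup2] clin_comp[OF clin_sup2 clin_sup1] finXX 2])
      (use that in auto)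
  have "(?r s \<diamondop> ?r t) \<diamondop> ?r r = ?r s \<diamondop> (?r t \<diamondop> ?r r)"
    by (rule clin_eqI[OF clin_comp[OF clin_sup1 clin_sup1] clin_sup1 finXX 3]) auto
  then show ?thesis by (simp add: sup_restrict1 sup_restrict2)
qed

lemma sgrp_par: "g \<in> carrier G \<Longrightarrow> sgrp g \<in> vspace (par_basis G n 0)"
  using delta_par[of "(g, {})" G n] by (simp add: sgrp_def sbasis_def)

lemma svec_par: "i < n \<Longrightarrow> svec G i \<in> vspace (par_basis G n 1)"
  using delta_par[of "(\<one>, {i})" G n] by (simp add: svec_def sbasis_def)

lemma sone2_left: assumes "t \<in> vspace (X \<times> X)" shows "sone2 G \<diamondop> t = t"
proof (rule clin_eqI[OF clin_sup2 clin_id finXX _ assms])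
  fix p assume "p \<in> X \<times> X"
  then obtain a b where p: "p = (a, b)" "a \<in> X" "b \<in> X" by auto
  have "tens (sgrp \<one>) (sgrp \<one>) \<diamondop> tens (delta a) (delta b) =
      (\<lambda>z. (- 1) ^ (0 * card (snd a)) * tens (sgrp \<one> \<star> delta a) (sgrp \<one> \<star> delta b) z)"
    using p by (intro sup_tens sgrp_vspace sgrp_par delta_par) auto
  then show "sone2 G \<diamondop> delta p = delta p" using p by (simp add: sone2_def sm_one_left)
qed

lemma sone2_right: assumes "t \<in> vspace (X \<times> X)" shows "t \<diamondop> sone2 G = t"
proof (rule clin_eqI[OF clin_sup1 clin_id finXX _ assms])
  fix p assume "p \<in> X \<times> X"
  then obtain a b where p: "p = (a, b)" "a \<in> X" "b \<in> X" by auto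
  have "tens (delta a) (delta b) \<diamondop> tens (sgrp \<one>) (sgrp \<one>) =
      (\<lambda>z. (- 1) ^ (card (snd b) * 0) * tens (delta a \<star> sgrp \<one>) (delta b \<star> sgrp \<one>) z)"
    using p by (intro sup_tens sgrp_vspace sgrp_par delta_par) auto
  then show "delta p \<diamondop> sone2 G = delta p" using p by (simp add: sone2_def sm_one_right)
qed

lemma sone2_vspace: "sone2 G \<in> vspace (X \<times> X)"
  unfolding sone2_def by (intro tens_in_vspace sgrp_vspace) auto

text \<open>Multiplicative but not unital: \<open>sop (sone2 G)\<close> is the truncation to
  \<open>X \<times> X\<close>, not the identity of \<open>lop\<close>. This is why it survives as a
  factor in the operator identities below.\<close>

definition sop where "sop s = Lop (sup s)"

lemma app_sop [simp]: "app (sop s) = sup s"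
  by (simp add: sop_def Lop_inverse clin_sup2)

lemma sop_mult: "sop (s \<diamondop> t) = sop s * sop t"
  by (rule lop_eqI) (simp add: sup_assoc)

lemma sop_add: "sop (\<lambda>z. s z + t z) = sop s + sop t"
  by (rule lop_eqI) (simp add: clin_add[OF clin_sup1] fun_eq_iff)

lemma sop_uminus: "sop (\<lambda>z. - s z) = - sop s"
  by (rule lop_eqI) (simp add: clin_uminus[OF clin_sup1] fun_eq_iff)

lemma sop_sum: "sop (\<lambda>z. \<Sum>i\<in>I. c i * a i z) = (\<Sum>i\<in>I. cscale (c i) * sop (a i))"
  by (rule lop_eqI) (simp add: fun_eq_iff app_sum clin_sum[OF clin_sup1])

text \<open>Applied to the unit, the operators return the elements.\<close>

lemma sop_inj: "s \<in> vspace (X \<times> X) \<Longrightarrow> t \<in> vspace (X \<times> X) \<Longrightarrow> sop s = sop t \<Longrightarrow> s = t"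
  using app_sop sone2_right by metis

end

section \<open>Exponentials\<close>

definition eterm :: "nat \<Rightarrow> 'x lop \<Rightarrow> 'x lop" where
  "eterm k x = cscale (1 / fact k) * x ^ k"

definition eop :: "nat \<Rightarrow> 'x lop \<Rightarrow> 'x lop" where
  "eop N x = (\<Sum>k\<le>N. eterm k x)"

lemma cscale_left_commute: "L * (cscale c * M) = cscale c * (L * M)"
  by (simp only: mult.assoc[symmetric] cscale_commute)

lemma cscale_swap: "cscale c * L * (cscale d * M) = cscale (c * d) * (L * M)"
  unfolding cscale_mult mult.assoc cscale_left_commute[of L d M] ..

lemma cscale_mult_commute: "L * M = M * L \<Longrightarrow> cscale c * L * M = M * (cscale c * L)"
  unfolding cscale_left_commute by (simp only: mult.assoc)

lemma commute_mult: "(c :: 'a::ring_1) * a = a * c \<Longrightarrow> c * b = b * c \<Longrightarrow> c * (a * b) = a * b * c"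
  by (metis mult.assoc)

lemma eterm_Suc: "cscale (of_nat (Suc k)) * eterm (Suc k) x = x * eterm k x"
proof -
  have "complex_of_nat (Suc k) * (1 / fact (Suc k)) = 1 / fact k"
    by (simp add: field_simps del: of_nat_Suc)
  then have "cscale (of_nat (Suc k)) * eterm (Suc k) x = cscale (1 / fact k) * x ^ Suc k"
    unfolding eterm_def by (simp only: mult.assoc[symmetric] cscale_mult[symmetric])
  also have "\<dots> = x * eterm k x"
    unfolding eterm_def by (simp add: mult.assoc[symmetric] cscale_commute)
  finally show ?thesis .
qed

lemma eterm_commute: "x * y = y * x \<Longrightarrow> eterm k x * y = y * eterm k x"
proof -
  assume "x * y = y * x"
  then have "x ^ k * y = y * x ^ k" by (rule power_commuting_commutes)
  then show ?thesis
    unfolding eterm_def by (rule cscale_mult_commute)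
qed

text \<open>The binomial theorem in divided powers, for two commuting elements of a noncommutative
  ring. After multiplication by k + 1 = i + (k + 1 - i), the recursion \<open>eterm_Suc\<close>
  applies to the left factor for the first summand and to the right factor for the second.\<close>

lemma eterm_add:
  assumes xy: "x * y = y * x"
  shows "eterm k (x + y) = (\<Sum>i\<le>k. eterm i x * eterm (k - i) y)"
proof (induction k)
  case 0
  then show ?case by (simp add: eterm_def)
next
  case (Suc k)
  let ?t = "\<lambda>i. eterm i x * eterm (Suc k - i) y"
  let ?c = "\<lambda>i. cscale (of_nat i) :: 'a lop"
  have X: "x * (eterm i x * eterm (k - i) y) = ?c (Suc i) * ?t (Suc i)" for i
    by (simp only: mult.assoc[symmetric] eterm_Suc diff_Suc_Suc)
  have Y: "y * (eterm i x * eterm (k - i) y) = ?c (Suc k - i) * ?t i" if "i \<le> k" for i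
  proof -
    have "y * (eterm i x * eterm (k - i) y) = eterm i x * (y * eterm (k - i) y)"
      using eterm_commute[OF xy, of i] by (simp add: mult.assoc[symmetric])
    also have "y * eterm (k - i) y = ?c (Suc k - i) * eterm (Suc k - i) y"
      using that by (simp only: eterm_Suc[symmetric] Suc_diff_le)
    finally show ?thesis by (simp add: mult.assoc[symmetric] cscale_commute)
  qed
  have "?c (Suc k) * eterm (Suc k) (x + y) = (x + y) * (\<Sum>i\<le>k. eterm i x * eterm (k - i) y)"
    by (simp only: eterm_Suc Suc.IH)
  also have "\<dots> = (\<Sum>i\<le>k. ?c (Suc i) * ?t (Suc i)) + (\<Sum>i\<le>k. ?c (Suc k - i) * ?t i)"
  proof -
    have "x * (\<Sum>i\<le>k. eterm i x * eterm (k - i) y) = (\<Sum>i\<le>k. ?c (Suc i) * ?t (Suc i))"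
      unfolding sum_distrib_left by (intro sum.cong refl X)
    moreover have "y * (\<Sum>i\<le>k. eterm i x * eterm (k - i) y) = (\<Sum>i\<le>k. ?c (Suc k - i) * ?t i)"
      unfolding sum_distrib_left by (intro sum.cong refl Y) simp
    ultimately show ?thesis by (simp only: distrib_right)
  qed
  also have "(\<Sum>i\<le>k. ?c (Suc i) * ?t (Suc i)) = (\<Sum>i\<le>Suc k. ?c i * ?t i)"
    unfolding sum.atMost_Suc_shift[of _ k] by simp
  also have "(\<Sum>i\<le>k. ?c (Suc k - i) * ?t i) = (\<Sum>i\<le>Suc k. ?c (Suc k - i) * ?t i)"
    by simp
  also have "(\<Sum>i\<le>Suc k. ?c i * ?t i) + (\<Sum>i\<le>Suc k. ?c (Suc k - i) * ?t i) =
      (\<Sum>i\<le>Suc k. ?c (Suc k) * ?t i)"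
    unfolding sum.distrib[symmetric]
  proof (intro sum.cong refl)
    fix i assume "i \<in> {..Suc k}"
    then have "complex_of_nat i + of_nat (Suc k - i) = of_nat (Suc k)"
      by (simp only: of_nat_add[symmetric]) simp
    then show "?c i * ?t i + ?c (Suc k - i) * ?t i = ?c (Suc k) * ?t i"
      by (simp only: distrib_right[symmetric] cscale_add[symmetric])
  qed
  finally have *: "?c (Suc k) * eterm (Suc k) (x + y) = ?c (Suc k) * (\<Sum>i\<le>Suc k. ?t i)"
    by (simp only: sum_distrib_left)
  \<comment> \<open>In \<open>lop\<close> there is no division, so k + 1 is cancelled by the scalar
    inverse to it.\<close>
  have inv: "cscale (1 / of_nat (Suc k)) * ?c (Suc k) = 1"
    by (simp only: cscale_mult[symmetric]) (simp del: of_nat_Suc)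
  have "cscale (1 / of_nat (Suc k)) * ?c (Suc k) * eterm (Suc k) (x + y) =
        cscale (1 / of_nat (Suc k)) * ?c (Suc k) * (\<Sum>i\<le>Suc k. ?t i)"
    by (simp only: mult.assoc *)
  then show ?case by (simp only: inv mult_1_left)
qed

lemma power_zero_le: "x ^ m = (0 :: 'a::ring_1) \<Longrightarrow> m \<le> k \<Longrightarrow> x ^ k = 0"
  by (metis le_add_diff_inverse mult_zero_left power_add)

text \<open>Terms with an index above \<open>N\<close> vanish by nilpotency, so the triangle of the
  Cauchy product and the square of the product of two partial sums have the same nonzero
  terms.\<close>

lemma eop_add:
  assumes "x * y = y * x" "x ^ Suc N = 0" "y ^ Suc N = 0" "(x + y) ^ Suc N = 0"
  shows "eop N x * eop N y = eop N (x + y)"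
proof -
  have z: "eterm k x = 0" "eterm k y = 0" "eterm k (x + y) = 0" if "N < k" for k
    using power_zero_le[OF assms(2)] power_zero_le[OF assms(3)] power_zero_le[OF assms(4)] that
    by (simp_all add: eterm_def Suc_le_eq)
  have zz: "i \<le> N \<and> j \<le> N" if "eterm i x * eterm j y \<noteq> 0" for i j
    using that z by (metis mult_zero_left mult_zero_right not_le)
  \<comment> \<open>Up to \<open>2 * N\<close>, so that the triangle contains the whole
    square.\<close>
  have "eop N (x + y) = (\<Sum>k\<le>2 * N. eterm k (x + y))"
    unfolding eop_def by (rule sum.mono_neutral_left) (auto simp: z)
  also have "\<dots> = (\<Sum>k\<le>2 * N. \<Sum>i\<le>k. eterm i x * eterm (k - i) y)"
    by (simp add: eterm_add[OF assms(1)])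
  also have "\<dots> = (\<Sum>(i, j)\<in>{(i, j). i + j \<le> 2 * N}. eterm i x * eterm j y)"
    by (rule sum.triangle_reindex_eq[symmetric])
  also have "\<dots> = (\<Sum>(i, j)\<in>{..N} \<times> {..N}. eterm i x * eterm j y)"
    by (rule sum.mono_neutral_right)
      (auto dest!: zz intro: finite_subset[of _ "{..2 * N} \<times> {..2 * N}"])
  also have "\<dots> = eop N x * eop N y"
    by (simp add: eop_def sum_product sum.cartesian_product)
  finally show ?thesis ..
qed

lemma power_commuting_intertwine: "x * d = d * (y :: 'a::ring_1) \<Longrightarrow> x ^ k * d = d * y ^ k"
proof (induction k)
  case (Suc k)
  then show ?case by (simp add: mult.assoc) (metis Suc mult.assoc)
qed simp

text \<open>For \<open>d\<close> the operator of g \<otimes> g this conjugates an exponential; for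
  \<open>x = y\<close> it says that the exponential commutes with whatever commutes with its
  exponent.\<close>

lemma eop_intertwine: "x * d = d * y \<Longrightarrow> eop N x * d = d * eop N y"
proof -
  assume xd: "x * d = d * y"
  have "eterm k x * d = d * eterm k y" for k
    unfolding eterm_def cscale_left_commute mult.assoc power_commuting_intertwine[OF xd] ..
  then show ?thesis by (simp add: eop_def sum_distrib_left sum_distrib_right)
qed

lemma eop_zero [simp]: "eop N 0 = 1"
proof -
  have "eop N 0 = (\<Sum>k\<le>N. if k = 0 then 1 else 0)"
    unfolding eop_def by (rule sum.cong) (auto simp: eterm_def power_0_left)
  then show ?thesis by simp
qed


section \<open>The twisted coproduct\<close>

lemma sum_swap4:
  "(\<Sum>i\<in>I. \<Sum>j\<in>J. \<Sum>k\<in>K. \<Sum>l\<in>L. f i j k l) = (\<Sum>k\<in>K. \<Sum>l\<in>L. \<Sum>i\<in>I. \<Sum>j\<in>J. (f i j k l :: 'a::comm_monoid_add))"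
proof -
  have "(\<Sum>i\<in>I. \<Sum>j\<in>J. \<Sum>k\<in>K. \<Sum>l\<in>L. f i j k l) = (\<Sum>i\<in>I. \<Sum>k\<in>K. \<Sum>j\<in>J. \<Sum>l\<in>L. f i j k l)"
    by (intro sum.cong refl sum.swap)
  also have "\<dots> = (\<Sum>k\<in>K. \<Sum>i\<in>I. \<Sum>l\<in>L. \<Sum>j\<in>J. f i j k l)"
    by (subst sum.swap) (intro sum.cong refl sum.swap)
  also have "\<dots> = (\<Sum>k\<in>K. \<Sum>l\<in>L. \<Sum>i\<in>I. \<Sum>j\<in>J. f i j k l)"
    by (intro sum.cong refl sum.swap)
  finally show ?thesis .
qed

context gv begin

abbreviation "avec i \<equiv> tens (svec G i) (sgrp \<one>)"
abbreviation "bvec i \<equiv> tens (sgrp \<one>) (svec G i)"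
abbreviation "aop i \<equiv> sop (avec i)"
abbreviation "bop i \<equiv> sop (bvec i)"
abbreviation "pop i \<equiv> sop (sprim G i)"
abbreviation "dg g \<equiv> tens (sgrp g) (sgrp g)"
abbreviation "dop g \<equiv> sop (dg g)"
abbreviation "beta C \<equiv> sop (stensor G n C)"

lemma pop_eq: "pop i = aop i + bop i"
  by (simp add: sprim_def sop_add)

lemma svec_gx: "svec G i = gx \<one> (delta {i})"
  by (simp add: svec_def gx_delta)

lemma sgrp_gx: "sgrp g = gx g (delta {})"
  by (simp add: sgrp_def gx_delta)

lemma sm_svec_anti:
  assumes "i < n" "j < n" shows "svec G i \<star> svec G j = (\<lambda>z. - (svec G j \<star> svec G i) z)"
proof -
  have "svec G i \<star> svec G j = gx \<one> (wedge (delta {i}) (delta {j}))" if "i < n" "j < n" for i j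
    using that by (simp add: svec_gx sm_gx rep_one ext_act_one)
  then show ?thesis
    using assms
    by (simp only:) (subst wedge_delta_single_anti, rule clin_uminus[OF clin_gx])
qed

lemma sup_ab:
  assumes "i < n" "j < n"
  shows "avec i \<diamondop> avec j = tens (svec G i \<star> svec G j) (sgrp \<one>)"
    "bvec i \<diamondop> bvec j = tens (sgrp \<one>) (svec G i \<star> svec G j)"
    "avec i \<diamondop> bvec j = tens (svec G i) (svec G j)"
    "bvec j \<diamondop> avec i = (\<lambda>z. - tens (svec G i) (svec G j) z)"
  using sup_tens[OF svec_vspace[OF assms(1)] sgrp_par[of \<one>] svec_par[OF assms(2)] sgrp_vspace[of \<one>]]
    sup_tens[OF sgrp_vspace[of \<one>] svec_par[OF assms(1)] sgrp_par[of \<one>] svec_vspace[OF assms(2)]]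
    sup_tens[OF svec_vspace[OF assms(1)] sgrp_par[of \<one>] sgrp_par[of \<one>] svec_vspace[OF assms(2)]]
    sup_tens[OF sgrp_vspace[of \<one>] svec_par[OF assms(2)] svec_par[OF assms(1)] sgrp_vspace[of \<one>]]
    assms
  by (simp_all add: sm_one_left sm_one_right)

text \<open>Within one tensor factor the relations are those of the exterior algebra; between the
  two factors the anticommutation comes from the sign rule of the super tensor product.\<close>

lemma ab_anti:
  assumes "i < n" "j < n"
  shows "aop i * aop j = - (aop j * aop i)" "bop i * bop j = - (bop j * bop i)"
    "bop j * aop i = - (aop i * bop j)"
    "sop (tens (svec G i) (svec G j)) = aop i * bop j"
proof -
  show "aop i * aop j = - (aop j * aop i)"
    unfolding sop_mult[symmetric] sup_ab[OF assms] sup_ab[OF assms(2,1)]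
    by (subst sm_svec_anti[OF assms]) (simp add: clin_uminus[OF clin_tens1] sop_uminus)
  show "bop i * bop j = - (bop j * bop i)"
    unfolding sop_mult[symmetric] sup_ab[OF assms] sup_ab[OF assms(2,1)]
    by (subst sm_svec_anti[OF assms]) (simp add: clin_uminus[OF clin_tens2] sop_uminus)
  show "bop j * aop i = - (aop i * bop j)"
    unfolding sop_mult[symmetric] sup_ab[OF assms] by (simp add: sop_uminus)
  show "sop (tens (svec G i) (svec G j)) = aop i * bop j"
    unfolding sop_mult[symmetric] sup_ab[OF assms] ..
qed

text \<open>This makes \<open>hat n pop\<close> multiplicative: it is the coproduct on the exterior
  algebra, in terms of operators.\<close>

lemma anticommuting_pop: "anticommuting n pop"
  unfolding anticommuting_def pop_eq
proof (intro allI impI)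
  fix i j assume ij: "i < n" "j < n"
  show "(aop i + bop i) * (aop j + bop j) = - ((aop j + bop j) * (aop i + bop i))"
    unfolding distrib_left distrib_right
    by (simp only: ab_anti(1,2)[OF ij] ab_anti(3)[OF ij] ab_anti(3)[OF ij(2,1)]) simp
qed

lemma beta_eq: "beta C = (\<Sum>i<n. \<Sum>j<n. cscale (C $$ (i, j)) * (aop i * bop j))"
proof -
  have "stensor G n C = (\<lambda>z. \<Sum>i<n. 1 * (\<lambda>z. \<Sum>j<n. C $$ (i, j) * tens (svec G i) (svec G j) z) z)"
    by (simp add: stensor_def)
  then show ?thesis by (simp only: sop_sum) (simp add: ab_anti(4))
qed

text \<open>A product of two generators passes a third one with two signs, which cancel. Hence
  \<open>beta C\<close>, and with it the twist, commutes with the coproducts of vectors.\<close>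

lemma ab_pair_commute:
  assumes "i < n" "j < n" "k < n"
  shows "aop i * bop j * pop k = pop k * (aop i * bop j)"
proof -
  have "aop i * bop j * aop k = aop k * (aop i * bop j)"
    by (simp only: mult.assoc ab_anti(3)[OF assms(3,2)])
      (simp add: mult.assoc[symmetric] ab_anti(1)[OF assms(1,3)])
  moreover have "aop i * bop j * bop k = bop k * (aop i * bop j)"
    by (simp only: mult.assoc ab_anti(2)[OF assms(2,3)])
      (simp add: mult.assoc[symmetric] ab_anti(3)[OF assms(1,3)])
  ultimately show ?thesis by (simp only: pop_eq distrib_left distrib_right)
qed

lemma beta_pop_commute: "k < n \<Longrightarrow> beta C * pop k = pop k * beta C"
  unfolding beta_eq sum_distrib_left sum_distrib_right
  by (intro sum.cong refl cscale_mult_commute ab_pair_commute) auto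

lemma ab_pairs_commute:
  assumes "i < n" "j < n" "k < n" "l < n"
  shows "aop i * bop j * (aop k * bop l) = aop k * bop l * (aop i * bop j)"
proof -
  have "aop i * bop j * aop k = aop k * (aop i * bop j)"
    by (simp only: mult.assoc ab_anti(3)[OF assms(3,2)])
      (simp add: mult.assoc[symmetric] ab_anti(1)[OF assms(1,3)])
  moreover have "aop i * bop j * bop l = bop l * (aop i * bop j)"
    by (simp only: mult.assoc ab_anti(2)[OF assms(2,4)])
      (simp add: mult.assoc[symmetric] ab_anti(3)[OF assms(1,4)])
  ultimately show ?thesis by (rule commute_mult)
qed

lemma beta_commute: "beta C * beta D = beta D * beta C"
proof -
  have 1: "beta C * (aop k * bop l) = (aop k * bop l) * beta C" if "k < n" "l < n" for k l
    unfolding beta_eq sum_distrib_left sum_distrib_right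
    by (intro sum.cong refl cscale_mult_commute ab_pairs_commute) (use that in auto)
  show ?thesis
    unfolding beta_eq[of D] sum_distrib_left sum_distrib_right
    by (intro sum.cong refl cscale_mult_commute[symmetric] 1[symmetric]) auto
qed

lemma beta_lincomb:
  assumes "C \<in> carrier_mat n n" "D \<in> carrier_mat n n"
  shows "beta (C + D) = beta C + beta D" "beta (- C) = - beta C"
proof -
  show "beta (C + D) = beta C + beta D"
    unfolding beta_eq sum.distrib[symmetric]
    by (intro sum.cong refl) (use assms in \<open>simp add: cscale_add distrib_right\<close>)
  have cm: "cscale (- c) = - cscale c" for c :: complex
    using cscale_add[of c "- c"] by (simp add: add_eq_0_iff)
  show "beta (- C) = - beta C"
    unfolding beta_eq sum_negf[symmetric]
    by (intro sum.cong refl) (use assms in \<open>simp add: cm\<close>)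
qed

lemma beta_zero: "beta (0\<^sub>m n n) = 0"
  by (simp add: beta_eq)

lemma conj_svec:
  assumes "g \<in> carrier G" "i < n"
  shows "sgrp g \<star> svec G i = (\<lambda>z. \<Sum>k<n. \<rho> g $$ (k, i) * (svec G k \<star> sgrp g) z)"
proof -
  have e: "gx \<one> (act g (delta {i})) = (\<lambda>z. \<Sum>k<n. \<rho> g $$ (k, i) * svec G k z)"
  proof -
    have "act g (delta {i}) = (\<lambda>S. \<Sum>k<n. \<rho> g $$ (k, i) * delta {k} S)"
      using assms carrier_matD[OF rep_carrier[OF assms(1)]] by (simp add: ext_act_single ext_vec_def)
    then show ?thesis by (simp add: clin_sum[OF clin_gx] svec_gx)
  qed
  have "inv g \<in> carrier G" using assms by simp
  then have c: "\<rho> (inv g) * \<rho> g = 1\<^sub>m n" using assms by (simp add: rep_mult[symmetric] rep_one)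
  have "gx \<one> (act g (delta {i})) \<star> sgrp g = gx g (wedge (act (inv g) (act g (delta {i}))) (delta {}))"
    using assms by (simp add: sgrp_gx sm_gx)
  also have "\<dots> = gx g (delta {i})"
    using assms by (simp add: ext_act_comp c ext_act_one) (simp add: wedge_delta wedge_sign_ninv)
  also have "\<dots> = sgrp g \<star> svec G i"
    using assms by (simp add: sgrp_gx svec_gx sm_gx ext_act_empty wedge_empty_left[of _ n])
  finally show ?thesis unfolding e clin_sum[OF clin_sm1] ..
qed

lemma dop_conj:
  assumes "g \<in> carrier G" "i < n"
  shows "dop g * aop i = (\<Sum>k<n. cscale (\<rho> g $$ (k, i)) * aop k) * dop g"
    "dop g * bop i = (\<Sum>k<n. cscale (\<rho> g $$ (k, i)) * bop k) * dop g"
proof -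
  have "dop g * aop i = sop (\<lambda>z. \<Sum>k<n. \<rho> g $$ (k, i) * tens (svec G k \<star> sgrp g) (sgrp g) z)"
    unfolding sop_mult[symmetric]
    using sup_tens[OF sgrp_vspace[OF assms(1)] sgrp_par[OF assms(1)] svec_par[OF assms(2)]
      sgrp_vspace[of \<one>]] assms
    by (simp add: sm_one_right conj_svec clin_sum[OF clin_tens1])
  also have "\<dots> = sop (\<lambda>z. \<Sum>k<n. \<rho> g $$ (k, i) * (avec k \<diamondop> dg g) z)"
  proof -
    have "avec k \<diamondop> dg g = tens (svec G k \<star> sgrp g) (sgrp g)" if "k < n" for k
      using sup_tens[OF svec_vspace[OF that] sgrp_par[of \<one>] sgrp_par[OF assms(1)] sgrp_vspace[OF
        assms(1)]] assms
      by (simp add: sm_one_left)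
    then show ?thesis by simp
  qed
  also have "\<dots> = (\<Sum>k<n. cscale (\<rho> g $$ (k, i)) * aop k) * dop g"
    by (simp add: sop_sum sop_mult sum_distrib_right mult.assoc)
  finally show "dop g * aop i = (\<Sum>k<n. cscale (\<rho> g $$ (k, i)) * aop k) * dop g" .
  have "dop g * bop i = sop (\<lambda>z. \<Sum>k<n. \<rho> g $$ (k, i) * tens (sgrp g) (svec G k \<star> sgrp g) z)"
    unfolding sop_mult[symmetric]
    using sup_tens[OF sgrp_vspace[OF assms(1)] sgrp_par[OF assms(1)] sgrp_par[of \<one>] svec_vspace[OF
      assms(2)]] assms
    by (simp add: sm_one_right conj_svec clin_sum[OF clin_tens2])
  also have "\<dots> = sop (\<lambda>z. \<Sum>k<n. \<rho> g $$ (k, i) * (bvec k \<diamondop> dg g) z)"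
  proof -
    have "bvec k \<diamondop> dg g = tens (sgrp g) (svec G k \<star> sgrp g)" if "k < n" for k
      using sup_tens[OF sgrp_vspace[of \<one>] svec_par[OF that] sgrp_par[OF assms(1)] sgrp_vspace[OF
        assms(1)]] assms
      by (simp add: sm_one_left)
    then show ?thesis by simp
  qed
  also have "\<dots> = (\<Sum>k<n. cscale (\<rho> g $$ (k, i)) * bop k) * dop g"
    by (simp add: sop_sum sop_mult sum_distrib_right mult.assoc)
  finally show "dop g * bop i = (\<Sum>k<n. cscale (\<rho> g $$ (k, i)) * bop k) * dop g" .
qed

lemma tensor_act_entry:
  assumes "R \<in> carrier_mat n n" "C \<in> carrier_mat n n" "k < n" "l < n"
  shows "tensor_act R C $$ (k, l) = (\<Sum>i<n. \<Sum>j<n. C $$ (i, j) * (R $$ (k, i) * R $$ (l, j)))"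
proof -
  have "tensor_act R C $$ (k, l) = (\<Sum>i<n. R $$ (k, i) * (\<Sum>j<n. C $$ (i, j) * R $$ (l, j)))"
    using assms by (simp add: tensor_act_def scalar_prod_def atLeast0LessThan)
  also have "\<dots> = (\<Sum>i<n. \<Sum>j<n. C $$ (i, j) * (R $$ (k, i) * R $$ (l, j)))"
    by (simp add: sum_distrib_left ac_simps)
  finally show ?thesis .
qed

lemma tensor_act_carrier:
  "R \<in> carrier_mat n n \<Longrightarrow> C \<in> carrier_mat n n \<Longrightarrow> tensor_act R C \<in> carrier_mat n n"
  by (simp add: tensor_act_def)

text \<open>Conjugation by g \<otimes> g acts by \<open>\<rho> g\<close> on the vectors of each
  tensor factor (\<open>dop_conj\<close>), so it transforms the coefficient matrix in both
  indices.\<close>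

lemma dop_beta:
  assumes "g \<in> carrier G" "C \<in> carrier_mat n n"
  shows "dop g * beta C = beta (tensor_act (\<rho> g) C) * dop g"
proof -
  let ?R = "\<lambda>k i. \<rho> g $$ (k, i)"
  have ab: "dop g * (aop i * bop j) =
      (\<Sum>k<n. \<Sum>l<n. cscale (?R k i * ?R l j) * (aop k * bop l)) * dop g" if "i < n" "j < n" for i j
  proof -
    have "dop g * (aop i * bop j) = (\<Sum>k<n. cscale (?R k i) * aop k) * (\<Sum>l<n. cscale (?R l j) *
      bop l) * dop g"
      unfolding mult.assoc[symmetric] dop_conj(1)[OF assms(1) that(1)]
      unfolding mult.assoc dop_conj(2)[OF assms(1) that(2)] ..
    also have "(\<Sum>k<n. cscale (?R k i) * aop k) * (\<Sum>l<n. cscale (?R l j) * bop l) =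
        (\<Sum>k<n. \<Sum>l<n. cscale (?R k i * ?R l j) * (aop k * bop l))"
      unfolding sum_product by (intro sum.cong refl cscale_swap)
    finally show ?thesis .
  qed
  have cs: "cscale (sum h I) = (\<Sum>i\<in>I. cscale (h i))" for h :: "nat \<Rightarrow> complex" and I
    by (induction I rule: infinite_finite_induct) (simp_all add: cscale_add)
  have "dop g * beta C = (\<Sum>i<n. \<Sum>j<n. cscale (C $$ (i, j)) * (dop g * (aop i * bop j)))"
    unfolding beta_eq sum_distrib_left by (intro sum.cong refl cscale_left_commute)
  also have "\<dots> = (\<Sum>i<n. \<Sum>j<n. \<Sum>k<n. \<Sum>l<n.
      cscale (C $$ (i, j) * (?R k i * ?R l j)) * (aop k * bop l)) * dop g"
    by (simp add: ab sum_distrib_left sum_distrib_right cscale_mult mult.assoc)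
  also have "(\<Sum>i<n. \<Sum>j<n. \<Sum>k<n. \<Sum>l<n. cscale (C $$ (i, j) * (?R k i * ?R l j)) * (aop k * bop l)) =
      (\<Sum>k<n. \<Sum>l<n. \<Sum>i<n. \<Sum>j<n. cscale (C $$ (i, j) * (?R k i * ?R l j)) * (aop k * bop l))"
    by (rule sum_swap4)
  also have "\<dots> = beta (tensor_act (\<rho> g) C)"
    unfolding beta_eq
    by (intro sum.cong refl)
      (use assms rep_carrier in \<open>simp add: tensor_act_entry cs sum_distrib_right\<close>)
  finally show ?thesis .
qed


section \<open>The filtration of the tensor square by total degree\<close>

definition degs :: "nat \<Rightarrow> (('g \<times> nat set) \<times> ('g \<times> nat set)) set" where
  "degs k = {p \<in> X \<times> X. k \<le> card (snd (fst p)) + card (snd (snd p))}"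

lemma degs_antimono: "t \<in> vspace (degs k) \<Longrightarrow> j \<le> k \<Longrightarrow> t \<in> vspace (degs j)"
  by (erule vspace_mono) (auto simp: degs_def)

lemma degs_0: "degs 0 = X \<times> X"
  by (simp add: degs_def)

lemma vspace_degs: "t \<in> vspace (degs k) \<Longrightarrow> t \<in> vspace (X \<times> X)"
  using degs_antimono[of t k 0] by (simp add: degs_0)

lemma degs_apply: "t \<in> vspace (degs k) \<Longrightarrow> card (snd a) + card (snd b) < k \<Longrightarrow> t (a, b) = 0"
proof -
  assume t: "t \<in> vspace (degs k)" and "card (snd a) + card (snd b) < k"
  then have "(a, b) \<notin> degs k" by (simp add: degs_def)
  then show ?thesis using t unfolding vspace_def by blast
qed

lemma X_card: "a \<in> X \<Longrightarrow> card (snd a) \<le> n"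
  using card_mono[of "{..<n}" "snd a"] by (auto simp: sbasis_def)

lemma degs_top: "2 * n < k \<Longrightarrow> t \<in> vspace (degs k) \<Longrightarrow> t = (\<lambda>z. 0)"
proof (rule ext, clarify)
  fix g S h T assume k: "2 * n < k" and t: "t \<in> vspace (degs k)"
  have "((g, S), (h, T)) \<notin> degs k"
    using k X_card[of "(g, S)"] X_card[of "(h, T)"] by (auto simp: degs_def)
  then show "t ((g, S), (h, T)) = 0" using t by (simp add: vspace_def)
qed

lemma sup_degs:
  assumes "s \<in> vspace (degs j)" "t \<in> vspace (degs k)"
  shows "s \<diamondop> t \<in> vspace (degs (j + k))"
proof (rule bilin_vspaceI[OF clin_sup1 clin_sup2 _ _ _ assms])
  show "finite (degs j)" "finite (degs k)"
    by (rule finite_subset[OF _ finXX], auto simp: degs_def)+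
  fix p q assume pq: "p \<in> degs j" "q \<in> degs k"
  obtain a b c d where e: "p = (a, b)" "q = (c, d)" by (cases p, cases q)
  then have m: "a \<in> X" "b \<in> X" "c \<in> X" "d \<in> X"
    "j \<le> card (snd a) + card (snd b)" "k \<le> card (snd c) + card (snd d)"
    using pq by (auto simp: degs_def)
  have "tens (delta a \<star> delta c) (delta b \<star> delta d) \<in> vspace (degs (j + k))"
    by (rule vspace_mono[OF tens_in_vspace[OF sm_delta_deg sm_delta_deg]])
      (use m in \<open>auto simp: degs_def\<close>)
  then show "delta p \<diamondop> delta q \<in> vspace (degs (j + k))"
    using m unfolding e by (simp add: sup_delta) (simp add: vspace_def)
qed

lemma stensor_degs: "stensor G n C \<in> vspace (degs 2)"
proof -
  have "tens (svec G i) (svec G j) \<in> vspace (degs 2)" if "i < n" "j < n" for i j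
    using that by (simp add: svec_def degs_def sbasis_def)
  then have "(\<lambda>z. \<Sum>j<n. C $$ (i, j) * tens (svec G i) (svec G j) z) \<in> vspace (degs 2)" if "i < n"
    for i
    by (rule vspace_sum) (use that in auto)
  then show ?thesis
    unfolding stensor_def
    using vspace_sum[where c = "\<lambda>_. 1" and I = "{..<n}" and X = "degs 2"
        and F = "\<lambda>i z. \<Sum>j<n. C $$ (i, j) * tens (svec G i) (svec G j) z"] by simp
qed

lemma sprim_degs: "i < n \<Longrightarrow> sprim G i \<in> vspace (degs 1)"
proof -
  assume i: "i < n"
  have "avec i \<in> vspace (degs 1)" "bvec i \<in> vspace (degs 1)"
    using i by (simp_all add: svec_def sgrp_def degs_def sbasis_def)
  then show ?thesis using vspace_lincomb[of "avec i" "degs 1" "bvec i" 1] by (simp add: sprim_def)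
qed

lemma beta_power_degs:
  assumes "v \<in> vspace (degs j)" shows "app (beta C ^ k) v \<in> vspace (degs (2 * k + j))"
proof (induction k)
  case (Suc k)
  have "stensor G n C \<diamondop> app (beta C ^ k) v \<in> vspace (degs (2 + (2 * k + j)))"
    by (intro sup_degs stensor_degs Suc.IH)
  then show ?case by simp
qed (use assms in simp)

text \<open>Each factor raises the total degree by 2, and the largest total degree is
  \<open>2 * n\<close>.\<close>

lemma beta_nilpotent:
  assumes "n < k" shows "beta C ^ k = 0"
proof (rule lop_eqI)
  fix v
  obtain m where k: "k = Suc m" using assms by (cases k) auto
  \<comment> \<open>The argument is an arbitrary function; it is truncated at the first
    multiplication in order to enter the filtration.\<close>
  have "app (beta C ^ k) v = app (beta C ^ m) (stensor G n C \<diamondop> restrict_to (X \<times> X) v)"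
    by (simp only: k power_Suc2 app_simps app_sop sup_restrict2)
  moreover have "stensor G n C \<diamondop> restrict_to (X \<times> X) v \<in> vspace (degs 2)"
    using sup_degs[OF stensor_degs, of "restrict_to (X \<times> X) v" 0] by (simp add: degs_0)
  ultimately have "app (beta C ^ k) v \<in> vspace (degs (2 * m + 2))"
    using beta_power_degs[of "stensor G n C \<diamondop> restrict_to (X \<times> X) v" 2 C m] by (simp only:)
  then show "app (beta C ^ k) v = app 0 v"
    using degs_top[of "2 * m + 2"] assms k by (simp add: fun_eq_iff)
qed

text \<open>The bound \<open>Suc n\<close> instead of \<open>n\<close> keeps the linear term when \<open>n = 0\<close>.\<close>

abbreviation "ebeta C \<equiv> eop (Suc n) (beta C)"

lemma super_exp_stensor: "super_exp G n \<rho> (stensor G n C) = app (ebeta C) (sone2 G)"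
proof
  fix z
  have "(sup (stensor G n C) ^^ k) (sone2 G) z / fact k = app (eterm k (beta C)) (sone2 G) z" for k
    by (simp add: eterm_def app_power)
  then have "super_exp G n \<rho> (stensor G n C) z = (\<Sum>k. app (eterm k (beta C)) (sone2 G) z)"
    by (simp add: super_exp_def)
  also have "\<dots> = (\<Sum>k\<le>Suc n. app (eterm k (beta C)) (sone2 G) z)"
    by (rule suminf_finite) (auto simp: eterm_def beta_nilpotent simp del: power_Suc)
  finally show "super_exp G n \<rho> (stensor G n C) z = app (ebeta C) (sone2 G) z"
    by (simp add: eop_def app_sum)
qed

lemma sop_app_power: "sop (app (sop s ^ k) t) = sop s ^ k * sop t"
  by (induction k) (simp_all add: sop_mult mult.assoc)

lemma sop_app_eop: "sop (app (eop N (sop s)) t) = eop N (sop s) * sop t"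
proof -
  have "app (eop N (sop s)) t = (\<lambda>z. \<Sum>k\<le>N. 1 / fact k * app (sop s ^ k) t z)"
    by (simp add: fun_eq_iff eop_def app_sum eterm_def)
  then show ?thesis
    by (simp only: sop_sum sop_app_power eop_def eterm_def sum_distrib_right mult.assoc)
qed

lemma sop_app_prod_list: "sop (app (prod_list (map (\<lambda>i. sop (f i)) l)) t) =
  prod_list (map (\<lambda>i. sop (f i)) l) * sop t"
  by (induction l) (simp_all add: sop_mult mult.assoc)

text \<open>The coproduct, before twisting, of the product of the \<open>e i\<close> with
  \<open>i \<in> S\<close>.\<close>

definition palt :: "nat set \<Rightarrow> ('g \<times> nat set) \<times> ('g \<times> nat set) \<Rightarrow> complex" where
  "palt S = app (altprod pop S) (sone2 G)"

text \<open>With \<open>coc B g = B - g\<^sup>-\<^sup>1 B\<close>, the twisted coproduct of \<open>(g, S)\<close> is \<open>g \<otimes> g\<close> times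
  \<open>wtw (coc B g) S\<close>, because \<open>J\<close> commutes with the coproducts of the vectors in \<open>V\<close>.\<close>

definition wtw :: "complex mat \<Rightarrow> nat set \<Rightarrow> ('g \<times> nat set) \<times> ('g \<times> nat set) \<Rightarrow> complex" where
  "wtw C S = app (ebeta C) (palt S)"

lemma sop_palt: "sop (palt S) = altprod pop S * sop (sone2 G)"
  by (simp add: palt_def altprod_def sop_app_prod_list)

lemma scomult_delta:
  assumes "(g, S) \<in> X" shows "scomult G n \<rho> (delta (g, S)) = dg g \<diamondop> palt S"
  using assms by (simp add: scomult_def lin_ext_delta finX palt_def altprod_def app_prod_list)

lemma ebeta_altprod_commute:
  assumes "S \<subseteq> {..<n}" shows "altprod pop S * ebeta C = ebeta C * altprod pop S"
proof -
  have "beta C * prod_list (map pop l) = prod_list (map pop l) * beta C" if "set l \<subseteq> {..<n}" for l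
    using that by (induction l) (simp_all add: commute_mult beta_pop_commute)
  then have "beta C * altprod pop S = altprod pop S * beta C"
    using assms finite_subset[of S "{..<n}"] by (simp add: altprod_def)
  then show ?thesis by (intro eop_intertwine[symmetric])
qed

lemma ebeta_add:
  assumes "C \<in> carrier_mat n n" "D \<in> carrier_mat n n"
  shows "ebeta C * ebeta D = ebeta (C + D)"
  using beta_nilpotent[of "Suc (Suc n)"]
  by (subst eop_add) (simp_all add: beta_commute beta_lincomb[OF assms, symmetric] del: power_Suc)

text \<open>A coboundary for the action of \<open>G\<close> on symmetric tensors. It vanishes for
  all \<open>g\<close> exactly when \<open>B\<close> is invariant, which is how classes modulo
  invariant tensors are detected (\<open>S2_rel_iff\<close>).\<close>

definition coc :: "complex mat \<Rightarrow> 'g \<Rightarrow> complex mat" where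
  "coc B g = B - tensor_act (\<rho> (inv g)) B"

lemma tensor_act_comp:
  assumes "R \<in> carrier_mat n n" "S \<in> carrier_mat n n" "C \<in> carrier_mat n n"
  shows "tensor_act R (tensor_act S C) = tensor_act (R * S) C"
  using assms
  by (simp add: tensor_act_def transpose_mult[of _ n n _ n] assoc_mult_mat[of _ n n _ n _ n])

lemma tensor_act_uminus:
  assumes "R \<in> carrier_mat n n" "C \<in> carrier_mat n n"
  shows "tensor_act R (- C) = - tensor_act R C"
proof (rule eq_matI)
  have c: "tensor_act R C \<in> carrier_mat n n" "tensor_act R (- C) \<in> carrier_mat n n"
    using assms by (intro tensor_act_carrier; simp)+
  fix k l assume "k < dim_row (- tensor_act R C)" "l < dim_col (- tensor_act R C)"
  then have "k < n" "l < n" using c by auto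
  then show "tensor_act R (- C) $$ (k, l) = (- tensor_act R C) $$ (k, l)"
    using assms c by (simp add: tensor_act_entry sum_negf)
qed (use assms in \<open>simp_all add: tensor_act_def\<close>)

lemma tensor_act_one: "C \<in> carrier_mat n n \<Longrightarrow> tensor_act (1\<^sub>m n) C = C"
  by (simp add: tensor_act_def)

lemma rep_inv:
  assumes "g \<in> carrier G" shows "\<rho> g * \<rho> (inv g) = 1\<^sub>m n" "\<rho> (inv g) * \<rho> g = 1\<^sub>m n"
  using assms by (simp_all add: rep_mult[symmetric] rep_one)

text \<open>Moving \<open>exp (-B)\<close> to the right past g \<otimes> g turns its exponent into
  -g^-1 B. The other exponential commutes with the coproduct of the vectors, and the two commuting
  exponentials multiply.\<close>

lemma twisted_comult_delta:
  assumes B: "B \<in> carrier_mat n n" and gS: "(g, S) \<in> X"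
  shows "twisted_comult G n \<rho> B (delta (g, S)) = dg g \<diamondop> wtw (coc B g) S"
proof -
  have g: "g \<in> carrier G" and S: "S \<subseteq> {..<n}" using gS by (auto simp: sbasis_def)
  let ?C = "tensor_act (\<rho> (inv g)) B"
  have C: "?C \<in> carrier_mat n n" using g B by (intro tensor_act_carrier rep_carrier) auto
  have "tensor_act (\<rho> g) ?C = B"
    using g B by (simp add: tensor_act_comp rep_inv tensor_act_one)
  then have "tensor_act (\<rho> g) (- ?C) = - B"
    using C rep_carrier[OF g] by (simp add: tensor_act_uminus)
  then have "dop g * beta (- ?C) = beta (- B) * dop g"
    using dop_beta[OF g, of "- ?C"] C by simp
  then have intw: "ebeta (- B) * dop g = dop g * ebeta (- ?C)"
    by (intro eop_intertwine) simp
  have cb: "coc B g = - ?C + B"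
    using B C by (auto simp: coc_def)
  let ?t = "twisted_comult G n \<rho> B (delta (g, S))"
  have se: "sop (super_exp G n \<rho> (stensor G n B)) = ebeta B * sop (sone2 G)" for B
    by (simp only: super_exp_stensor sop_app_eop)
  \<comment> \<open>The truncation is absorbed to the left of any \<open>sop s\<close>, because
    products lie in \<open>vspace (X \<times> X)\<close>.\<close>
  have one: "sop (sone2 G) * sop s = sop s" for s
    by (rule lop_eqI) (simp add: sone2_left sup_vspace)
  have "sop ?t = ebeta (- B) * (sop (sone2 G) * (dop g * (altprod pop S * (sop (sone2 G) *
    (ebeta B * sop (sone2 G))))))"
    unfolding twisted_comult_def sop_mult se scomult_delta[OF gS] sop_palt by (simp only: mult.assoc)
  also have "sop (sone2 G) * (ebeta B * sop (sone2 G)) = ebeta B * sop (sone2 G)"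
    using one[of "super_exp G n \<rho> (stensor G n B)"] by (simp only: se)
  also have "ebeta (- B) * (sop (sone2 G) * (dop g * (altprod pop S * (ebeta B * sop (sone2 G))))) =
      (ebeta (- B) * dop g) * (altprod pop S * ebeta B) * sop (sone2 G)"
    by (simp only: mult.assoc[symmetric] one)
  also have "\<dots> = dop g * (ebeta (- ?C) * ebeta B) * altprod pop S * sop (sone2 G)"
    unfolding intw ebeta_altprod_commute[OF S] by (simp only: mult.assoc)
  also have "\<dots> = dop g * (ebeta (coc B g) * (altprod pop S * sop (sone2 G)))"
    using B C by (simp add: ebeta_add cb mult.assoc)
  also have "\<dots> = sop (dg g \<diamondop> wtw (coc B g) S)"
    by (simp only: wtw_def sop_mult sop_app_eop sop_palt)
  finally show ?thesis
    by (intro sop_inj) (simp_all add: sup_vspace twisted_comult_def)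
qed

lemma clin_twisted_comult: "clin (twisted_comult G n \<rho> B)"
  unfolding twisted_comult_def scomult_def
  by (intro clin_comp[OF clin_sup2] clin_comp[OF clin_sup1] clin_lin_ext)

lemma twisted_comult_restrict: "twisted_comult G n \<rho> B (restrict_to X x) = twisted_comult G n \<rho> B x"
  by (simp add: twisted_comult_def scomult_def lin_ext_restrict)

lemma twisted_comult_eq:
  assumes "B \<in> carrier_mat n n"
  shows "twisted_comult G n \<rho> B x = lin_ext X (\<lambda>(g, S). dg g \<diamondop> wtw (coc B g) S) x"
proof -
  have "twisted_comult G n \<rho> B (restrict_to X x) =
    lin_ext X (\<lambda>p. twisted_comult G n \<rho> B (delta p)) (restrict_to X x)"
    by (intro clin_eq_lin_ext clin_twisted_comult finX) simp
  then have "twisted_comult G n \<rho> B x = lin_ext X (\<lambda>p. twisted_comult G n \<rho> B (delta p)) x"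
    by (simp only: twisted_comult_restrict lin_ext_restrict)
  also have "\<dots> = lin_ext X (\<lambda>(g, S). dg g \<diamondop> wtw (coc B g) S) x"
    unfolding lin_ext_def by (intro ext sum.cong) (auto simp: twisted_comult_delta[OF assms])
  finally show ?thesis .
qed

lemma palt_degs:
  assumes "S \<subseteq> {..<n}" shows "palt S \<in> vspace (degs (card S))"
proof -
  have "app (prod_list (map pop l)) (sone2 G) \<in> vspace (degs (length l))" if "set l \<subseteq> {..<n}" for l
    using that
  proof (induction l)
    case (Cons i l)
    then show ?case using sup_degs[OF sprim_degs, of i] by simp
  qed (simp add: degs_0 sone2_vspace)
  from this[of "sorted_list_of_set S"] show ?thesis
    using assms finite_subset[of S "{..<n}"] by (simp add: palt_def altprod_def)
qed

section \<open>Coefficients of the twisted coproduct in total degree at most 2\<close>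

abbreviation "X1 \<equiv> {\<one>} \<times> E"

lemma sup_X1:
  assumes "s \<in> vspace (X1 \<times> X1)" "t \<in> vspace (X1 \<times> X1)"
  shows "s \<diamondop> t \<in> vspace (X1 \<times> X1)"
proof (rule bilin_vspaceI[OF clin_sup1 clin_sup2 _ _ _ assms])
  show "finite (X1 \<times> X1)" "finite (X1 \<times> X1)" by simp_all
  fix p q assume pq: "p \<in> X1 \<times> X1" "q \<in> X1 \<times> X1"
  obtain a b c d where e: "p = (a, b)" "q = (c, d)" by (cases p, cases q)
  then have m: "a \<in> X1" "b \<in> X1" "c \<in> X1" "d \<in> X1" using pq by auto
  have sub: "X1 \<subseteq> X" by (auto simp: sbasis_def)
  have 1: "delta a \<star> delta c \<in> vspace X1" if "a \<in> X1" "c \<in> X1" for a c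
  proof -
    have "delta a \<star> delta c = gx \<one> (wedge (act \<one> (delta (snd a))) (delta (snd c)))"
      using that sub sm_delta[of \<one> "snd a" \<one> "snd c"] by (auto simp: sbasis_def)
    moreover have "wedge (act \<one> (delta (snd a))) (delta (snd c)) \<in> vspace E"
      using that by (intro wedge_vspace ext_act_vspace) auto
    ultimately show ?thesis by (auto simp: vspace_def)
  qed
  have "tens (delta a \<star> delta c) (delta b \<star> delta d) \<in> vspace (X1 \<times> X1)"
    using m by (intro tens_in_vspace 1)
  moreover have "a \<in> X" "b \<in> X" "c \<in> X" "d \<in> X" using m sub by auto
  ultimately show "delta p \<diamondop> delta q \<in> vspace (X1 \<times> X1)"
    unfolding e by (simp add: sup_delta) (simp add: vspace_def)
qed

lemma sprim_delta: "sprim G i = (\<lambda>z. delta ((\<one>, {i}), (\<one>, {})) z + delta ((\<one>, {}), (\<one>, {i})) z)"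
  by (simp add: sprim_def svec_def sgrp_def)

lemma sone2_delta: "sone2 G = delta ((\<one>, {}), (\<one>, {}))"
  by (simp add: sone2_def sgrp_def)

lemma palt_X1:
  assumes "S \<subseteq> {..<n}" shows "palt S \<in> vspace (X1 \<times> X1)"
proof -
  have sp: "sprim G i \<in> vspace (X1 \<times> X1)" if "i < n" for i
    using that by (auto simp: sprim_delta vspace_def delta_def)
  have "app (prod_list (map pop l)) (sone2 G) \<in> vspace (X1 \<times> X1)" if "set l \<subseteq> {..<n}" for l
    using that
  proof (induction l)
    case (Cons i l)
    then show ?case using sup_X1[OF sp, of i] by simp
  qed (simp add: sone2_delta)
  from this[of "sorted_list_of_set S"] show ?thesis
    using assms finite_subset[of S "{..<n}"] by (simp add: palt_def altprod_def)
qed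

lemma stensor_apply:
  "stensor G n C ((k, S), (h, T)) =
    (if k = \<one> \<and> h = \<one> then \<Sum>i<n. \<Sum>j<n. C $$ (i, j) * (delta {i} S * delta {j} T) else 0)"
  by (auto simp: stensor_def svec_def delta_def intro!: sum.neutral sum.cong)

lemma stensor_coeff:
  assumes "i < n" "j < n" shows "stensor G n C ((\<one>, {i}), (\<one>, {j})) = C $$ (i, j)"
proof -
  have "stensor G n C ((\<one>, {i}), (\<one>, {j})) = (\<Sum>a<n. \<Sum>b<n. if b = j then (if a =
    i then C $$ (i, j) else 0) else 0)"
    unfolding stensor_apply simp_thms if_True by (intro sum.cong refl) (auto simp: delta_def)
  then show ?thesis using assms by simp
qed

lemma palt_empty: "palt {} = sone2 G"
  by (simp add: palt_def)

lemma palt_single: "i < n \<Longrightarrow> palt {i} = sprim G i"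
  using sprim_degs[of i] by (simp add: palt_def sone2_right vspace_degs)

text \<open>Each power of the exponent adds 2 to the degree, so only the constant and the linear
  term of the exponential are visible, and the linear one only on top of the unit.\<close>

lemma wtw_low:
  assumes "S \<subseteq> {..<n}" "card S' + card T' \<le> 2"
  shows "wtw C S ((k, S'), (h, T')) =
    palt S ((k, S'), (h, T')) + (if S = {} then stensor G n C ((k, S'), (h, T')) else 0)"
proof -
  let ?z = "((k, S'), (h, T'))"
  have fS: "finite S" using assms(1) finite_subset by blast
  have hi: "app (eterm j (beta C)) (palt S) ?z = 0" if "2 \<le> j" for j
    using degs_apply[OF beta_power_degs[OF palt_degs[OF assms(1)]], of "(k, S')"
      "(h, T')" j C] that assms(2)
    by (simp add: eterm_def)
  have "wtw C S ?z = (\<Sum>j\<le>Suc n. app (eterm j (beta C)) (palt S) ?z)"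
    by (simp add: wtw_def eop_def app_sum)
  \<comment> \<open>The index 1 belongs to the range also for \<open>n = 0\<close>, due to the bound
    \<open>Suc n\<close>.\<close>
  also have "\<dots> = (\<Sum>j\<in>{0, 1}. app (eterm j (beta C)) (palt S) ?z)"
    by (rule sum.mono_neutral_right) (auto intro!: hi)
  also have "\<dots> = palt S ?z + (stensor G n C \<diamondop> palt S) ?z"
    by (simp add: eterm_def)
  also have "(stensor G n C \<diamondop> palt S) ?z = (if S = {} then stensor G n C ?z else 0)"
  proof (cases "S = {}")
    case True
    then show ?thesis by (simp add: palt_empty sone2_right vspace_degs[OF stensor_degs])
  next
    case False
    then have "0 < card S" using fS by (simp add: card_gt_0_iff)
    then show ?thesis
      using False degs_apply[OF sup_degs[OF stensor_degs palt_degs[OF assms(1)]], of "(k, S')"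
        "(h, T')"] assms(2)
      by simp
  qed
  finally show ?thesis .
qed

lemma palt_00:
  assumes "S \<subseteq> {..<n}" shows "palt S ((\<one>, {}), (\<one>, {})) = (if S = {} then 1 else 0)"
proof (cases "S = {}")
  case False
  then have "0 < card S" using assms finite_subset[of S "{..<n}"] by (simp add: card_gt_0_iff)
  then show ?thesis
    using False degs_apply[OF palt_degs[OF assms], of "(\<one>, {})" "(\<one>, {})"] by simp
qed (simp add: palt_empty sone2_delta)

lemma palt_1:
  assumes "S \<subseteq> {..<n}" "i < n"
  shows "palt S ((\<one>, {i}), (\<one>, {})) = (if S = {i} then 1 else 0)"
    "palt S ((\<one>, {}), (\<one>, {i})) = (if S = {i} then 1 else 0)"
proof -
  have fS: "finite S" using assms(1) finite_subset by blast
  consider "S = {}" | j where "S = {j}" | "1 < card S"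
    using fS by (metis One_nat_def card_0_eq card_1_singletonE less_one linorder_neqE_nat)
  then have "palt S ((\<one>, {i}), (\<one>, {})) = (if S = {i} then 1 else 0) \<and>
    palt S ((\<one>, {}), (\<one>, {i})) = (if S = {i} then 1 else 0)"
  proof cases
    case 1
    then show ?thesis by (simp add: palt_empty sone2_delta delta_def)
  next
    case 2
    then show ?thesis using assms by (auto simp: palt_single sprim_delta delta_def)
  next
    case 3
    then show ?thesis
      using degs_apply[OF palt_degs[OF assms(1)], of "(\<one>, {i})" "(\<one>, {})"]
        degs_apply[OF palt_degs[OF assms(1)], of "(\<one>, {})" "(\<one>, {i})"] by auto
  qed
  then show "palt S ((\<one>, {i}), (\<one>, {})) = (if S = {i} then 1 else 0)"
    "palt S ((\<one>, {}), (\<one>, {i})) = (if S = {i} then 1 else 0)" by auto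
qed

lemma sprim_sprim_11:
  assumes "a < n" "b < n"
  shows "(sprim G a \<diamondop> sprim G b) ((\<one>, {i}), (\<one>, {j})) =
    (if i = a \<and> j = b then 1 else 0) - (if i = b \<and> j = a then 1 else 0)"
proof -
  have "sprim G a \<diamondop> sprim G b = (\<lambda>z. (avec a \<diamondop> avec b) z + (avec a \<diamondop> bvec b) z +
      ((bvec a \<diamondop> avec b) z + (bvec a \<diamondop> bvec b) z))"
    unfolding sprim_def clin_add[OF clin_sup1] clin_add[OF clin_sup2] by (simp add: algebra_simps)
  then have e: "(sprim G a \<diamondop> sprim G b) ((\<one>, {i}), (\<one>, {j})) =
      svec G a (\<one>, {i}) * svec G b (\<one>, {j}) - svec G b (\<one>, {i}) * svec G a (\<one>, {j})"
    unfolding sup_ab(1-3)[OF assms] sup_ab(4)[OF assms(2,1)] by (simp add: sgrp_def delta_def)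
  have v: "svec G a (\<one>, {i}) = (if i = a then 1 else 0)" for a i
    by (simp add: svec_def delta_def)
  have "(if P then 1 else 0) * (if Q then 1 else 0) = (if P \<and> Q then 1 else 0 :: complex)" for P Q
    by simp
  then show ?thesis unfolding e v by (simp only:)
qed

text \<open>Only sets of two elements a < b contribute in bidegree (1, 1), with e_a \<otimes> e_b -
  e_b \<otimes> e_a.\<close>

lemma palt_11_antisym:
  assumes "S \<subseteq> {..<n}"
  shows "palt S ((\<one>, {i}), (\<one>, {j})) + palt S ((\<one>, {j}), (\<one>, {i})) = 0"
proof -
  have fS: "finite S" using assms(1) finite_subset by blast
  consider "S = {}" | a where "S = {a}" | a b where "S = {a, b}" "a < b" | "2 < card S"
  proof (cases "card S" "2::nat" rule: linorder_cases)
    case less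
    then have "card S = 0 \<or> card S = 1" by linarith
    then show ?thesis
    proof
      assume "card S = 0"
      then have "S = {}" using fS by simp
      then show ?thesis by (rule that(1))
    next
      assume "card S = 1"
      then obtain a where "S = {a}" by (rule card_1_singletonE)
      then show ?thesis by (rule that(2))
    qed
  next
    case equal
    then obtain a b where ab: "S = {a, b}" "a \<noteq> b" by (auto simp: card_2_iff)
    show ?thesis
    proof (cases "a < b")
      case False
      then have "S = {b, a}" "b < a" using ab by auto
      then show ?thesis by (rule that(3))
    qed (rule that(3)[OF ab(1)])
  qed (use that(4) in simp)
  then show ?thesis
  proof cases
    case 1
    then show ?thesis by (simp add: palt_empty sone2_delta delta_def)
  next
    case 2
    then show ?thesis using assms by (auto simp: palt_single sprim_delta delta_def)
  next
    case 3
    then have ab: "a < n" "b < n" using assms by auto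
    have e: "palt S = sprim G a \<diamondop> sprim G b"
      using 3 ab sprim_degs[of b] by (simp add: palt_def altprod_two sone2_right vspace_degs)
    show ?thesis unfolding e sprim_sprim_11[OF ab] by (simp add: conj_commute)
  next
    case 4
    then show ?thesis
      using degs_apply[OF palt_degs[OF assms(1)], of "(\<one>, {i})" "(\<one>, {j})"]
        degs_apply[OF palt_degs[OF assms(1)], of "(\<one>, {j})" "(\<one>, {i})"] by auto
  qed
qed

text \<open>Group elements are even, so multiplying by them translates the group components without
  any sign.\<close>

lemma sgrp_sup_apply:
  assumes "g \<in> carrier G" "g' \<in> carrier G" "k \<in> carrier G" "h \<in> carrier G" "t \<in> vspace (X \<times> X)"
  shows "(tens (sgrp g) (sgrp g') \<diamondop> t) ((k, S), (h, T)) = t ((inv g \<otimes> k, S), (inv g' \<otimes> h, T))"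
proof -
  \<comment> \<open>The translation as a map on all functions, so that it can be compared on basis
    elements; the guard gives the value 0 outside \<open>G\<close>.\<close>
  define M where "M t = (\<lambda>((k, S), (h, T)). if k \<in> carrier G \<and> h \<in> carrier G
    then t ((inv g \<otimes> k, S), (inv g' \<otimes> h, T)) else 0)" for t :: "('g \<times> nat set) \<times> ('g \<times> nat set) \<Rightarrow>
      complex"
  have "tens (sgrp g) (sgrp g') \<diamondop> t = M t"
  proof (rule clin_eqI[OF clin_sup2 _ finXX _ assms(5)])
    show "clin M" by (rule clinI) (auto simp: M_def split: prod.split)
    fix p assume "p \<in> X \<times> X"
    then obtain a S b T where p: "p = ((a, S), (b, T))" "(a, S) \<in> X" "(b, T) \<in> X"
      "a \<in> carrier G" "b \<in> carrier G" by (auto simp: sbasis_def)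
    have "tens (sgrp g) (sgrp g') \<diamondop> tens (delta (a, S)) (delta (b, T)) =
        tens (sgrp g \<star> delta (a, S)) (sgrp g' \<star> delta (b, T))"
      using sup_tens[OF sgrp_vspace[OF assms(1)] sgrp_par[OF assms(2)] delta_par[OF p(2)], of
        "delta (b, T)"] p
      by simp
    then have L: "tens (sgrp g) (sgrp g') \<diamondop> delta p = delta ((g \<otimes> a, S), (g' \<otimes> b, T))"
      using p assms(1,2) by (simp add: sm_sgrp_delta)
    have e: "k = g \<otimes> a \<longleftrightarrow> k \<in> carrier G \<and> inv g \<otimes> k = a" if "g \<in> carrier G" "a \<in> carrier G" for g k a
      using that by (metis inv_solve_left m_closed)
    show "tens (sgrp g) (sgrp g') \<diamondop> delta p = M (delta p)"
    proof (rule ext, clarify)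
      fix k S' h T'
      have if_iff: "(if P \<and> Q then 1 else 0) =
        (if K \<and> H then if P' \<and> Q' then 1 else 0 else 0 :: complex)"
        if "P \<longleftrightarrow> K \<and> P'" "Q \<longleftrightarrow> H \<and> Q'" for P Q P' Q' K H :: bool
        using that by auto
      have "delta ((g \<otimes> a, S), (g' \<otimes> b, T)) ((k, S'), (h, T')) =
        (if (k, S') = (g \<otimes> a, S) \<and> (h, T') = (g' \<otimes> b, T) then 1 else 0)"
        by (simp add: delta_def)
      also have "\<dots> = (if k \<in> carrier G \<and> h \<in> carrier G then
          if (inv g \<otimes> k, S') = (a, S) \<and> (inv g' \<otimes> h, T') = (b, T) then 1 else 0 else 0)"
        by (rule if_iff)
          (use e[OF assms(1) p(4), of k] e[OF assms(2) p(5), of h] in \<open>simp_all only: prod.inject,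
            blast+\<close>)
      also have "\<dots> = M (delta p) ((k, S'), (h, T'))"
        by (simp add: M_def p(1) delta_def)
      finally show "(tens (sgrp g) (sgrp g') \<diamondop> delta p) ((k, S'), (h, T')) =
        M (delta p) ((k, S'), (h, T'))"
        unfolding L .
    qed
  qed
  then show ?thesis using assms by (simp add: M_def)
qed

lemma wtw_vspace: "S \<subseteq> {..<n} \<Longrightarrow> wtw C S \<in> vspace (X \<times> X)"
proof -
  assume S: "S \<subseteq> {..<n}"
  have "app (beta C ^ k) (palt S) \<in> vspace (X \<times> X)" for k
    using beta_power_degs[OF palt_degs[OF S]] by (rule vspace_degs)
  then have "(\<lambda>z. \<Sum>k\<le>Suc n. 1 / fact k * app (beta C ^ k) (palt S) z) \<in> vspace (X \<times> X)"
    by (intro vspace_sum)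
  moreover have "(\<lambda>z. \<Sum>k\<le>Suc n. 1 / fact k * app (beta C ^ k) (palt S) z) = wtw C S"
    unfolding wtw_def eop_def by (auto simp: fun_eq_iff app_sum eterm_def simp del: sum.atMost_Suc
      power_Suc)
  ultimately show ?thesis by simp
qed

lemma twisted_comult_low:
  assumes "B \<in> carrier_mat n n" "k \<in> carrier G" "h \<in> carrier G" "card S' + card T' \<le> 2"
  shows "twisted_comult G n \<rho> B y ((k, S'), (h, T')) =
    (if k = h then \<Sum>S\<in>E. y (h, S) * wtw (coc B h) S ((\<one>, S'), (\<one>, T')) else 0)"
proof -
  \<comment> \<open>In these degrees the factor to the right of g \<otimes> g has no group component
    except (\<one>, \<one>). Hence only the summand with g = k = h remains.\<close>
  have w0: "wtw C S ((k', S'), (h', T')) = 0" if "S \<subseteq> {..<n}" "\<not> (k' = \<one> \<and> h' = \<one>)" for C S k' h'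
    using that palt_X1[OF that(1)] wtw_low[OF that(1) assms(4), of C k' h']
    by (auto simp: vspace_def stensor_apply)
  have "twisted_comult G n \<rho> B y ((k, S'), (h, T')) =
    (\<Sum>(g, S)\<in>carrier G \<times> E. y (g, S) * wtw (coc B g) S ((inv g \<otimes> k, S'), (inv g \<otimes> h, T')))"
    unfolding twisted_comult_eq[OF assms(1)] lin_ext_def sbasis_def
    using assms(2,3) by (intro sum.cong refl) (auto simp: sgrp_sup_apply wtw_vspace)
  also have "\<dots> = (\<Sum>g\<in>carrier G. \<Sum>S\<in>E. y (g, S) * wtw (coc B g) S ((inv g \<otimes> k, S'), (inv g \<otimes> h, T')))"
    by (rule sum.cartesian_product[symmetric])
  also have "\<dots> = (\<Sum>g\<in>carrier G. if g = h then
      (if k = h then \<Sum>S\<in>E. y (h, S) * wtw (coc B h) S ((\<one>, S'), (\<one>, T')) else 0) else 0)"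
  proof (rule sum.cong[OF refl])
    fix g assume g: "g \<in> carrier G"
    have e: "inv g \<otimes> k = \<one> \<longleftrightarrow> g = k" if "k \<in> carrier G" for k
      using that g by (metis inv_solve_left l_inv r_one one_closed)
    show "(\<Sum>S\<in>E. y (g, S) * wtw (coc B g) S ((inv g \<otimes> k, S'), (inv g \<otimes> h, T'))) =
      (if g = h then (if k = h then \<Sum>S\<in>E. y (h, S) * wtw (coc B h) S ((\<one>, S'), (\<one>, T')) else 0)
        else 0)"
      using e[OF assms(2)] e[OF assms(3)] w0 g by (auto intro!: sum.neutral)
  qed
  also have "\<dots> = (if k = h then \<Sum>S\<in>E. y (h, S) * wtw (coc B h) S ((\<one>, S'), (\<one>, T')) else 0)"
    using finG assms(3) by simp
  finally show ?thesis .
qed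

end

section \<open>The coproduct of \<open>A(G, V, u, B)\<close>\<close>

lemma clin_parity_inv: "clin parity_inv"
  by (rule clinI) (auto simp: parity_inv_def algebra_simps split: prod.split)

locale gvu = gv G n \<rho> for G :: "('g, 'm) monoid_scheme" (structure) and n \<rho> +
  fixes u :: 'g
  assumes uG [simp]: "u \<in> carrier G"
    and ucentral: "\<And>g. g \<in> carrier G \<Longrightarrow> u \<otimes> g = g \<otimes> u"
    and uu: "u \<otimes> u = \<one>" and rho_u: "\<rho> u = - 1\<^sub>m n"
begin

abbreviation "ttw \<equiv> twisted_comult G n \<rho>"
abbreviation "aco \<equiv> A_comult G n \<rho> u"

lemma inv_u [simp]: "inv u = u"
  using uu by (simp add: inv_equality)

lemma odd_part_vspace: "(\<lambda>w. if snd_even w then 0 else ttw B y w) \<in> vspace (X \<times> X)"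
  using sup_vspace by (auto simp: vspace_def twisted_comult_def)

text \<open>Multiplication by u \<otimes> 1 translates by the inverse of \<open>u\<close>, which is
  \<open>u\<close>.\<close>

lemma A_comult_apply:
  assumes "k \<in> carrier G" "h \<in> carrier G"
  shows "aco B y ((k, S), (h, T)) =
    (if even (card T) then ttw B y ((k, S), (h, T)) else - ttw B (parity_inv y) ((u \<otimes> k, S), (h, T)))"
  using assms by (simp add: A_comult_def sgrp_sup_apply odd_part_vspace) (simp add: snd_even_def)

lemma sum_E_single: "i < n \<Longrightarrow> (\<Sum>S\<in>E. y S * (if S = {i} then 1 else 0 :: complex)) = y {i}"
proof -
  assume "i < n"
  have "(\<Sum>S\<in>E. y S * (if S = {i} then 1 else 0 :: complex)) = (\<Sum>S\<in>E. if S = {i} then y {i} else 0)"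
    by (rule sum.cong) auto
  then show ?thesis using \<open>i < n\<close> by simp
qed

lemma sum_E_empty: "(\<Sum>S\<in>E. y S * (if S = {} then c else 0 :: complex)) = y {} * c"
proof -
  have "(\<Sum>S\<in>E. y S * (if S = {} then c else 0 :: complex)) = (\<Sum>S\<in>E. if S = {} then y {} * c else 0)"
    by (rule sum.cong) auto
  then show ?thesis by simp
qed

lemma stensor_0 [simp]:
  "stensor G n C ((k, {}), (h, T)) = 0" "stensor G n C ((k, S), (h, {})) = 0"
  by (simp_all add: stensor_apply delta_def)

context
  fixes B :: "complex mat" assumes B: "B \<in> carrier_mat n n"
begin

section \<open>The coproduct of A in bidegrees (0, 0), (1, 0), (0, 1), (1, 1), and on
  \<open>u\<close> and V\<close>

lemma A_comult_00:
  assumes "k \<in> carrier G" "h \<in> carrier G"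
  shows "aco B y ((k, {}), (h, {})) = (if k = h then y (h, {}) else 0)"
proof -
  have "(\<Sum>S\<in>E. y (h, S) * wtw (coc B h) S ((\<one>, {}), (\<one>, {}))) = y (h, {})"
    using sum_E_empty[of "\<lambda>S. y (h, S)" 1] by (simp add: wtw_low palt_00 cong: if_cong)
  then show ?thesis using assms B by (simp add: A_comult_apply twisted_comult_low)
qed

lemma A_comult_10:
  assumes "k \<in> carrier G" "h \<in> carrier G" "i < n"
  shows "aco B y ((k, {i}), (h, {})) = (if k = h then y (h, {i}) else 0)"
proof -
  have "(\<Sum>S\<in>E. y (h, S) * wtw (coc B h) S ((\<one>, {i}), (\<one>, {}))) = y (h, {i})"
    using sum_E_single[OF assms(3), of "\<lambda>S. y (h, S)"] assms(3)
    by (simp add: wtw_low palt_1 cong: if_cong)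
  then show ?thesis using assms B by (simp add: A_comult_apply twisted_comult_low)
qed

lemma A_comult_01:
  assumes "k \<in> carrier G" "h \<in> carrier G" "i < n"
  shows "aco B y ((k, {}), (h, {i})) = (if u \<otimes> k = h then y (h, {i}) else 0)"
proof -
  \<comment> \<open>The sign from the odd parity of \<open>{i}\<close> cancels the minus sign in
    front of the odd half of the coproduct.\<close>
  have "(\<Sum>S\<in>E. parity_inv y (h, S) * wtw (coc B h) S ((\<one>, {}), (\<one>, {i}))) = - y (h, {i})"
    using sum_E_single[OF assms(3), of "\<lambda>S. parity_inv y (h, S)"] assms(3)
    by (simp add: wtw_low palt_1 cong: if_cong) (simp add: parity_inv_def)
  then show ?thesis using assms B by (simp add: A_comult_apply twisted_comult_low)
qed

text \<open>The elements of \<open>\<Lambda>\<^sup>2V\<close> also contribute in bidegree (1, 1), but their contribution is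
  antisymmetric, so symmetrizing in \<open>i\<close>, \<open>j\<close> removes it.\<close>

lemma A_comult_11:
  assumes "k \<in> carrier G" "h \<in> carrier G" "i < n" "j < n"
  shows "aco B y ((k, {i}), (h, {j})) + aco B y ((k, {j}), (h, {i})) =
    (if u \<otimes> k = h then - y (h, {}) * (coc B h $$ (i, j) + coc B h $$ (j, i)) else 0)"
proof -
  let ?w = "wtw (coc B h)"
  have w: "?w S ((\<one>, {i}), (\<one>, {j})) + ?w S ((\<one>, {j}), (\<one>, {i})) =
      (if S = {} then coc B h $$ (i, j) + coc B h $$ (j, i) else 0)" if "S \<in> E" for S
    using that palt_11_antisym[of S i j] assms(3,4)
    by (auto simp: wtw_low stensor_coeff algebra_simps)
  have "(\<Sum>S\<in>E. parity_inv y (h, S) * ?w S ((\<one>, {i}), (\<one>, {j}))) +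
      (\<Sum>S\<in>E. parity_inv y (h, S) * ?w S ((\<one>, {j}), (\<one>, {i}))) =
      (\<Sum>S\<in>E. parity_inv y (h, S) * (if S = {} then coc B h $$ (i, j) + coc B h $$ (j, i) else 0))"
    unfolding sum.distrib[symmetric] distrib_left[symmetric] by (intro sum.cong refl) (simp only: w)
  also have "\<dots> = y (h, {}) * (coc B h $$ (i, j) + coc B h $$ (j, i))"
    unfolding sum_E_empty by (simp add: parity_inv_def)
  finally have "- (\<Sum>S\<in>E. parity_inv y (h, S) * ?w S ((\<one>, {i}), (\<one>, {j}))) +
      - (\<Sum>S\<in>E. parity_inv y (h, S) * ?w S ((\<one>, {j}), (\<one>, {i}))) =
      - y (h, {}) * (coc B h $$ (i, j) + coc B h $$ (j, i))"
    by (simp only: minus_add_distrib[symmetric] mult_minus_left)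
  then show ?thesis
    using assms B by (simp add: A_comult_apply twisted_comult_low)
qed

lemma coc_one: "coc B \<one> = 0\<^sub>m n n"
  using B by (simp add: coc_def rep_one tensor_act_one)

text \<open>The two signs of -1 cancel on tensors of degree 2, so the twist does not affect the
  coproduct of \<open>u\<close>.\<close>

lemma coc_u: "coc B u = 0\<^sub>m n n"
proof -
  have "- (1\<^sub>m n :: complex mat) * B * (- 1\<^sub>m n)\<^sup>T = B"
    using B by (simp add: transpose_uminus)
  then show ?thesis using B by (simp add: coc_def tensor_act_def rho_u)
qed

lemma A_comult_sgrp_u: "aco B (sgrp u) = tens (sgrp u) (sgrp u)"
proof -
  have "ttw B (delta (u, {})) = dg u \<diamondop> wtw (coc B u) {}"
    by (rule twisted_comult_delta[OF B]) (simp add: sbasis_def)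
  also have "wtw (coc B u) {} = sone2 G"
    by (simp add: coc_u wtw_def beta_zero palt_empty)
  also have "dg u \<diamondop> sone2 G = dg u"
    by (rule sone2_right) (simp add: tens_in_vspace)
  finally have t: "ttw B (sgrp u) = dg u"
    by (simp only: sgrp_def)
  have p: "parity_inv (sgrp u) = sgrp u"
    by (auto simp: parity_inv_def sgrp_def delta_def)
  have o: "(\<lambda>w. if snd_even w then 0 else dg u w) = (\<lambda>w. 0)"
    by (auto simp: snd_even_def sgrp_def delta_def)
  show ?thesis
    unfolding A_comult_def p t o clin_zero[OF clin_sup2]
    by (auto simp: snd_even_def sgrp_def delta_def)
qed

lemma A_comult_svec:
  assumes i: "i < n"
  shows "aco B (svec G i) = (\<lambda>z. tens (svec G i) (sgrp \<one>) z + tens (sgrp u) (svec G i) z)"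
proof -
  have "dg \<one> \<diamondop> sprim G i = sprim G i"
    using sone2_left[OF vspace_degs[OF sprim_degs[OF i]]] by (simp add: sone2_def)
  then have t: "ttw B (svec G i) = sprim G i"
    using B i twisted_comult_delta[OF B, of \<one> "{i}"]
    by (simp add: svec_def sbasis_def coc_one wtw_def beta_zero palt_single)
  \<comment> \<open>Vectors are odd, so this sign and the one in the definition of the coproduct
    leave +u \<otimes> v.\<close>
  have p: "parity_inv (svec G i) = (\<lambda>x. - svec G i x)"
    by (auto simp: parity_inv_def svec_def delta_def)
  have o: "(\<lambda>w. if snd_even w then 0 else - sprim G i w) = (\<lambda>w. - bvec i w)"
    by (auto simp: snd_even_def sprim_delta sgrp_def svec_def delta_def)
  have s: "tens (sgrp u) (sgrp \<one>) \<diamondop> bvec i = tens (sgrp u) (svec G i)"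
    using sup_tens[OF sgrp_vspace[OF uG] sgrp_par[of \<one>] sgrp_par[of \<one>] svec_vspace[OF i]] i
    by (simp add: sm_one_left sm_one_right)
  show ?thesis
    unfolding A_comult_def p t clin_uminus[OF clin_twisted_comult] o clin_uminus[OF clin_sup2] s
    by (auto simp: snd_even_def sprim_delta sgrp_def svec_def delta_def)
qed

end

end


section \<open>Isomorphisms from automorphisms of \<open>(G, V)\<close>\<close>

lemma invertible_matE:
  fixes \<eta> :: "complex mat"
  assumes "invertible_mat \<eta>" "\<eta> \<in> carrier_mat n n"
  obtains \<eta>' where "\<eta>' \<in> carrier_mat n n" "\<eta> * \<eta>' = 1\<^sub>m n" "\<eta>' * \<eta> = 1\<^sub>m n"
proof -
  obtain M where M: "inverts_mat \<eta> M" "inverts_mat M \<eta>" using assms(1)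
    by (auto simp: invertible_mat_def)
  have 1: "\<eta> * M = 1\<^sub>m n" using M(1) assms(2) by (simp add: inverts_mat_def)
  have 2: "M * \<eta> = 1\<^sub>m (dim_row M)" using M(2) by (simp add: inverts_mat_def)
  have "dim_col M = n" using arg_cong[OF 1, of dim_col] by simp
  moreover have "dim_row M = n" using arg_cong[OF 2, of dim_col] assms(2) by simp
  ultimately show ?thesis using that[of M] 1 2 by auto
qed

lemma invertible_matI:
  fixes \<eta> :: "complex mat"
  assumes "\<eta> \<in> carrier_mat n n" "\<eta>' \<in> carrier_mat n n" "\<eta> * \<eta>' = 1\<^sub>m n" "\<eta>' * \<eta> = 1\<^sub>m n"
  shows "invertible_mat \<eta>"
  using assms unfolding invertible_mat_def inverts_mat_def square_mat.simps by auto

lemma tensor_sq_delta: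
  "finite X \<Longrightarrow> a \<in> X \<Longrightarrow> b \<in> X \<Longrightarrow> tensor_sq X F (delta (a, b)) = tens (F (delta a)) (F (delta b))"
  unfolding tensor_sq_def by (simp add: lin_ext_delta)

lemma clin_tensor_sq: "clin (tensor_sq X F)"
  unfolding tensor_sq_def by (rule clin_lin_ext)

lemma tensor_sq_tens:
  assumes "clin F" "finite X" "x \<in> vspace X" "y \<in> vspace X"
  shows "tensor_sq X F (tens x y) = tens (F x) (F y)"
  by (rule bilin_eqI[OF clin_comp[OF clin_tensor_sq clin_tens1] clin_comp[OF clin_tensor_sq
    clin_tens2]
      clin_comp[OF clin_tens1 assms(1)] clin_comp[OF clin_tens2 assms(1)] assms(2,2) _ assms(3,4)])
    (simp add: tensor_sq_delta assms(2))

context gv begin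

text \<open>The map sending g a to \<phi>(g) \<eta>(a). No relation between \<open>\<phi>\<close>
  and \<open>\<eta>\<close> is built in, and the inverse is a map of the same form.\<close>

definition fm :: "('g \<Rightarrow> 'g) \<Rightarrow> complex mat \<Rightarrow> ('g \<times> nat set \<Rightarrow> complex) \<Rightarrow> 'g \<times> nat set \<Rightarrow> complex" where
  "fm \<phi> \<eta> = lin_ext X (\<lambda>(g, S). gx (\<phi> g) (ext_act n \<eta> (delta S)))"

lemma clin_fm: "clin (fm \<phi> \<eta>)"
  unfolding fm_def by (rule clin_lin_ext)

lemma fm_delta: "(g, S) \<in> X \<Longrightarrow> fm \<phi> \<eta> (delta (g, S)) = gx (\<phi> g) (ext_act n \<eta> (delta S))"
  by (simp add: fm_def lin_ext_delta finX)

lemma fm_gx: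
  assumes "g \<in> carrier G" "a \<in> vspace E"
  shows "fm \<phi> \<eta> (gx g a) = gx (\<phi> g) (ext_act n \<eta> a)"
  by (rule clin_eqI[OF clin_comp[OF clin_fm clin_gx] clin_comp[OF clin_gx clin_ext_act] _ _ assms(2)])
    (use assms(1) in \<open>auto simp: gx_delta fm_delta sbasis_def\<close>)

lemma fm_delta_deg:
  assumes "b \<in> X" "\<phi> \<in> carrier G \<rightarrow> carrier G" "\<eta> \<in> carrier_mat n n"
  shows "fm \<phi> \<eta> (delta b) \<in> vspace {c \<in> X. card (snd c) = card (snd b)}"
proof -
  obtain g S where b: "b = (g, S)" "g \<in> carrier G" "S \<subseteq> {..<n}"
    using assms(1) by (cases b) (auto simp: sbasis_def)
  have "ext_act n \<eta> (delta S) \<in> vspace E" by (rule ext_act_vspace[OF assms(3)])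
  moreover have "homog (card S) (ext_act n \<eta> (delta S))" by (rule homog_ext_act_delta[OF b(3)])
  ultimately show ?thesis
    using b assms(1,2) by (auto simp: fm_delta vspace_def sbasis_def homog_def)
qed

lemma fm_vspace:
  assumes "\<phi> \<in> carrier G \<rightarrow> carrier G" "\<eta> \<in> carrier_mat n n"
  shows "fm \<phi> \<eta> x \<in> vspace X"
  unfolding fm_def
proof (rule lin_ext_vspace)
  fix b assume b: "b \<in> X"
  then show "(case b of (g, S) \<Rightarrow> gx (\<phi> g) (ext_act n \<eta> (delta S))) \<in> vspace X"
    using vspace_mono[OF fm_delta_deg[OF b assms], of X] by (cases b) (auto simp: fm_delta)
qed

lemma fm_comp:
  assumes "x \<in> vspace X" "\<And>g. g \<in> carrier G \<Longrightarrow> \<phi> g \<in> carrier G" "\<And>g. g \<in> carrier G \<Longrightarrow> \<phi>' (\<phi> g) = g"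
    "\<eta> \<in> carrier_mat n n" "\<eta>' \<in> carrier_mat n n" "\<eta>' * \<eta> = 1\<^sub>m n"
  shows "fm \<phi>' \<eta>' (fm \<phi> \<eta> x) = x"
proof (rule clin_eqI[OF clin_comp[OF clin_fm clin_fm] clin_id finX _ assms(1)])
  fix b assume "b \<in> X"
  then obtain g S where b: "b = (g, S)" "g \<in> carrier G" "S \<subseteq> {..<n}" by (auto simp: sbasis_def)
  then show "fm \<phi>' \<eta>' (fm \<phi> \<eta> (delta b)) = delta b"
    using assms by (simp add: gx_delta[symmetric] fm_gx ext_act_vspace ext_act_comp ext_act_one)
qed

text \<open>Extends \<open>scomult_delta\<close> to arbitrary exterior elements, as needed for the
  image of a basis element under \<eta>.\<close>

lemma scomult_gx:
  assumes "g \<in> carrier G" "a \<in> vspace E"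
  shows "scomult G n \<rho> (gx g a) = dg g \<diamondop> app (hat n pop a) (sone2 G)"
proof (rule clin_eqI[OF _ _ _ _ assms(2)])
  show "clin (\<lambda>a. scomult G n \<rho> (gx g a))"
    unfolding scomult_def by (rule clin_comp[OF clin_lin_ext clin_gx])
  show "clin (\<lambda>a. dg g \<diamondop> app (hat n pop a) (sone2 G))"
    unfolding app_hat by (rule clin_comp[OF clin_sup2 clin_lin_ext])
  fix S assume "S \<in> E"
  then show "scomult G n \<rho> (gx g (delta S)) = dg g \<diamondop> app (hat n pop (delta S)) (sone2 G)"
    using assms(1) by (simp add: gx_delta scomult_delta sbasis_def hat_delta palt_def)
qed simp

end

locale gvaut = gvu G n \<rho> u for G :: "('g, 'm) monoid_scheme" (structure) and n \<rho> u +
  fixes \<phi> :: "'g \<Rightarrow> 'g" and \<eta> :: "complex mat"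
  assumes phi: "\<phi> \<in> hom G G" and phi_u: "\<phi> u = u"
    and eta [simp]: "\<eta> \<in> carrier_mat n n" and equiv: "\<And>g. g \<in> carrier G \<Longrightarrow> \<eta> * \<rho> g = \<rho> (\<phi> g) * \<eta>"
begin

lemma phi_closed [simp]: "g \<in> carrier G \<Longrightarrow> \<phi> g \<in> carrier G"
  using phi by (rule hom_in_carrier)

lemma phi_one [simp]: "\<phi> \<one> = \<one>"
  using phi by (rule hom_one[OF _ is_group is_group])

lemma phi_mult: "g \<in> carrier G \<Longrightarrow> h \<in> carrier G \<Longrightarrow> \<phi> (g \<otimes> h) = \<phi> g \<otimes> \<phi> h"
  using phi by (simp add: hom_mult)

lemma phi_inv: "g \<in> carrier G \<Longrightarrow> \<phi> (inv g) = inv (\<phi> g)"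
  using phi is_group group_hom.hom_inv[of G G \<phi>] by (simp add: group_hom_def group_hom_axioms_def)

lemma phi_funcset: "\<phi> \<in> carrier G \<rightarrow> carrier G" by simp

abbreviation "f \<equiv> fm \<phi> \<eta>"
abbreviation "ff \<equiv> tensor_sq X f"

lemmas f_vspace = fm_vspace[OF phi_funcset eta]
lemmas f_delta_deg = fm_delta_deg[OF _ phi_funcset eta]

lemma f_mult:
  assumes "x \<in> vspace X" "y \<in> vspace X" shows "f (x \<star> y) = f x \<star> f y"
proof (rule bilin_eqI[OF clin_comp[OF clin_fm clin_sm1] clin_comp[OF clin_fm clin_sm2]
      clin_comp[OF clin_sm1 clin_fm] clin_comp[OF clin_sm2 clin_fm] finX finX _ assms])
  fix a b assume "a \<in> X" "b \<in> X"
  then obtain g S h T where ab: "a = (g, S)" "b = (h, T)" and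
    c: "g \<in> carrier G" "h \<in> carrier G" "S \<subseteq> {..<n}" "T \<subseteq> {..<n}" by (auto simp: sbasis_def)
  have r: "\<eta> * \<rho> (inv h) = \<rho> (inv (\<phi> h)) * \<eta>" using equiv[of "inv h"] c by (simp add: phi_inv)
  have "wedge (act (inv h) (delta S)) (delta T) \<in> vspace E"
    using c by (intro wedge_vspace ext_act_vspace) auto
  then show "f (delta a \<star> delta b) = f (delta a) \<star> f (delta b)"
    unfolding ab gx_delta[symmetric] using c
    by (simp add: sm_gx fm_gx ext_act_wedge ext_act_comp phi_mult r)
qed

lemma f_sgrp: "g \<in> carrier G \<Longrightarrow> f (sgrp g) = sgrp (\<phi> g)"
  by (simp add: sgrp_gx fm_gx ext_act_empty)

lemma f_svec: "i < n \<Longrightarrow> f (svec G i) = (\<lambda>z. \<Sum>k<n. \<eta> $$ (k, i) * svec G k z)"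
proof -
  assume i: "i < n"
  have "ext_act n \<eta> (delta {i}) = (\<lambda>S. \<Sum>k<n. \<eta> $$ (k, i) * delta {k} S)"
    using i carrier_matD[OF eta] by (simp add: ext_act_single[OF _ eta] ext_vec_def)
  then show ?thesis using i by (simp add: svec_gx fm_gx clin_sum[OF clin_gx])
qed

lemma f_parity_inv:
  assumes "x \<in> vspace X" shows "f (parity_inv x) = parity_inv (f x)"
proof (rule clin_eqI[OF clin_comp[OF clin_fm clin_parity_inv] clin_comp[OF clin_parity_inv clin_fm]
  finX _ assms])
  fix b assume b: "b \<in> X"
  have p: "parity_inv x = (\<lambda>c. (- 1) ^ k * x c)" if "x \<in> vspace {c \<in> X. card (snd c) = k}" for x k
  proof (rule ext, clarify)
    fix g S show "parity_inv x (g, S) = (- 1) ^ k * x (g, S)"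
    proof (cases "card S = k")
      case False
      then have "x (g, S) = 0" using that by (simp add: vspace_def)
      then show ?thesis by (simp add: parity_inv_def)
    qed (simp add: parity_inv_def)
  qed
  have "parity_inv (delta b) = (\<lambda>c. (- 1) ^ card (snd b) * delta b c)"
    using b by (intro p) simp
  then show "f (parity_inv (delta b)) = parity_inv (f (delta b))"
    by (simp add: p[OF f_delta_deg[OF b]] clin_scale[OF clin_fm])
qed

lemma ff_restrict: "ff (restrict_to (X \<times> X) t) = ff t"
  unfolding tensor_sq_def by (rule lin_ext_restrict)

lemmas clin_ff = clin_tensor_sq[of X f]
lemmas ff_delta = tensor_sq_delta[OF finX, of _ _ f]
lemmas ff_tens = tensor_sq_tens[OF clin_fm finX]

text \<open>\<open>f\<close> is multiplicative and preserves degrees, so the signs on both sides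
  agree.\<close>

lemma ff_sup: "ff (s \<diamondop> t) = ff s \<diamondop> ff t"
proof -
  let ?r = "restrict_to (X \<times> X)"
  have "ff (?r s \<diamondop> ?r t) = ff (?r s) \<diamondop> ff (?r t)"
  proof (rule bilin_eqI[OF clin_comp[OF clin_ff clin_sup1] clin_comp[OF clin_ff clin_sup2]
      clin_comp[OF clin_sup1 clin_ff] clin_comp[OF clin_sup2 clin_ff] finXX finXX])
    fix p q assume "p \<in> X \<times> X" "q \<in> X \<times> X"
    then obtain a b c d where e: "p = (a, b)" "q = (c, d)"
      and m: "a \<in> X" "b \<in> X" "c \<in> X" "d \<in> X" by auto
    have par: "f (delta b) \<in> vspace (par_basis G n (card (snd b)))" if "b \<in> X" for b
      by (rule vspace_mono[OF f_delta_deg[OF that]]) (auto simp: par_basis_def)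
    have "ff (delta p \<diamondop> delta q) = (\<lambda>z. (- 1) ^ (card (snd b) * card (snd c)) *
        tens (f (delta a \<star> delta c)) (f (delta b \<star> delta d)) z)"
      using m unfolding e
      by (simp add: sup_delta clin_scale[OF clin_ff] ff_tens sm_vspace)
    also have "\<dots> = tens (f (delta a)) (f (delta b)) \<diamondop> tens (f (delta c)) (f (delta d))"
      using m by (simp add: sup_tens[OF f_vspace par par f_vspace] f_mult)
    also have "\<dots> = ff (delta p) \<diamondop> ff (delta q)" using m unfolding e by (simp add: ff_delta)
    finally show "ff (delta p \<diamondop> delta q) = ff (delta p) \<diamondop> ff (delta q)" .
  qed auto
  then show ?thesis by (simp only: sup_restrict1 sup_restrict2 ff_restrict)
qed

lemma ff_sone2: "ff (sone2 G) = sone2 G"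
  by (simp add: sone2_def ff_tens f_sgrp)

lemma ff_sprim:
  assumes "i < n" shows "sop (ff (sprim G i)) = (\<Sum>k<n. cscale (\<eta> $$ (k, i)) * pop k)"
proof -
  have "ff (sprim G i) = (\<lambda>z. \<Sum>k<n. \<eta> $$ (k, i) * sprim G k z)"
    using assms
    by (simp add: sprim_def clin_add[OF clin_ff] ff_tens f_sgrp f_svec clin_sum[OF clin_tens1]
        clin_sum[OF clin_tens2] distrib_left sum.distrib)
  then show ?thesis by (simp add: sop_sum)
qed

lemma ff_stensor:
  assumes B: "B \<in> carrier_mat n n" shows "ff (stensor G n B) = stensor G n (tensor_act \<eta> B)"
proof
  fix z
  let ?t = "\<lambda>k l. tens (svec G k) (svec G l) z"
  have "ff (stensor G n B) = (\<lambda>z. \<Sum>i<n. \<Sum>j<n. B $$ (i, j) * ff (tens (svec G i) (svec G j)) z)"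
    unfolding stensor_def clin_sum1[OF clin_ff] clin_scale[OF clin_ff] ..
  then have "ff (stensor G n B) z = (\<Sum>i<n. \<Sum>j<n. B $$ (i, j) *
      (\<Sum>k<n. \<eta> $$ (k, i) * (\<Sum>l<n. \<eta> $$ (l, j) * ?t k l)))"
    by (simp add: ff_tens f_svec clin_sum[OF clin_tens1] clin_sum[OF clin_tens2])
  also have "\<dots> = (\<Sum>i<n. \<Sum>j<n. \<Sum>k<n. \<Sum>l<n. B $$ (i, j) * (\<eta> $$ (k, i) * \<eta> $$ (l, j)) * ?t k l)"
    by (simp add: sum_distrib_left mult.assoc)
  also have "\<dots> = (\<Sum>k<n. \<Sum>l<n. (\<Sum>i<n. \<Sum>j<n. B $$ (i, j) * (\<eta> $$ (k, i) * \<eta> $$ (l, j))) * ?t k l)"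
    unfolding sum_distrib_right by (rule sum_swap4)
  also have "\<dots> = stensor G n (tensor_act \<eta> B) z"
    unfolding stensor_def by (intro sum.cong refl) (simp add: tensor_act_entry[OF eta B])
  finally show "ff (stensor G n B) z = stensor G n (tensor_act \<eta> B) z" .
qed

lemma ff_super_exp:
  assumes B: "B \<in> carrier_mat n n"
  shows "ff (super_exp G n \<rho> (stensor G n B)) = super_exp G n \<rho> (stensor G n (tensor_act \<eta> B))"
proof -
  have e: "super_exp G n \<rho> (stensor G n C) =
    (\<lambda>z. \<Sum>k\<le>Suc n. 1 / fact k * (sup (stensor G n C) ^^ k) (sone2 G) z)" for C
    unfolding super_exp_stensor eop_def by (auto simp: fun_eq_iff app_sum eterm_def app_power simp
      del: sum.atMost_Suc)
  have "ff ((sup (stensor G n B) ^^ k) (sone2 G)) =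
    (sup (stensor G n (tensor_act \<eta> B)) ^^ k) (sone2 G)" for k
    by (induction k) (simp_all add: ff_sone2 ff_sup ff_stensor[OF B])
  then show ?thesis unfolding e clin_sum[OF clin_ff] by simp
qed

text \<open>On vectors both sides give the coproduct of the image under \<eta>; products of vectors
  are handled by \<open>hat_ext_act\<close> applied to \<open>hat n pop\<close>.\<close>

lemma ff_scomult:
  assumes "x \<in> vspace X" shows "ff (scomult G n \<rho> x) = scomult G n \<rho> (f x)"
proof (rule clin_eqI[OF _ _ finX _ assms])
  show "clin (\<lambda>x. ff (scomult G n \<rho> x))" "clin (\<lambda>x. scomult G n \<rho> (f x))"
    unfolding scomult_def by (rule clin_comp[OF clin_ff clin_lin_ext], rule clin_comp[OF
      clin_lin_ext clin_fm])
  fix b assume "b \<in> X"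
  then obtain g S where b: "b = (g, S)" "g \<in> carrier G" "S \<subseteq> {..<n}" by (auto simp: sbasis_def)
  let ?w = "\<lambda>i. \<Sum>k<n. cscale (\<eta> $$ (k, i)) * pop k"
  have "ff (app (prod_list (map pop l)) (sone2 G)) = app (prod_list (map ?w l)) (sone2 G)"
    if "set l \<subseteq> {..<n}" for l
    using that
    by (induction l) (simp_all add: ff_sone2 ff_sup ff_sprim[symmetric])
  from this[of "sorted_list_of_set S"] have "ff (palt S) = app (altprod ?w S) (sone2 G)"
    using b finite_subset[of S "{..<n}"] by (simp add: palt_def altprod_def)
  also have "altprod ?w S = hat n pop (ext_act n \<eta> (delta S))"
    using b by (simp add: hat_ext_act[OF anticommuting_pop eta] hat_delta)
  finally show "ff (scomult G n \<rho> (delta b)) = scomult G n \<rho> (f (delta b))"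
    using b \<open>b \<in> X\<close>
    by (simp add: scomult_delta ff_sup ff_tens f_sgrp fm_delta scomult_gx ext_act_vspace)
qed

lemma ff_twisted_comult:
  assumes "x \<in> vspace X" "B \<in> carrier_mat n n"
  shows "ff (ttw B x) = ttw (tensor_act \<eta> B) (f x)"
  using assms ff_super_exp[of "- B"]
  by (simp add: twisted_comult_def ff_sup ff_super_exp ff_scomult tensor_act_uminus)

text \<open>The splitting of the coproduct into its even and odd half is respected, as
  \<open>f\<close> preserves the degree of the second tensor factor.\<close>

lemma ff_snd_even:
  assumes "t \<in> vspace (X \<times> X)"
  shows "ff (\<lambda>z. if snd_even z then t z else 0) = (\<lambda>z. if snd_even z then ff t z else 0)"
    "ff (\<lambda>z. if snd_even z then 0 else t z) = (\<lambda>z. if snd_even z then 0 else ff t z)"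
proof -
  have d: "ff (\<lambda>z. if snd_even z then delta p z else 0) =
    (\<lambda>z. if snd_even z then ff (delta p) z else 0)"
    "ff (\<lambda>z. if snd_even z then 0 else delta p z) = (\<lambda>z. if snd_even z then 0 else ff (delta p) z)"
    if p: "p \<in> X \<times> X" for p
  proof -
    obtain a b where ab: "p = (a, b)" "a \<in> X" "b \<in> X" using p by auto
    have d: "(\<lambda>z. if snd_even z then delta p z else 0) = (if snd_even p then delta p else (\<lambda>z. 0))"
      "(\<lambda>z. if snd_even z then 0 else delta p z) = (if snd_even p then (\<lambda>z. 0) else delta p)"
      by (auto simp: delta_def fun_eq_iff)
    have s: "snd_even z = snd_even p" if "ff (delta p) z \<noteq> 0" for z
    proof -
      obtain z1 z2 where z: "z = (z1, z2)" by (cases z)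
      then have "f (delta b) z2 \<noteq> 0" using that ab by (simp add: ff_delta)
      then have "card (snd z2) = card (snd b)"
        using f_delta_deg[OF ab(3)] unfolding vspace_def by blast
      then show ?thesis using z ab by (simp add: snd_even_def)
    qed
    show "ff (\<lambda>z. if snd_even z then delta p z else 0) =
      (\<lambda>z. if snd_even z then ff (delta p) z else 0)"
      "ff (\<lambda>z. if snd_even z then 0 else delta p z) = (\<lambda>z. if snd_even z then 0 else ff (delta p) z)"
      unfolding d using s by (auto simp: clin_zero[OF clin_ff] fun_eq_iff)
  qed
  show "ff (\<lambda>z. if snd_even z then t z else 0) = (\<lambda>z. if snd_even z then ff t z else 0)"
    by (rule clin_eqI[OF clin_comp[OF clin_ff clin_if[OF clin_id clin_const_zero]]
        clin_if[OF clin_ff clin_const_zero] finXX d(1) assms])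
  show "ff (\<lambda>z. if snd_even z then 0 else t z) = (\<lambda>z. if snd_even z then 0 else ff t z)"
    by (rule clin_eqI[OF clin_comp[OF clin_ff clin_if[OF clin_const_zero clin_id]]
        clin_if[OF clin_const_zero clin_ff] finXX d(2) assms])
qed

lemma f_A_comult:
  assumes x: "x \<in> vspace X" and B: "B \<in> carrier_mat n n"
  shows "aco (tensor_act \<eta> B) (f x) = ff (aco B x)"
proof -
  have v: "ttw B x \<in> vspace (X \<times> X)" for x
    by (simp add: twisted_comult_def sup_vspace)
  have px: "parity_inv x \<in> vspace X" using x by (auto simp: parity_inv_def vspace_def)
  have "ff (aco B x) = (\<lambda>z. ff (\<lambda>z. if snd_even z then ttw B x z else 0) z -
      ff (tens (sgrp u) (sgrp \<one>) \<diamondop> (\<lambda>w. if snd_even w then 0 else ttw B (parity_inv x) w)) z)"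
    unfolding A_comult_def clin_diff[OF clin_ff] ..
  also have "\<dots> = aco (tensor_act \<eta> B) (f x)"
    unfolding ff_sup ff_snd_even[OF v] ff_twisted_comult[OF x B] ff_twisted_comult[OF px B]
      f_parity_inv[OF x] A_comult_def
    \<comment> \<open>This is where \<open>\<phi> u = u\<close> enters: u \<otimes> 1 has to be sent
      to itself.\<close>
    by (simp add: ff_tens f_sgrp phi_u)
  finally show ?thesis ..
qed

lemma f_scounit:
  assumes "x \<in> vspace X" shows "scounit G (f x) = scounit G x"
proof -
  \<comment> \<open>The counit is viewed as a map into functions on a point, so that the extension
    principle \<open>clin_eqI\<close> applies to it.\<close>
  have c: "clin (\<lambda>x (_::unit). scounit G x)"
    by (rule clinI) (simp add: scounit_def sum_distrib_left sum.distrib)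
  have "(\<lambda>(_::unit). scounit G (f x)) = (\<lambda>_. scounit G x)"
  proof (rule clin_eqI[OF clin_comp[OF c clin_fm] c finX _ assms])
    fix b assume "b \<in> X"
    then obtain g S where b: "b = (g, S)" "g \<in> carrier G" "S \<subseteq> {..<n}" by (auto simp: sbasis_def)
    have "scounit G (gx g a) = a {}" if "g \<in> carrier G" for g a
      using that finG by (simp add: scounit_def)
    then show "(\<lambda>(_::unit). scounit G (f (delta b))) = (\<lambda>_. scounit G (delta b))"
      using b by (simp add: fm_delta gx_delta[symmetric] sbasis_def fm_gx ext_act_at_empty)
  qed
  then show ?thesis by (simp add: fun_eq_iff)
qed

lemma hopf_iso_f:
  assumes bij: "bij_betw \<phi> (carrier G) (carrier G)" and inv: "invertible_mat \<eta>"
    and B: "B \<in> carrier_mat n n"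
  shows "hopf_iso (A_hopf G n \<rho> u B) (A_hopf G n \<rho> u (tensor_act \<eta> B)) f"
proof -
  obtain \<eta>' where e': "\<eta>' \<in> carrier_mat n n" "\<eta> * \<eta>' = 1\<^sub>m n" "\<eta>' * \<eta> = 1\<^sub>m n"
    using inv eta by (rule invertible_matE)
  define \<phi>' where "\<phi>' = inv_into (carrier G) \<phi>"
  have p: "\<phi>' g \<in> carrier G" "\<phi> (\<phi>' g) = g" "\<phi>' (\<phi> g) = g" if "g \<in> carrier G" for g
    using that bij unfolding \<phi>'_def bij_betw_def
    by (auto simp: inv_into_into f_inv_into_f)
  have p': "\<phi>' \<in> carrier G \<rightarrow> carrier G" using p by auto
  have "bij_betw f (vspace X) (vspace X)"
    by (rule bij_betw_byWitness[where f' = "fm \<phi>' \<eta>'"])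
      (use p e' in \<open>auto simp: fm_comp f_vspace fm_vspace[OF p' e'(1)]\<close>)
  then show ?thesis
    using f_mult f_sgrp[of \<one>] f_A_comult[OF _ B] f_scounit clinD[OF clin_fm]
    by (simp add: hopf_iso_def A_hopf_def)
qed

end

section \<open>Automorphisms of \<open>(G, V)\<close> from isomorphisms\<close>

text \<open>An isomorphism in the sense of \<open>hopf_iso\<close> is arbitrary outside
  \<open>vspace X\<close>. By this formula it agrees there with a map that is linear on all
  functions, to which the calculus of \<open>clin\<close> applies.\<close>

lemma lin_on_vspace:
  assumes lin: "\<And>c a b. a \<in> vspace X \<Longrightarrow> b \<in> vspace X \<Longrightarrow> F (\<lambda>x. c * a x + b x) = (\<lambda>y. c * F a y + F b y)"
    and "finite X" "a \<in> vspace X"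
  shows "F a = lin_ext X (\<lambda>x. F (delta x)) a"
proof -
  have z: "(\<lambda>x. 0) \<in> vspace X" by (simp add: vspace_def)
  have F0: "F (\<lambda>x. 0) = (\<lambda>y. 0)" using lin[OF z z, of 1] by (auto simp: fun_eq_iff)
  have "F (\<lambda>y. \<Sum>x\<in>I. a x * delta x y) = (\<lambda>y. \<Sum>x\<in>I. a x * F (delta x) y)" if "I \<subseteq> X" for I
    using finite_subset[OF that assms(2)] that
  proof (induction I rule: finite_induct)
    case (insert i I)
    have "(\<lambda>y. \<Sum>x\<in>I. a x * delta x y) \<in> vspace X"
      using insert by (intro vspace_sum) auto
    then show ?case using insert lin[of "delta i" "\<lambda>y. \<Sum>x\<in>I. a x * delta x y" "a i"] by simp
  qed (simp add: F0)
  from this[of X] show ?thesis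
    using assms(2,3) by (simp add: vspace_delta_sum lin_ext_def)
qed

lemma sum_E_low:
  fixes y :: "nat set \<Rightarrow> complex"
  assumes "\<And>S. S \<subseteq> {..<n} \<Longrightarrow> 2 \<le> card S \<Longrightarrow> y S = 0"
  shows "(\<Sum>S\<in>Pow {..<n}. y S) = y {} + (\<Sum>i<n. y {i})"
proof -
  have "(\<Sum>S\<in>Pow {..<n}. y S) = (\<Sum>S\<in>insert {} ((\<lambda>i. {i}) ` {..<n}). y S)"
  proof (rule sum.mono_neutral_right)
    show "\<forall>S\<in>Pow {..<n} - insert {} ((\<lambda>i. {i}) ` {..<n}). y S = 0"
    proof
      fix S assume S: "S \<in> Pow {..<n} - insert {} ((\<lambda>i. {i}) ` {..<n})"
      have "finite S" by (rule finite_subset[of S "{..<n}"]) (use S in auto)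
      then have "card S \<noteq> 0" using S by auto
      moreover have "card S \<noteq> 1"
      proof
        assume "card S = 1"
        then obtain i where "S = {i}" by (rule card_1_singletonE)
        then show False using S by auto
      qed
      ultimately show "y S = 0" using S assms[of S] by simp
    qed
  qed auto
  also have "\<dots> = y {} + (\<Sum>S\<in>(\<lambda>i. {i}) ` {..<n}. y S)"
    by (rule sum.insert) auto
  also have "(\<Sum>S\<in>(\<lambda>i. {i}) ` {..<n}. y S) = (\<Sum>i<n. y {i})"
    by (subst sum.reindex) (auto intro: inj_onI)
  finally show ?thesis .
qed

context gv begin

text \<open>\<open>vspace (Fil k)\<close> is the k-th power of the ideal generated by V.\<close>

definition Fil :: "nat \<Rightarrow> ('g \<times> nat set) set" where
  "Fil k = {b \<in> X. k \<le> card (snd b)}"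

lemma Fil_0: "Fil 0 = X"
  by (simp add: Fil_def)

lemma Fil_apply: "x \<in> vspace (Fil k) \<Longrightarrow> card S < k \<Longrightarrow> x (g, S) = 0"
  by (simp add: vspace_def Fil_def)

lemma sm_Fil:
  assumes "x \<in> vspace (Fil j)" "y \<in> vspace (Fil k)" shows "x \<star> y \<in> vspace (Fil (j + k))"
proof (rule bilin_vspaceI[OF clin_sm1 clin_sm2 _ _ _ assms])
  show "finite (Fil j)" "finite (Fil k)" by (rule finite_subset[OF _ finX], auto simp: Fil_def)+
  fix a b assume "a \<in> Fil j" "b \<in> Fil k"
  then show "delta a \<star> delta b \<in> vspace (Fil (j + k))"
    by (intro vspace_mono[OF sm_delta_deg]) (auto simp: Fil_def)
qed

lemma sm_at_empty:
  "(x \<star> y) (k, {}) = (\<Sum>(g, h)\<in>{(g, h). g \<in> carrier G \<and> h \<in> carrier G \<and> g \<otimes> h =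
    k}. x (g, {}) * y (h, {}))"
  by (simp add: smult_alg_def wedge_at_empty ext_act_at_empty)

lemma svec_sgrp:
  assumes "g \<in> carrier G" "i < n"
  shows "svec G i \<star> sgrp g = (\<lambda>z. \<Sum>k<n. \<rho> (inv g) $$ (k, i) * delta (g, {k}) z)"
proof -
  have i: "inv g \<in> carrier G" using assms by simp
  have "act (inv g) (delta {i}) = (\<lambda>S. \<Sum>k<n. \<rho> (inv g) $$ (k, i) * delta {k} S)"
    using assms carrier_matD[OF rep_carrier[OF i]] by (simp add: ext_act_single ext_vec_def)
  moreover have "wedge (delta {k}) (delta {}) = delta {k}" for k :: nat
    by (simp add: wedge_delta wedge_sign_ninv)
  moreover have "svec G i \<star> sgrp g = gx g (wedge (act (inv g) (delta {i})) (delta {}))"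
    using assms by (simp add: svec_gx sgrp_gx sm_gx)
  ultimately show ?thesis
    by (simp add: clin_sum[OF clin_wedge1] clin_sum[OF clin_gx] gx_delta)
qed

lemma sum_delta_single:
  assumes "j < n"
  shows "(\<Sum>m<n. a m * delta (g, {m}) (k, {j})) = (if k = g then a j else 0)"
proof -
  have "(\<Sum>m<n. a m * delta (g, {m}) (k, {j})) = (\<Sum>m<n. if m = j then (if k =
    g then a j else 0) else 0)"
    by (rule sum.cong) (auto simp: delta_def)
  then show ?thesis using assms by simp
qed

lemma scounit_sgrp: "g \<in> carrier G \<Longrightarrow> scounit G (sgrp g) = 1"
  using finG by (simp add: scounit_def sgrp_gx)

lemma sum_X: "(\<Sum>a\<in>X. h a) = (\<Sum>g\<in>carrier G. \<Sum>S\<in>E. h (g, S))"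
  by (simp add: sbasis_def sum.cartesian_product')

lemma svec_sq: "i < n \<Longrightarrow> svec G i \<star> svec G i = (\<lambda>z. 0)"
proof
  fix z assume "i < n"
  then have "(svec G i \<star> svec G i) z = - (svec G i \<star> svec G i) z"
    using sm_svec_anti[of i i] by metis
  then show "(svec G i \<star> svec G i) z = 0" by simp
qed

text \<open>Splits one vector off a basis element without a sign, for the induction in
  \<open>F_delta_Fil\<close>.\<close>

lemma delta_insert_min:
  assumes "g \<in> carrier G" "b < n" "A \<subseteq> {..<n}" "\<And>a. a \<in> A \<Longrightarrow> b < a"
  shows "delta (g, insert b A) = sgrp g \<star> svec G b \<star> delta (\<one>, A)"
proof -
  have fA: "finite A" using assms(3) finite_subset by blast
  have "ninv {b} A = 0" using assms(4) by (intro ninv_eq_0) (auto intro: less_imp_le)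
  moreover have "b \<notin> A" using assms(4) by blast
  ultimately have "wedge (delta {b}) (delta A) = delta (insert b A)"
    using fA by (simp add: wedge_delta wedge_sign_ninv)
  moreover have "sgrp g \<star> svec G b = gx g (delta {b})"
    using assms sm_sgrp_delta[of g \<one> "{b}"] by (simp add: svec_def sbasis_def gx_delta)
  ultimately show ?thesis
    using assms by (simp add: gx_delta[symmetric] sm_gx rep_one ext_act_one)
qed

text \<open>The coefficients of a grouplike element of the group algebra are idempotent and pairwise
  orthogonal, so at most one is nonzero and it is 1; the counit excludes the element 0.\<close>

lemma grouplike_deg0:
  assumes "\<And>k h. k \<in> carrier G \<Longrightarrow> h \<in> carrier G \<Longrightarrow> (if k = h then c h else 0) = c k * (c h :: complex)"
    and "(\<Sum>h\<in>carrier G. c h) = 1"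
  shows "\<exists>g\<in>carrier G. \<forall>h\<in>carrier G. c h = (if h = g then 1 else 0)"
proof -
  obtain g where g: "g \<in> carrier G" "c g \<noteq> 0"
    using assms(2) by (metis sum.neutral zero_neq_one)
  then have "c g = 1" using assms(1)[of g g] by simp
  moreover have "c h = 0" if "h \<in> carrier G" "h \<noteq> g" for h
    using assms(1)[of h g] g that by auto
  ultimately show ?thesis using g by (intro bexI[of _ g]) auto
qed

text \<open>Here \<open>c\<close> is skew-primitive in the group algebra, hence a multiple of \<open>1 - g\<close>, and the
  square of \<open>1 - g\<close> vanishes only for \<open>g = 1\<close>.\<close>

lemma skew_primitive_deg0:
  fixes c :: "'g \<Rightarrow> complex"
  assumes skew: "\<And>k h. k \<in> carrier G \<Longrightarrow> h \<in> carrier G \<Longrightarrow>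
      (if k = h then c h else 0) = c k * (if h = \<one> then 1 else 0) + (if k = g then 1 else 0) * c h"
    and sq: "(\<Sum>(a, b)\<in>{(a, b). a \<in> carrier G \<and> b \<in> carrier G \<and> a \<otimes> b = \<one>}. c a * c b) = 0"
    and g: "g \<in> carrier G" and k: "k \<in> carrier G"
  shows "c k = 0"
proof (cases "g = \<one>")
  case True
  then show ?thesis using skew[OF k k] by (cases "k = \<one>") auto
next
  case False
  have z: "c h = 0" if "h \<in> carrier G" "h \<noteq> \<one>" "h \<noteq> g" for h
    using skew[of h h] that by simp
  have cg: "c g = - c \<one>" using skew[of g \<one>] g False by (simp add: add_eq_0_iff2)
  have iv: "inv a = b" if "a \<in> carrier G" "b \<in> carrier G" "a \<otimes> b = \<one>" for a b
    using that by (metis inv_equality inv_inv)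
  have "(\<Sum>(a, b)\<in>{(a, b). a \<in> carrier G \<and> b \<in> carrier G \<and> a \<otimes> b = \<one>}. c a * c b) =
      (\<Sum>a\<in>carrier G. c a * c (inv a))"
    by (rule sum.reindex_bij_witness[of _ "\<lambda>a. (a, inv a)" fst]) (auto simp: iv)
  also have "\<dots> = (\<Sum>a\<in>{\<one>, g}. c a * c (inv a))"
    using finG g z by (intro sum.mono_neutral_right) auto
  also have "\<dots> = c \<one> * c \<one> + c g * c (inv g)" using False by simp
  finally have s: "c \<one> * c \<one> + c g * c (inv g) = 0" using sq by simp
  \<comment> \<open>The coefficient at \<one> of the square of c(1 - g) is 2 c^2 if \<open>g\<close>
    is an involution and c^2 otherwise.\<close>
  have "c \<one> = 0"
  proof (cases "inv g = g")
    case True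
    then have "2 * (c \<one> * c \<one>) = 0" using s cg by simp
    then show ?thesis by simp
  next
    case F: False
    have "inv g \<noteq> \<one>" using False g by (metis inv_inv inv_one)
    then have "c (inv g) = 0" using z[of "inv g"] F g by simp
    then show ?thesis using s by simp
  qed
  then show ?thesis using z[OF k] cg by (cases "k = \<one>"; cases "k = g") auto
qed

end

locale gviso = gvu G n \<rho> u for G :: "('g, 'm) monoid_scheme" (structure) and n \<rho> u +
  fixes B B' :: "complex mat" and F
  assumes B: "B \<in> carrier_mat n n" "B\<^sup>T = B" and B': "B' \<in> carrier_mat n n" "B'\<^sup>T = B'"
    and clinF: "clin F"
    and F_vspace: "\<And>x. x \<in> vspace X \<Longrightarrow> F x \<in> vspace X"
    and F_surj: "\<And>y. y \<in> vspace X \<Longrightarrow> \<exists>x\<in>vspace X. F x = y"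
    and F_mult: "\<And>x y. x \<in> vspace X \<Longrightarrow> y \<in> vspace X \<Longrightarrow> F (x \<star> y) = F x \<star> F y"
    and F_one: "F (sgrp \<one>) = sgrp \<one>"
    and F_comult: "\<And>x. x \<in> vspace X \<Longrightarrow> aco B' (F x) = tensor_sq X F (aco B x)"
    and F_counit: "\<And>x. x \<in> vspace X \<Longrightarrow> scounit G (F x) = scounit G x"
begin

abbreviation "FF \<equiv> tensor_sq X F"

lemmas FF_tens = tensor_sq_tens[OF clinF finX]

lemma FF_apply: "FF t (p, q) = (\<Sum>a\<in>X. \<Sum>b\<in>X. t (a, b) * (F (delta a) p * F (delta b) q))"
  by (simp add: tensor_sq_def lin_ext_def sum.cartesian_product split_def)

lemma comult_u: "aco B' (F (sgrp u)) = tens (F (sgrp u)) (F (sgrp u))"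
  by (simp add: F_comult A_comult_sgrp_u[OF B(1)] FF_tens)

lemma comult_v:
  "i < n \<Longrightarrow> aco B' (F (svec G i)) =
    (\<lambda>z. tens (F (svec G i)) (sgrp \<one>) z + tens (F (sgrp u)) (F (svec G i)) z)"
  by (simp add: F_comult A_comult_svec[OF B(1)] clin_add[OF clin_tensor_sq] FF_tens F_one)

lemma F_u_deg0: "\<exists>g\<in>carrier G. \<forall>h\<in>carrier G. F (sgrp u) (h, {}) = (if h = g then 1 else 0)"
proof (rule grouplike_deg0)
  fix k h assume kh: "k \<in> carrier G" "h \<in> carrier G"
  show "(if k = h then F (sgrp u) (h, {}) else 0) = F (sgrp u) (k, {}) * F (sgrp u) (h, {})"
    using A_comult_00[OF B'(1) kh, of "F (sgrp u)"] by (simp add: comult_u)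
next
  have "scounit G (F (sgrp u)) = 1" by (simp add: F_counit scounit_sgrp)
  then show "(\<Sum>h\<in>carrier G. F (sgrp u) (h, {})) = 1" by (simp add: scounit_def)
qed

lemma F_v_Fil: assumes i: "i < n" shows "F (svec G i) \<in> vspace (Fil 1)"
proof -
  let ?x = "F (svec G i)"
  have xv: "?x \<in> vspace X" using i by (simp add: F_vspace)
  obtain g where g: "g \<in> carrier G" "\<And>h. h \<in> carrier G \<Longrightarrow> F (sgrp u) (h, {}) = (if h =
    g then 1 else 0)"
    using F_u_deg0 by blast
  have "?x \<star> ?x = F (svec G i \<star> svec G i)" using i by (simp add: F_mult)
  also have "\<dots> = (\<lambda>z. 0)" using i by (simp add: svec_sq clin_zero[OF clinF])
  \<comment> \<open>The square of F(v) vanishes entirely; its coefficient at \<one>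
    suffices.\<close>
  finally have sq: "(?x \<star> ?x) (\<one>, {}) = 0" by simp
  have z: "?x (k, {}) = 0" if k: "k \<in> carrier G" for k
  proof (rule skew_primitive_deg0[where c = "\<lambda>h. ?x (h, {})" and g = g])
    fix k h assume kh: "k \<in> carrier G" "h \<in> carrier G"
    show "(if k = h then ?x (h, {}) else 0) =
      ?x (k, {}) * (if h = \<one> then 1 else 0) + (if k = g then 1 else 0) * ?x (h, {})"
      using A_comult_00[OF B'(1) kh, of ?x] g(2)[OF kh(1)] unfolding comult_v[OF i]
      by (simp add: sgrp_def delta_def)
  qed (use sq g k in \<open>simp_all add: sm_at_empty\<close>)
  have "b \<in> Fil 1" if "?x b \<noteq> 0" for b
  proof -
    obtain h S where b: "b = (h, S)" by (cases b)
    have bX: "b \<in> X" using that xv unfolding vspace_def by blast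
    then have "S \<noteq> {}" using that z[of h] b by (auto simp: sbasis_def)
    moreover have "finite S" using bX b finite_subset[of S "{..<n}"] by (auto simp: sbasis_def)
    ultimately have "card S \<noteq> 0" by simp
    then show ?thesis using bX b by (simp add: Fil_def)
  qed
  then show ?thesis unfolding vspace_def by blast
qed

lemma F_delta_Fil:
  assumes "(g, S) \<in> X" shows "F (delta (g, S)) \<in> vspace (Fil (card S))"
proof -
  have S: "finite S" "S \<subseteq> {..<n}" "g \<in> carrier G"
    using assms finite_subset[of S "{..<n}"] by (auto simp: sbasis_def)
  then show ?thesis
  proof (induction S arbitrary: g rule: finite_linorder_min_induct)
    case empty
    then have "(g, {}) \<in> X" by (simp add: sbasis_def)
    then show ?case by (simp add: Fil_0 F_vspace)
  next
    case (insert b A)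
    have bA: "b \<notin> A" using insert.hyps by blast
    have v: "sgrp g \<in> vspace X" "svec G b \<in> vspace X" "delta (\<one>, A) \<in> vspace X"
      using insert.prems by (simp_all, simp add: sbasis_def)
    have "F (delta (g, insert b A)) = F (sgrp g) \<star> F (svec G b) \<star> F (delta (\<one>, A))"
      using insert.prems insert.hyps v by (simp add: delta_insert_min F_mult sm_vspace)
    also have "\<dots> \<in> vspace (Fil (0 + 1 + card A))"
      using insert.prems insert.IH v by (intro sm_Fil F_v_Fil) (auto simp: Fil_0 F_vspace)
    finally show ?case using insert.hyps bA by simp
  qed
qed

text \<open>F is triangular with respect to the degree. This cuts the sums over basis elements below
  down to those of degree at most that of the coefficient in question.\<close>

lemma F_delta_low:
  assumes "(g, S) \<in> X" "card T < card S" shows "F (delta (g, S)) (h, T) = 0"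
  using F_delta_Fil[OF assms(1)] assms(2) by (rule Fil_apply)

section \<open>Low-degree coefficients of F and of F \<otimes> F\<close>

lemma F_apply_deg0:
  assumes "x \<in> vspace X"
  shows "F x (h, {}) = (\<Sum>g\<in>carrier G. x (g, {}) * F (sgrp g) (h, {}))"
proof -
  have "F x (h, {}) = (\<Sum>g\<in>carrier G. \<Sum>S\<in>E. x (g, S) * F (delta (g, S)) (h, {}))"
    unfolding clin_eq_lin_ext[OF clinF finX assms] lin_ext_def sum_X ..
  also have "\<dots> = (\<Sum>g\<in>carrier G. \<Sum>S\<in>E. if S = {} then x (g, {}) * F (sgrp g) (h, {}) else 0)"
  proof (intro sum.cong refl)
    fix g S assume gS: "g \<in> carrier G" "S \<in> E"
    then have "finite S" using finite_subset by blast
    then show "x (g, S) * F (delta (g, S)) (h, {}) = (if S =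
      {} then x (g, {}) * F (sgrp g) (h, {}) else 0)"
      using gS F_delta_low[of g S "{}"] by (auto simp: sgrp_def sbasis_def card_gt_0_iff)
  qed
  finally show ?thesis by simp
qed

lemma F_apply_deg1:
  assumes "x \<in> vspace X"
  shows "F x (h, {j}) = (\<Sum>g\<in>carrier G. x (g, {}) * F (sgrp g) (h, {j}) +
    (\<Sum>i<n. x (g, {i}) * F (delta (g, {i})) (h, {j})))"
proof -
  have "F x (h, {j}) = (\<Sum>g\<in>carrier G. \<Sum>S\<in>E. x (g, S) * F (delta (g, S)) (h, {j}))"
    unfolding clin_eq_lin_ext[OF clinF finX assms] lin_ext_def sum_X ..
  also have "\<dots> = (\<Sum>g\<in>carrier G. x (g, {}) * F (sgrp g) (h, {j}) +
    (\<Sum>i<n. x (g, {i}) * F (delta (g, {i})) (h, {j})))"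
    unfolding sgrp_def by (intro sum.cong refl sum_E_low) (simp add: F_delta_low sbasis_def)
  finally show ?thesis .
qed

lemma FF_apply_low:
  "FF t ((k, S), (h, T)) =
    (\<Sum>a\<in>carrier G. \<Sum>b\<in>carrier G. \<Sum>P\<in>E. \<Sum>Q\<in>E.
      t ((a, P), (b, Q)) * (F (delta (a, P)) (k, S) * F (delta (b, Q)) (h, T)))"
proof -
  have "FF t ((k, S), (h, T)) = (\<Sum>a\<in>carrier G. \<Sum>P\<in>E. \<Sum>b\<in>carrier G. \<Sum>Q\<in>E.
      t ((a, P), (b, Q)) * (F (delta (a, P)) (k, S) * F (delta (b, Q)) (h, T)))"
    by (simp only: FF_apply sum_X)
  also have "\<dots> = (\<Sum>a\<in>carrier G. \<Sum>b\<in>carrier G. \<Sum>P\<in>E. \<Sum>Q\<in>E.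
      t ((a, P), (b, Q)) * (F (delta (a, P)) (k, S) * F (delta (b, Q)) (h, T)))"
    by (intro sum.cong refl sum.swap)
  finally show ?thesis .
qed

lemma sum_E_deg0:
  assumes "\<And>S. S \<subseteq> {..<n} \<Longrightarrow> 0 < card S \<Longrightarrow> y S = 0"
  shows "(\<Sum>S\<in>E. y S) = (y {} :: complex)"
  using assms by (subst sum_E_low) auto

lemma FF_00: "FF t ((k, {}), (h, {})) = (\<Sum>a\<in>carrier G. \<Sum>b\<in>carrier G.
    t ((a, {}), (b, {})) * (F (sgrp a) (k, {}) * F (sgrp b) (h, {})))"
  unfolding FF_apply_low sgrp_def
  by (intro sum.cong refl, subst sum_E_deg0, intro sum.neutral ballI, simp add: F_delta_low
    sbasis_def,
      rule sum_E_deg0, simp add: F_delta_low sbasis_def)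

lemma FF_10: "FF t ((k, {i}), (h, {})) = (\<Sum>a\<in>carrier G. \<Sum>b\<in>carrier G.
    t ((a, {}), (b, {})) * (F (sgrp a) (k, {i}) * F (sgrp b) (h, {})) +
    (\<Sum>p<n. t ((a, {p}), (b, {})) * (F (delta (a, {p})) (k, {i}) * F (sgrp b) (h, {}))))"
proof -
  have Q: "(\<Sum>Q\<in>E. t ((a, P), (b, Q)) * (F (delta (a, P)) (k, {i}) * F (delta (b, Q)) (h, {}))) =
    t ((a, P), (b, {})) * (F (delta (a, P)) (k, {i}) * F (sgrp b) (h, {}))" if "b \<in> carrier G" for
      a b P
    unfolding sgrp_def by (rule sum_E_deg0) (use that in \<open>simp add: F_delta_low sbasis_def\<close>)
  show ?thesis unfolding FF_apply_low sgrp_def[of "_ :: 'g"]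
    by (intro sum.cong refl, simp only: Q, subst sum_E_low)
      (auto simp add: F_delta_low sbasis_def sgrp_def)
qed

lemma FF_01: "FF t ((k, {}), (h, {j})) = (\<Sum>a\<in>carrier G. \<Sum>b\<in>carrier G.
    t ((a, {}), (b, {})) * (F (sgrp a) (k, {}) * F (sgrp b) (h, {j})) +
    (\<Sum>q<n. t ((a, {}), (b, {q})) * (F (sgrp a) (k, {}) * F (delta (b, {q})) (h, {j}))))"
proof -
  have P: "(\<Sum>P\<in>E. \<Sum>Q\<in>E. t ((a, P), (b, Q)) * (F (delta (a, P)) (k, {}) * F (delta (b, Q)) (h, {j}))) =
    (\<Sum>Q\<in>E. t ((a, {}), (b, Q)) * (F (sgrp a) (k, {}) * F (delta (b, Q)) (h, {j})))" if "a \<in> carrier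
      G" for a b
    unfolding sgrp_def by (rule sum_E_deg0) (use that in \<open>simp add: F_delta_low sbasis_def\<close>)
  show ?thesis unfolding FF_apply_low sgrp_def[of "_ :: 'g"]
    by (intro sum.cong refl, simp only: P, subst sum_E_low)
      (auto simp add: F_delta_low sbasis_def sgrp_def)
qed

text \<open>The hypotheses exclude the mixed terms, where one tensor factor of \<open>t\<close> has
  degree 0 and the other degree 1. The coproduct of a group element satisfies them
  (\<open>comult_g\<close>).\<close>

lemma FF_11:
  assumes "\<And>a p b. a \<in> carrier G \<Longrightarrow> b \<in> carrier G \<Longrightarrow> p < n \<Longrightarrow> t ((a, {p}), (b, {})) = 0"
    "\<And>a p b. a \<in> carrier G \<Longrightarrow> b \<in> carrier G \<Longrightarrow> p < n \<Longrightarrow> t ((a, {}), (b, {p})) = 0"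
  shows "FF t ((k, {i}), (h, {j})) = (\<Sum>a\<in>carrier G. \<Sum>b\<in>carrier G.
    t ((a, {}), (b, {})) * (F (sgrp a) (k, {i}) * F (sgrp b) (h, {j})) +
    (\<Sum>p<n. \<Sum>q<n. t ((a, {p}), (b, {q})) * (F (delta (a, {p})) (k, {i}) * F (delta (b, {q}))
      (h, {j}))))"
proof -
  let ?f = "\<lambda>a b P Q. t ((a, P), (b, Q)) * (F (delta (a, P)) (k, {i}) * F (delta (b, Q)) (h, {j}))"
  have Q: "(\<Sum>Q\<in>E. ?f a b P Q) = ?f a b P {} + (\<Sum>q<n. ?f a b P {q})" if "b \<in> carrier G" for a b P
    by (rule sum_E_low) (use that in \<open>simp add: F_delta_low sbasis_def\<close>)
  have "(\<Sum>P\<in>E. \<Sum>Q\<in>E. ?f a b P Q) = ?f a b {} {} + (\<Sum>p<n. \<Sum>q<n. ?f a b {p} {q})"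
    if ab: "a \<in> carrier G" "b \<in> carrier G" for a b
  proof -
    have "(\<Sum>P\<in>E. \<Sum>Q\<in>E. ?f a b P Q) = (\<Sum>Q\<in>E. ?f a b {} Q) + (\<Sum>p<n. \<Sum>Q\<in>E. ?f a b {p} Q)"
      by (rule sum_E_low) (use ab in \<open>simp add: F_delta_low sbasis_def\<close>)
    then show ?thesis unfolding Q[OF ab(2)] using ab assms by simp
  qed
  then show ?thesis unfolding FF_apply_low sgrp_def by simp
qed

section \<open>The induced automorphism \<open>phi\<close> of G\<close>

lemma F_g_deg0:
  assumes g: "g \<in> carrier G"
  shows "\<exists>k\<in>carrier G. \<forall>h\<in>carrier G. F (sgrp g) (h, {}) = (if h = k then 1 else 0)"
proof (rule grouplike_deg0)
  fix k h assume kh: "k \<in> carrier G" "h \<in> carrier G"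
  have "FF (aco B (sgrp g)) ((k, {}), (h, {})) =
      (\<Sum>a\<in>carrier G. \<Sum>b\<in>carrier G. if b = a then
        (if a = g then F (sgrp a) (k, {}) * F (sgrp b) (h, {}) else 0) else 0)"
    unfolding FF_00 by (intro sum.cong refl) (auto simp: A_comult_00[OF B(1)] sgrp_def delta_def)
  also have "\<dots> = F (sgrp g) (k, {}) * F (sgrp g) (h, {})"
    using finG g by simp
  finally show "(if k = h then F (sgrp g) (h, {}) else 0) = F (sgrp g) (k, {}) * F (sgrp g) (h, {})"
    using A_comult_00[OF B'(1) kh, of "F (sgrp g)"] g by (simp add: F_comult)
next
  have "scounit G (F (sgrp g)) = 1" using g by (simp add: F_counit scounit_sgrp)
  then show "(\<Sum>h\<in>carrier G. F (sgrp g) (h, {})) = 1" by (simp add: scounit_def)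
qed

text \<open>Extensional outside the carrier, as membership in \<open>auto G\<close> demands.\<close>

definition phi :: "'g \<Rightarrow> 'g" where
  "phi = (\<lambda>g\<in>carrier G. SOME k. k \<in> carrier G \<and> (\<forall>h\<in>carrier G. F (sgrp g) (h, {}) = (if h =
    k then 1 else 0)))"

lemma phi:
  assumes "g \<in> carrier G"
  shows phi_closed: "phi g \<in> carrier G"
    and F_g_0: "h \<in> carrier G \<Longrightarrow> F (sgrp g) (h, {}) = (if h = phi g then 1 else 0)"
proof -
  have ex: "\<exists>k. k \<in> carrier G \<and> (\<forall>h\<in>carrier G. F (sgrp g) (h, {}) = (if h = k then 1 else 0))"
    using F_g_deg0[OF assms] by blast
  have e: "phi g = (SOME k. k \<in> carrier G \<and> (\<forall>h\<in>carrier G. F (sgrp g) (h, {}) = (if h =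
    k then 1 else 0)))"
    using assms by (simp only: phi_def restrict_apply if_True)
  have *: "phi g \<in> carrier G \<and> (\<forall>h\<in>carrier G. F (sgrp g) (h, {}) = (if h = phi g then 1 else 0))"
    unfolding e by (rule someI_ex[OF ex])
  show "phi g \<in> carrier G" using * by (rule conjunct1)
  assume "h \<in> carrier G"
  then show "F (sgrp g) (h, {}) = (if h = phi g then 1 else 0)"
    using conjunct2[OF *] by (rule bspec[rotated])
qed

lemma sgrp_mult: "g \<in> carrier G \<Longrightarrow> h \<in> carrier G \<Longrightarrow> sgrp g \<star> sgrp h = sgrp (g \<otimes> h)"
  using sm_sgrp_delta[of g h "{}"] by (simp add: sgrp_def sbasis_def)

text \<open>Taking parts of degree 0 is reduction modulo the ideal generated by V, an algebra map,
  and F(g) reduces to \<open>phi g\<close>.\<close>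

lemma phi_mult:
  assumes "g \<in> carrier G" "h \<in> carrier G" shows "phi (g \<otimes> h) = phi g \<otimes> phi h"
proof -
  let ?k = "phi g \<otimes> phi h"
  have k: "?k \<in> carrier G" using assms by (simp add: phi_closed)
  let ?P = "{(a, b). a \<in> carrier G \<and> b \<in> carrier G \<and> a \<otimes> b = ?k}"
  have fin: "finite ?P" by (rule finite_subset[of _ "carrier G \<times> carrier G"]) (auto simp: finG)
  have "F (sgrp (g \<otimes> h)) (?k, {}) = (\<Sum>(a, b)\<in>?P. F (sgrp g) (a, {}) * F (sgrp h) (b, {}))"
    using assms by (simp add: sgrp_mult[symmetric] F_mult sm_at_empty)
  also have "\<dots> = (\<Sum>p\<in>?P. if p = (phi g, phi h) then 1 else 0)"
    by (rule sum.cong) (auto simp: F_g_0 assms split: if_split_asm)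
  also have "\<dots> = 1" using fin assms by (simp add: phi_closed)
  finally show ?thesis using F_g_0[of "g \<otimes> h" ?k] assms k by (auto split: if_splits)
qed

text \<open>A preimage of \<open>g\<close> under F must involve some \<open>h\<close> whose image
  has \<open>g\<close> as a term of degree 0. As G is finite, bijectivity follows.\<close>

lemma phi_surj: assumes "g \<in> carrier G" shows "\<exists>h\<in>carrier G. phi h = g"
proof -
  obtain x where x: "x \<in> vspace X" "F x = sgrp g" using F_surj[of "sgrp g"] assms by auto
  have "(\<Sum>h\<in>carrier G. x (h, {}) * F (sgrp h) (g, {})) = 1"
    using F_apply_deg0[OF x(1), of g] x(2) by (simp add: sgrp_def)
  then obtain h where h: "h \<in> carrier G" "x (h, {}) * F (sgrp h) (g, {}) \<noteq> 0"
    by (metis (no_types, lifting) sum.neutral zero_neq_one)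
  then show ?thesis using F_g_0[OF h(1) assms] by (intro bexI[of _ h]) (auto split: if_splits)
qed

lemma phi_bij: "bij_betw phi (carrier G) (carrier G)"
proof -
  have "phi ` carrier G = carrier G" using phi_surj phi_closed by blast
  then show ?thesis using finG by (simp add: bij_betw_def eq_card_imp_inj_on)
qed

lemma phi_auto: "phi \<in> auto G"
  using phi_bij phi_closed phi_mult
  by (auto simp: auto_def Bij_def hom_def phi_def extensional_def)

lemma phi_inj: "g \<in> carrier G \<Longrightarrow> h \<in> carrier G \<Longrightarrow> phi g = phi h \<longleftrightarrow> g = h"
  using phi_bij by (auto simp: bij_betw_def inj_on_def)

lemma phi_one: "phi \<one> = \<one>"
  using phi_mult[of \<one> \<one>] phi_closed[of \<one>] by (simp add: l_cancel_one')

lemma phi_inv: "g \<in> carrier G \<Longrightarrow> phi (inv g) = inv (phi g)"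
  using phi_mult[of "inv g" g] phi_closed by (simp add: phi_one inv_equality)

section \<open>The induced isomorphism \<open>eta\<close> of V\<close>

lemma F_v_1:
  assumes "i < n" "j < n" "k \<in> carrier G" "k \<noteq> \<one>"
  shows "F (svec G i) (k, {j}) = 0"
proof -
  \<comment> \<open>In bidegree (1, 0) this removes the term F(u) \<otimes> F(v) of the coproduct of
    F(v); the other term, F(v) \<otimes> 1, has second group component \<one>, whereas the coproduct
    on the left is diagonal in the group components.\<close>
  have "F (svec G i) (k, {}) = 0" using F_v_Fil[OF assms(1)] by (rule Fil_apply) simp
  then show ?thesis
    using A_comult_10[OF B'(1) assms(3,3,2), of "F (svec G i)"] assms(4)
    unfolding comult_v[OF assms(1)] by (simp add: sgrp_def delta_def)
qed

definition eta :: "complex mat" where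
  "eta = mat n n (\<lambda>(j, i). F (svec G i) (\<one>, {j}))"

lemma eta_carrier [simp]: "eta \<in> carrier_mat n n"
  by (simp add: eta_def)

lemma F_v_eta: "i < n \<Longrightarrow> j < n \<Longrightarrow> k \<in> carrier G \<Longrightarrow> F (svec G i) (k, {j}) = (if k =
  \<one> then eta $$ (j, i) else 0)"
  by (simp add: F_v_1 eta_def)

text \<open>By \<open>F_v_1\<close> the part of degree 1 lies in V itself, with no other group
  element in front, and degree 0 is excluded by \<open>F_v_Fil\<close>.\<close>

lemma F_v_mod:
  assumes i: "i < n"
  shows "(\<lambda>z. F (svec G i) z - (\<Sum>j<n. eta $$ (j, i) * svec G j z)) \<in> vspace (Fil 2)"
proof -
  have x: "F (svec G i) \<in> vspace (Fil 1)" by (rule F_v_Fil[OF i])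
  have "b \<in> Fil 2" if nz: "F (svec G i) b - (\<Sum>j<n. eta $$ (j, i) * svec G j b) \<noteq> 0" for b
  proof -
    obtain h S where b: "b = (h, S)" by (cases b)
    have "F (svec G i) b \<noteq> 0 \<or> (\<exists>j<n. svec G j b \<noteq> 0)"
    proof (rule ccontr)
      assume "\<not> ?thesis"
      then show False using nz by (auto intro!: sum.neutral)
    qed
    then have bF: "b \<in> Fil 1"
    proof
      assume "F (svec G i) b \<noteq> 0"
      then show ?thesis using x unfolding vspace_def by blast
    qed (auto simp: svec_def delta_def Fil_def sbasis_def split: if_splits)
    then have hS: "h \<in> carrier G" "S \<subseteq> {..<n}" "1 \<le> card S" using b by (auto simp: Fil_def sbasis_def)
    have "card S \<noteq> 1"
    proof
      assume "card S = 1"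
      then obtain k where S: "S = {k}" by (rule card_1_singletonE)
      then have k: "k < n" using hS by simp
      have "(\<Sum>j<n. eta $$ (j, i) * svec G j b) = (\<Sum>j<n. if j = k then (if h =
        \<one> then eta $$ (k, i) else 0) else 0)"
        by (rule sum.cong) (auto simp: b S svec_def delta_def)
      then show False using nz k F_v_eta[OF i k hS(1)] by (simp add: b S)
    qed
    then show ?thesis using bF hS b by (simp add: Fil_def)
  qed
  then show ?thesis unfolding vspace_def by blast
qed

lemma F_g_mod:
  assumes g: "g \<in> carrier G"
  shows "(\<lambda>z. F (sgrp g) z - sgrp (phi g) z) \<in> vspace (Fil 1)"
proof -
  have x: "F (sgrp g) \<in> vspace X" using g by (simp add: F_vspace)
  have "b \<in> Fil 1" if nz: "F (sgrp g) b - sgrp (phi g) b \<noteq> 0" for b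
  proof -
    obtain h S where b: "b = (h, S)" by (cases b)
    have "F (sgrp g) b \<noteq> 0 \<or> sgrp (phi g) b \<noteq> 0" using nz by auto
    then have bX: "b \<in> X"
      using x sgrp_vspace[OF phi_closed[OF g]] unfolding vspace_def by blast
    have hS: "h \<in> carrier G" "finite S" using b bX finite_subset[of S "{..<n}"]
      by (auto simp: sbasis_def)
    then have "S \<noteq> {}" using nz b F_g_0[OF g hS(1)] by (auto simp: sgrp_def delta_def)
    then have "1 \<le> card S" using hS(2) by (simp add: Suc_le_eq card_gt_0_iff)
    then show ?thesis using bX b by (simp add: Fil_def)
  qed
  then show ?thesis unfolding vspace_def by blast
qed

text \<open>Up to degree 1 a product of F(g) and F(v) depends only on F(g) modulo
  \<open>Fil 1\<close> and on F(v) modulo \<open>Fil 2\<close>, so both can be replaced by their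
  leading parts.\<close>

lemma F_gv_low:
  assumes "g \<in> carrier G" "i < n" "j < n" "k \<in> carrier G"
  shows "(F (sgrp g) \<star> F (svec G i)) (k, {j}) = (if k = phi g then eta $$ (j, i) else 0)"
    "(F (svec G i) \<star> F (sgrp g)) (k, {j}) =
      (if k = phi g then \<Sum>l<n. \<rho> (inv (phi g)) $$ (j, l) * eta $$ (l, i) else 0)"
proof -
  let ?w = "\<lambda>z. \<Sum>l<n. eta $$ (l, i) * svec G l z"
  have x: "F (svec G i) \<in> vspace (Fil 1)" by (rule F_v_Fil[OF assms(2)])
  have r: "(\<lambda>z. F (svec G i) z - ?w z) \<in> vspace (Fil 2)" by (rule F_v_mod[OF assms(2)])
  have s: "(\<lambda>z. F (sgrp g) z - sgrp (phi g) z) \<in> vspace (Fil 1)" by (rule F_g_mod[OF assms(1)])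
  have p: "sgrp (phi g) \<in> vspace (Fil 0)" using assms(1) by (simp add: Fil_0 phi_closed)
  have "(F (sgrp g) \<star> F (svec G i)) (k, {j}) = (sgrp (phi g) \<star> F (svec G i)) (k, {j})"
    using Fil_apply[OF sm_Fil[OF s x], of "{j}" k] by (simp add: clin_diff[OF clin_sm1])
  also have "\<dots> = (sgrp (phi g) \<star> ?w) (k, {j})"
    using Fil_apply[OF sm_Fil[OF p r], of "{j}" k] by (simp add: clin_diff[OF clin_sm2])
  also have "\<dots> = (\<Sum>l<n. if l = j then (if k = phi g then eta $$ (j, i) else 0) else 0)"
    unfolding clin_sum[OF clin_sm2]
  proof (intro sum.cong refl)
    fix l assume "l \<in> {..<n}"
    then have "sgrp (phi g) \<star> svec G l = delta (phi g, {l})"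
      using assms(1) sm_sgrp_delta[of "phi g" \<one> "{l}"] by (simp add: svec_def sbasis_def phi_closed)
    then show "eta $$ (l, i) * (sgrp (phi g) \<star> svec G l) (k, {j}) =
        (if l = j then (if k = phi g then eta $$ (j, i) else 0) else 0)"
      by (simp add: delta_def)
  qed
  finally show "(F (sgrp g) \<star> F (svec G i)) (k, {j}) = (if k = phi g then eta $$ (j, i) else 0)"
    using assms(3) by simp
  have "(F (svec G i) \<star> F (sgrp g)) (k, {j}) = (F (svec G i) \<star> sgrp (phi g)) (k, {j})"
    using Fil_apply[OF sm_Fil[OF x s], of "{j}" k] by (simp add: clin_diff[OF clin_sm2])
  also have "\<dots> = (?w \<star> sgrp (phi g)) (k, {j})"
    using Fil_apply[OF sm_Fil[OF r p], of "{j}" k] by (simp add: clin_diff[OF clin_sm1])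
  also have "\<dots> = (\<Sum>l<n. eta $$ (l, i) * (if k = phi g then \<rho> (inv (phi g)) $$ (j, l) else 0))"
    unfolding clin_sum[OF clin_sm1]
    using assms(1,3) by (intro sum.cong refl) (simp add: svec_sgrp phi_closed sum_delta_single)
  finally show "(F (svec G i) \<star> F (sgrp g)) (k, {j}) =
      (if k = phi g then \<Sum>l<n. \<rho> (inv (phi g)) $$ (j, l) * eta $$ (l, i) else 0)"
    by (simp add: mult.commute)
qed

lemma F_delta_1:
  assumes "g \<in> carrier G" "i < n" "j < n" "k \<in> carrier G"
  shows "F (delta (g, {i})) (k, {j}) = (if k = phi g then eta $$ (j, i) else 0)"
proof -
  have "delta (g, {i}) = sgrp g \<star> svec G i"
    using assms sm_sgrp_delta[of g \<one> "{i}"] by (simp add: svec_def sbasis_def)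
  then show ?thesis using F_gv_low[OF assms] assms by (simp add: F_mult)
qed

text \<open>Compares F(v g) with F(v) F(g) in degree 1. The inverse appears because group elements
  are written on the left: v g = g (g^-1 v).\<close>

lemma eta_equiv_inv:
  assumes g: "g \<in> carrier G" shows "eta * \<rho> (inv g) = \<rho> (inv (phi g)) * eta"
proof (rule eq_matI)
  have c: "\<rho> (inv g) \<in> carrier_mat n n" "\<rho> (inv (phi g)) \<in> carrier_mat n n"
    using g by (simp_all add: phi_closed)
  then show "dim_row (eta * \<rho> (inv g)) = dim_row (\<rho> (inv (phi g)) * eta)"
    "dim_col (eta * \<rho> (inv g)) = dim_col (\<rho> (inv (phi g)) * eta)" by (auto simp: eta_def)
  fix j i assume "j < dim_row (\<rho> (inv (phi g)) * eta)" "i < dim_col (\<rho> (inv (phi g)) * eta)"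
  then have ij: "i < n" "j < n" using c by (auto simp: eta_def)
  have "F (svec G i \<star> sgrp g) (phi g, {j}) = (\<Sum>k<n. \<rho> (inv g) $$ (k, i) * eta $$ (j, k))"
    using g ij by (simp add: svec_sgrp clin_sum[OF clinF] F_delta_1 phi_closed)
  moreover have "F (svec G i \<star> sgrp g) (phi g, {j}) =
    (\<Sum>l<n. \<rho> (inv (phi g)) $$ (j, l) * eta $$ (l, i))"
    using g ij F_gv_low(2)[OF g ij phi_closed[OF g]] by (simp add: F_mult)
  ultimately show "(eta * \<rho> (inv g)) $$ (j, i) = (\<rho> (inv (phi g)) * eta) $$ (j, i)"
    using c ij carrier_matD[OF eta_carrier]
    by (simp add: scalar_prod_def atLeast0LessThan mult.commute)
qed

lemma eta_equiv: "g \<in> carrier G \<Longrightarrow> eta * \<rho> g = \<rho> (phi g) * eta"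
  using eta_equiv_inv[of "inv g"] by (simp add: phi_inv phi_closed)

lemma eta_inverse: "\<exists>M\<in>carrier_mat n n. eta * M = 1\<^sub>m n \<and> M * eta = 1\<^sub>m n"
proof -
  have "\<exists>x. x \<in> vspace X \<and> F x = svec G k" if "k < n" for k
    using F_surj[of "svec G k"] that by auto
  then obtain x where x: "\<And>k. k < n \<Longrightarrow> x k \<in> vspace X \<and> F (x k) = svec G k" by metis
  \<comment> \<open>The parts of degree 1 over \<one> of preimages of the basis vectors give a right
    inverse of \<open>eta\<close>.\<close>
  define M where "M = mat n n (\<lambda>(i, k). x k (\<one>, {i}))"
  have "eta * M = 1\<^sub>m n"
  proof (rule eq_matI)
    fix j k assume "j < dim_row (1\<^sub>m n :: complex mat)" "k < dim_col (1\<^sub>m n :: complex mat)"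
    then have jk: "j < n" "k < n" by auto
    \<comment> \<open>Modulo the ideal generated by V, F permutes the group elements injectively and
      the target is 0, so the preimage has no part of degree 0.\<close>
    have z: "x k (g, {}) = 0" if g: "g \<in> carrier G" for g
    proof -
      have "svec G k (phi g, {}) = (\<Sum>h\<in>carrier G. if h = g then x k (g, {}) else 0)"
        using F_apply_deg0[of "x k" "phi g"] x[OF jk(2)] g
        by (auto simp: F_g_0 phi_closed phi_inj intro!: sum.cong)
      then show ?thesis using finG g by (simp add: svec_def delta_def)
    qed
    have "svec G k (\<one>, {j}) = (\<Sum>g\<in>carrier G. if g = \<one> then \<Sum>i<n. x k (\<one>, {i}) * eta $$ (j, i) else 0)"
      using F_apply_deg1[of "x k" \<one> j] x[OF jk(2)] jk
      using phi_inj[OF one_closed] by (auto simp: z F_delta_1 phi_one intro!: sum.cong)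
    also have "\<dots> = (eta * M) $$ (j, k)"
      using finG jk by (simp add: M_def eta_def scalar_prod_def atLeast0LessThan mult.commute)
    finally show "(eta * M) $$ (j, k) = 1\<^sub>m n $$ (j, k)"
      using jk by (simp add: svec_def delta_def)
  qed (simp_all add: eta_def M_def)
  moreover have M: "M \<in> carrier_mat n n" by (simp add: M_def)
  ultimately show ?thesis
    using mat_mult_left_right_inverse[OF eta_carrier M] M by auto
qed

lemma eta_invertible: "invertible_mat eta"
  using eta_inverse invertible_matI[OF eta_carrier] by blast

section \<open>Nonzero V: \<open>phi\<close> fixes \<open>u\<close>, and the coboundaries
  correspond\<close>

context
  assumes n: "0 < n"
begin

lemma u_ne_one: "u \<noteq> \<one>"
proof
  assume "u = \<one>"
  then have "(- 1\<^sub>m n :: complex mat) $$ (0, 0) = 1\<^sub>m n $$ (0, 0)" using rho_u rep_one by simp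
  then show False using n by simp
qed

text \<open>In the coproduct of F(v) the term F(u) \<otimes> F(v) must appear with first group
  component \<open>u\<close>; at a nonzero entry of \<open>eta\<close> this forces the coefficient
  of F(u) at \<open>u\<close> to be 1.\<close>

lemma phi_u: "phi u = u"
proof -
  have "\<exists>i j. i < n \<and> j < n \<and> eta $$ (j, i) \<noteq> 0"
  proof (rule ccontr)
    assume *: "\<not> ?thesis"
    then have "eta = 0\<^sub>m n n" by (intro eq_matI) (auto simp: eta_def)
    then have "(0\<^sub>m n n :: complex mat) = 1\<^sub>m n" using eta_inverse by auto
    then have "(0\<^sub>m n n :: complex mat) $$ (0, 0) = 1\<^sub>m n $$ (0, 0)" by simp
    then show False using n by simp
  qed
  then obtain i j where ij: "i < n" "j < n" "eta $$ (j, i) \<noteq> 0" by blast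
  have "F (svec G i) (u, {}) = 0" using F_v_Fil[OF ij(1)] by (rule Fil_apply) simp
  then have "F (svec G i) (\<one>, {j}) = F (sgrp u) (u, {}) * F (svec G i) (\<one>, {j})"
    using A_comult_01[OF B'(1) uG one_closed ij(2), of "F (svec G i)"] uu
    unfolding comult_v[OF ij(1)] by (simp add: sgrp_def)
  then have "F (sgrp u) (u, {}) = 1" using ij F_v_eta[OF ij(1,2) one_closed] by simp
  then show ?thesis using F_g_0[OF uG uG] by (auto split: if_splits)
qed

lemma comult_g:
  assumes "g \<in> carrier G" "a \<in> carrier G" "b \<in> carrier G"
  shows "aco B (sgrp g) ((a, {}), (b, {})) = (if a = g \<and> b = g then 1 else 0)"
    "p < n \<Longrightarrow> aco B (sgrp g) ((a, {p}), (b, {})) = 0"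
    "p < n \<Longrightarrow> aco B (sgrp g) ((a, {}), (b, {p})) = 0"
  using assms by (auto simp: A_comult_00[OF B(1)] A_comult_10[OF B(1)] A_comult_01[OF B(1)]
    sgrp_def delta_def)

lemma sum_delta2:
  assumes "g \<in> carrier G" "h \<in> carrier G"
  shows "(\<Sum>a\<in>carrier G. \<Sum>b\<in>carrier G. if a = g \<and> b = h then c else 0) = (c :: complex)"
proof -
  have "(\<Sum>a\<in>carrier G. \<Sum>b\<in>carrier G. if a = g \<and> b = h then c else 0) =
      (\<Sum>a\<in>carrier G. if a = g then \<Sum>b\<in>carrier G. if b = h then c else 0 else 0)"
    by (intro sum.cong) auto
  then show ?thesis using assms finG by simp
qed

text \<open>Bidegree (1, 0) allows a part of degree 1 only over \<open>phi g\<close>. Bidegree (0,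
  1) rules this out, because there the two group components differ by \<open>u\<close>.\<close>

lemma F_g_1:
  assumes g: "g \<in> carrier G" and k: "k \<in> carrier G" and i: "i < n"
  shows "F (sgrp g) (k, {i}) = 0"
proof -
  let ?y = "F (sgrp g)"
  have c: "phi g \<in> carrier G" using g by (rule phi_closed)
  have 1: "(if k = h then ?y (h, {i}) else 0) = ?y (k, {i}) * ?y (h, {})"
    if "k \<in> carrier G" "h \<in> carrier G" for k h
  proof -
    have "FF (aco B (sgrp g)) ((k, {i}), (h, {})) = (\<Sum>a\<in>carrier G. \<Sum>b\<in>carrier G.
        if a = g \<and> b = g then ?y (k, {i}) * ?y (h, {}) else 0)"
      unfolding FF_10 by (intro sum.cong refl) (auto simp: comult_g[OF g])
    then show ?thesis
      using A_comult_10[OF B'(1) that i, of ?y] g sum_delta2[OF g g] by (simp add: F_comult)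
  qed
  have 2: "(if u \<otimes> k = h then ?y (h, {i}) else 0) = ?y (k, {}) * ?y (h, {i})"
    if "k \<in> carrier G" "h \<in> carrier G" for k h
  proof -
    have "FF (aco B (sgrp g)) ((k, {}), (h, {i})) = (\<Sum>a\<in>carrier G. \<Sum>b\<in>carrier G.
        if a = g \<and> b = g then ?y (k, {}) * ?y (h, {i}) else 0)"
      unfolding FF_01 by (intro sum.cong refl) (auto simp: comult_g[OF g])
    then show ?thesis
      using A_comult_01[OF B'(1) that i, of ?y] g sum_delta2[OF g g] by (simp add: F_comult)
  qed
  have "u \<otimes> phi g \<noteq> phi g" using u_ne_one c by (simp add: l_cancel_one)
  then have "?y (phi g, {i}) = 0" using 2[OF c c] F_g_0[OF g c] by simp
  moreover have "?y (k, {i}) = 0" if "k \<noteq> phi g"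
    using 1[OF k c] F_g_0[OF g c] that by simp
  ultimately show ?thesis by metis
qed

lemma coc_transport:
  assumes g: "g \<in> carrier G" shows "coc B' (phi g) = tensor_act eta (coc B g)"
proof -
  \<comment> \<open>Symmetry lets the sum of the entries (i, j) and (j, i) be read as twice one
    entry.\<close>
  have sym: "C\<^sup>T = C \<Longrightarrow> C \<in> carrier_mat n n \<Longrightarrow> coc C g \<in> carrier_mat n n \<and> (coc C g)\<^sup>T = coc C g"
    if "g \<in> carrier G" for C g
  proof -
    assume C: "C\<^sup>T = C" "C \<in> carrier_mat n n"
    let ?R = "\<rho> (inv g)"
    have R: "?R \<in> carrier_mat n n" using that by simp
    have m: "?R * C * ?R\<^sup>T \<in> carrier_mat n n" using R C by simp
    have "(?R * C * ?R\<^sup>T)\<^sup>T = ?R * C * ?R\<^sup>T"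
      using R C by (simp add: transpose_mult[of _ n n _ n] assoc_mult_mat[of _ n n _ n _ n])
    then have "(coc C g)\<^sup>T = coc C g"
      unfolding coc_def tensor_act_def using C(1) transpose_minus[OF C(2) m] by (simp only:)
    moreover have "coc C g \<in> carrier_mat n n"
      unfolding coc_def tensor_act_def by (rule minus_carrier_mat[OF m])
    ultimately show ?thesis by simp
  qed
  note C = sym[OF g B(2,1)] and C' = sym[OF phi_closed[OF g] B'(2,1)]
  have cs: "M $$ (j, i) = M $$ (i, j)" if "M \<in> carrier_mat n n \<and> M\<^sup>T = M" "i < n" "j < n"
    for M :: "complex mat" and i j
    using that by (metis carrier_matD index_transpose_mat(1))
  have ug: "u \<otimes> g \<in> carrier G" using g by simp
  \<comment> \<open>The odd half of the coproduct is multiplied by u \<otimes> 1, so its first group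
    component is off by \<open>u\<close>.\<close>
  let ?k = "u \<otimes> phi g"
  have k: "?k \<in> carrier G" "phi g \<in> carrier G" "phi (u \<otimes> g) = ?k"
    using g by (simp_all add: phi_closed phi_mult phi_u)
  have uk: "u \<otimes> ?k = phi g" "u \<otimes> (u \<otimes> g) = g"
    using g phi_closed[OF g] uu by (simp_all add: m_assoc[symmetric])
  let ?t = "aco B (sgrp g)"
  \<comment> \<open>Since \<open>phi\<close> is injective and fixes \<open>u\<close>, only the
    components u g and g of the coproduct of \<open>g\<close> reach this place; the parts of degree
    1 of F(a) and F(b) vanish by \<open>F_g_1\<close>.\<close>
  have FFt: "FF ?t ((?k, {i}), (phi g, {j})) =
      (\<Sum>p<n. \<Sum>q<n. ?t ((u \<otimes> g, {p}), (g, {q})) * (eta $$ (i, p) * eta $$ (j, q)))"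
    if ij: "i < n" "j < n" for i j
  proof -
    let ?c = "\<Sum>p<n. \<Sum>q<n. ?t ((u \<otimes> g, {p}), (g, {q})) * (eta $$ (i, p) * eta $$ (j, q))"
    have ka: "(?k = phi a) = (a = u \<otimes> g)" "(phi g = phi a) = (a = g)" if "a \<in> carrier G" for a
      unfolding k(3)[symmetric] phi_inj[OF ug that] phi_inj[OF g that] by (rule eq_commute)+
    have 1: "F (delta (a, {p})) (?k, {i}) = (if a = u \<otimes> g then eta $$ (i, p) else 0)"
      "F (delta (a, {p})) (phi g, {j}) = (if a = g then eta $$ (j, p) else 0)"
      if "a \<in> carrier G" "p < n" for a p
      using F_delta_1[OF that ij(1) k(1)] F_delta_1[OF that ij(2) k(2)] unfolding ka[OF that(1)]
      by simp_all
    have "FF ?t ((?k, {i}), (phi g, {j})) = (\<Sum>a\<in>carrier G. \<Sum>b\<in>carrier G.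
      ?t ((a, {}), (b, {})) * (F (sgrp a) (?k, {i}) * F (sgrp b) (phi g, {j})) +
      (\<Sum>p<n. \<Sum>q<n. ?t ((a, {p}), (b, {q})) * (F (delta (a, {p})) (?k, {i}) * F (delta (b, {q}))
        (phi g, {j}))))"
      by (rule FF_11[OF comult_g(2,3)[OF g]])
    also have "\<dots> = (\<Sum>a\<in>carrier G. \<Sum>b\<in>carrier G. if a = u \<otimes> g \<and> b = g then ?c else 0)"
    proof (intro sum.cong refl)
      fix a b assume ab: "a \<in> carrier G" "b \<in> carrier G"
      have "(\<Sum>p<n. \<Sum>q<n. ?t ((a, {p}), (b, {q})) * (F (delta (a, {p})) (?k, {i}) * F (delta (b,
        {q})) (phi g, {j}))) =
          (\<Sum>p<n. \<Sum>q<n. ?t ((a, {p}), (b, {q})) *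
            ((if a = u \<otimes> g then eta $$ (i, p) else 0) * (if b = g then eta $$ (j, q) else 0)))"
        by (intro sum.cong refl) (simp only: 1 ab lessThan_iff)
      also have "\<dots> = (if a = u \<otimes> g \<and> b = g then ?c else 0)"
        by (cases "a = u \<otimes> g"; cases "b = g") simp_all
      finally show "?t ((a, {}), (b, {})) * (F (sgrp a) (?k, {i}) * F (sgrp b) (phi g, {j})) +
          (\<Sum>p<n. \<Sum>q<n. ?t ((a, {p}), (b, {q})) * (F (delta (a, {p})) (?k, {i}) * F (delta (b, {q}))
            (phi g, {j}))) =
          (if a = u \<otimes> g \<and> b = g then ?c else 0)"
        by (simp only: F_g_1[OF ab(1) k(1) ij(1)] mult_zero_left mult_zero_right add_0_left)
    qed
    finally show ?thesis unfolding sum_delta2[OF ug g] .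
  qed
  show ?thesis
  proof (rule eq_matI)
    show "dim_row (coc B' (phi g)) = dim_row (tensor_act eta (coc B g))"
      "dim_col (coc B' (phi g)) = dim_col (tensor_act eta (coc B g))"
      using C C' tensor_act_carrier[OF eta_carrier, of "coc B g"] by auto
    fix i j assume "i < dim_row (tensor_act eta (coc B g))" "j < dim_col (tensor_act eta (coc B g))"
    then have ij: "i < n" "j < n" using C tensor_act_carrier[OF eta_carrier, of "coc B g"] by auto
    let ?T = "\<lambda>p q. ?t ((u \<otimes> g, {p}), (g, {q}))"
    \<comment> \<open>The factor -2 appears on both sides of the comparison and is cancelled at the
      end.\<close>
    have tsym: "?T p q + ?T q p = - 2 * coc B g $$ (p, q)" if "p < n" "q < n" for p q
      using A_comult_11[OF B(1) ug g that, of "sgrp g"] uk cs[OF C that] by (simp add: sgrp_def)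
    have "aco B' (F (sgrp g)) ((?k, {i}), (phi g, {j})) + aco B' (F (sgrp g)) ((?k, {j}), (phi g,
      {i})) =
        - 2 * coc B' (phi g) $$ (i, j)"
      using A_comult_11[OF B'(1) k(1,2) ij, of "F (sgrp g)"] uk cs[OF C' ij] F_g_0[OF g k(2)] by simp
    moreover have "aco B' (F (sgrp g)) ((?k, {i}), (phi g, {j})) + aco B' (F (sgrp g)) ((?k, {j}),
      (phi g, {i})) =
        (\<Sum>p<n. \<Sum>q<n. ?T p q * (eta $$ (i, p) * eta $$ (j, q))) +
        (\<Sum>p<n. \<Sum>q<n. ?T p q * (eta $$ (j, p) * eta $$ (i, q)))"
      using g ij by (simp add: F_comult FFt)
    \<comment> \<open>Exchanging p and q moves the symmetrization from the outer indices to the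
      inner ones, where \<open>tsym\<close> applies.\<close>
    moreover have "(\<Sum>p<n. \<Sum>q<n. ?T p q * (eta $$ (j, p) * eta $$ (i, q))) =
        (\<Sum>p<n. \<Sum>q<n. ?T q p * (eta $$ (i, p) * eta $$ (j, q)))"
      by (subst sum.swap) (simp add: mult.commute)
    moreover have "(\<Sum>p<n. \<Sum>q<n. ?T p q * (eta $$ (i, p) * eta $$ (j, q))) +
        (\<Sum>p<n. \<Sum>q<n. ?T q p * (eta $$ (i, p) * eta $$ (j, q))) =
        (\<Sum>p<n. \<Sum>q<n. - 2 * coc B g $$ (p, q) * (eta $$ (i, p) * eta $$ (j, q)))"
      unfolding sum.distrib[symmetric] distrib_right[symmetric]
      by (intro sum.cong refl) (simp only: tsym lessThan_iff)
    moreover have "\<dots> = - 2 * tensor_act eta (coc B g) $$ (i, j)"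
      using C ij by (simp add: tensor_act_entry sum_distrib_left mult.assoc)
    ultimately show "coc B' (phi g) $$ (i, j) = tensor_act eta (coc B g) $$ (i, j)" by simp
  qed
qed

end

end

section \<open>Orbits and isomorphism classes\<close>

lemma restrict_inv_into_auto:
  assumes "group G" "\<phi> \<in> auto G"
  shows "(\<lambda>x\<in>carrier G. inv_into (carrier G) \<phi> x) \<in> auto G"
proof -
  have "m_inv (BijGroup (carrier G)) \<phi> \<in> auto G"
    using subgroup.m_inv_closed[OF group.subgroup_auto[OF assms(1)] assms(2)] .
  moreover have "\<phi> \<in> Bij (carrier G)" using assms(2) by (simp add: auto_def)
  ultimately show ?thesis by (simp add: inv_BijGroup)
qed

lemma compose_auto:
  assumes "group G" "\<phi> \<in> auto G" "\<phi>' \<in> auto G"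
  shows "compose (carrier G) \<phi> \<phi>' \<in> auto G"
proof -
  have "\<phi> \<otimes>\<^bsub>BijGroup (carrier G)\<^esub> \<phi>' \<in> auto G"
    using subgroup.m_closed[OF group.subgroup_auto[OF assms(1)] assms(2,3)] .
  moreover have "\<phi> \<in> Bij (carrier G)" "\<phi>' \<in> Bij (carrier G)" using assms by (simp_all add: auto_def)
  ultimately show ?thesis by (simp add: BijGroup_def)
qed

text \<open>Orbits and isomorphism classes are both parametrized by \<open>S2 n\<close>. Once the
  two parametrizations have the same fibres, this provides the bijection together with its value on
  each tensor.\<close>

lemma bij_betw_images:
  assumes "\<And>x y. x \<in> S \<Longrightarrow> y \<in> S \<Longrightarrow> f x = f y \<longleftrightarrow> g x = g y"
  shows "\<exists>\<Phi>. bij_betw \<Phi> (f ` S) (g ` S) \<and> (\<forall>x\<in>S. \<Phi> (f x) = g x)"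
proof (intro exI conjI)
  let ?\<Phi> = "\<lambda>y. g (inv_into S f y)"
  show e: "\<forall>x\<in>S. ?\<Phi> (f x) = g x"
    using assms by (metis f_inv_into_f imageI inv_into_into)
  then show "bij_betw ?\<Phi> (f ` S) (g ` S)"
    using assms by (auto simp: bij_betw_def inj_on_def image_image)
qed

context gv begin

lemma S2_D: "B \<in> S2 n \<Longrightarrow> B \<in> carrier_mat n n" "B \<in> S2 n \<Longrightarrow> B\<^sup>T = B"
  by (simp_all add: S2_def)

lemma tensor_act_S2:
  assumes "R \<in> carrier_mat n n" "B \<in> S2 n" shows "tensor_act R B \<in> S2 n"
proof -
  have c: "B \<in> carrier_mat n n" "B\<^sup>T = B" using assms(2) by (simp_all add: S2_D)
  have "(R * B * R\<^sup>T)\<^sup>T = R * B * R\<^sup>T"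
    using assms(1) c by (simp add: transpose_mult[of _ n n _ n] assoc_mult_mat[of _ n n _ n _ n])
  then show ?thesis
    using tensor_act_carrier[OF assms(1) c(1)] unfolding tensor_act_def
    by (simp only: S2_def mem_Collect_eq)
qed

lemma tensor_act_minus:
  assumes "R \<in> carrier_mat n n" "C \<in> carrier_mat n n" "D \<in> carrier_mat n n"
  shows "tensor_act R (C - D) = tensor_act R C - tensor_act R D"
  using assms
  by (simp add: tensor_act_def mult_minus_distrib_mat[of _ n n _ n] minus_mult_distrib_mat[of _ n n
    _ _ n])

lemma S2_minus: "B \<in> S2 n \<Longrightarrow> C \<in> S2 n \<Longrightarrow> B - C \<in> S2 n"
  by (auto simp: S2_def transpose_minus[of _ n n])

text \<open>Equal coboundaries mean that B - C is fixed by the inverse of every group element, hence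
  by every group element.\<close>

lemma S2_rel_iff:
  "(B, C) \<in> S2_rel G n \<rho> \<longleftrightarrow> B \<in> S2 n \<and> C \<in> S2 n \<and> (\<forall>g\<in>carrier G. coc B g = coc C g)"
proof -
  have *: "coc B g = coc C g \<longleftrightarrow> tensor_act (\<rho> (inv g)) (B - C) = B - C"
    if B: "B \<in> S2 n" and C: "C \<in> S2 n" and g: "g \<in> carrier G" for g
  proof -
    let ?R = "\<rho> (inv g)"
    have c: "B \<in> carrier_mat n n" "C \<in> carrier_mat n n" "?R \<in> carrier_mat n n"
      "tensor_act ?R B \<in> carrier_mat n n" "tensor_act ?R C \<in> carrier_mat n n"
      using S2_D(1)[OF B] S2_D(1)[OF C] g by (simp_all add: tensor_act_carrier)
    have "coc B g = coc C g \<longleftrightarrow>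
        (\<forall>i<n. \<forall>j<n. B $$ (i, j) - tensor_act ?R B $$ (i, j) = C $$ (i, j) - tensor_act ?R C $$
          (i, j))"
      unfolding coc_def using c by (auto simp: mat_eq_iff)
    also have "\<dots> \<longleftrightarrow>
        (\<forall>i<n. \<forall>j<n. tensor_act ?R B $$ (i, j) - tensor_act ?R C $$ (i, j) = B $$ (i, j) - C $$
          (i, j))"
      by (intro all_cong1 imp_cong refl) (auto simp: algebra_simps)
    also have "\<dots> \<longleftrightarrow> tensor_act ?R (B - C) = B - C"
      unfolding tensor_act_minus[OF c(3,1,2)] using c by (auto simp: mat_eq_iff)
    finally show ?thesis .
  qed
  have "(\<forall>g\<in>carrier G. tensor_act (\<rho> (inv g)) D = D) \<longleftrightarrow> (\<forall>g\<in>carrier G. tensor_act (\<rho> g) D = D)" for D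
    by (metis inv_closed inv_inv)
  then show ?thesis
    using * S2_minus[of B C] by (auto simp: S2_rel_def S2_inv_def)
qed

lemma equiv_S2_rel: "equiv (S2 n) (S2_rel G n \<rho>)"
  by (rule equivI) (auto simp: refl_on_def sym_def trans_def S2_rel_iff)

end

context gvu begin

section \<open>The group of pairs and its action on classes\<close>

abbreviation "Au \<equiv> carrier (AutGVu G n \<rho> u)"

lemma Au_iff: "(\<phi>, \<eta>) \<in> Au \<longleftrightarrow> \<phi> \<in> auto G \<and> \<eta> \<in> carrier_mat n n \<and> invertible_mat \<eta> \<and>
    (\<forall>g\<in>carrier G. \<eta> * \<rho> g = \<rho> (\<phi> g) * \<eta>) \<and> \<phi> u = u"
  by (auto simp: AutGVu_def AutGV_def)

lemma auto_closed: "\<phi> \<in> auto G \<Longrightarrow> g \<in> carrier G \<Longrightarrow> \<phi> g \<in> carrier G"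
  by (auto simp: auto_def hom_def)

lemma Au_one: "(\<lambda>g\<in>carrier G. g, 1\<^sub>m n) \<in> Au"
  using id_in_auto invertible_matI[of "1\<^sub>m n" n "1\<^sub>m n"]
  by (auto simp: Au_iff left_mult_one_mat[of _ n n] right_mult_one_mat[of _ n n])

lemma Au_mult:
  assumes "(\<phi>, \<eta>) \<in> Au" "(\<phi>', \<eta>') \<in> Au"
  shows "(compose (carrier G) \<phi> \<phi>', \<eta> * \<eta>') \<in> Au"
proof -
  note a = assms[unfolded Au_iff]
  obtain M where M: "M \<in> carrier_mat n n" "\<eta> * M = 1\<^sub>m n" "M * \<eta> = 1\<^sub>m n"
    using a(1) by (auto elim: invertible_matE)
  obtain M' where M': "M' \<in> carrier_mat n n" "\<eta>' * M' = 1\<^sub>m n" "M' * \<eta>' = 1\<^sub>m n"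
    using a(2) by (auto elim: invertible_matE)
  have e: "\<eta> \<in> carrier_mat n n" "\<eta>' \<in> carrier_mat n n" using a by auto
  have "\<eta> * \<eta>' * (M' * M) = \<eta> * (\<eta>' * M') * M" "M' * M * (\<eta> * \<eta>') = M' * (M * \<eta>) * \<eta>'"
    using e M(1) M'(1) by (simp_all add: assoc_mult_mat[of _ n n _ n _ n])
  then have "invertible_mat (\<eta> * \<eta>')"
    using e M M' by (intro invertible_matI[of _ n "M' * M"]) auto
  moreover have "\<eta> * \<eta>' * \<rho> g = \<rho> (compose (carrier G) \<phi> \<phi>' g) * (\<eta> * \<eta>')" if g: "g \<in> carrier G" for g
  proof -
    have c: "\<rho> g \<in> carrier_mat n n" "\<phi>' g \<in> carrier G" "\<rho> (\<phi>' g) \<in> carrier_mat n n"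
      "\<rho> (\<phi> (\<phi>' g)) \<in> carrier_mat n n"
      using g a by (auto simp: auto_closed)
    have "\<eta> * \<eta>' * \<rho> g = \<eta> * (\<eta>' * \<rho> g)" using e c by (intro assoc_mult_mat) auto
    also have "\<dots> = \<eta> * (\<rho> (\<phi>' g) * \<eta>')" using a(2) g by auto
    also have "\<dots> = (\<eta> * \<rho> (\<phi>' g)) * \<eta>'" using e c by (intro assoc_mult_mat[symmetric]) auto
    also have "\<dots> = (\<rho> (\<phi> (\<phi>' g)) * \<eta>) * \<eta>'" using a(1) c(2) by auto
    also have "\<dots> = \<rho> (\<phi> (\<phi>' g)) * (\<eta> * \<eta>')" using e c by (intro assoc_mult_mat) auto
    finally show ?thesis using g by (simp add: compose_def)
  qed
  ultimately show ?thesis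
    using a e compose_auto[OF is_group] by (simp add: Au_iff compose_def)
qed

lemma Au_inv:
  assumes "(\<phi>, \<eta>) \<in> Au"
  obtains \<phi>' \<eta>' where "(\<phi>', \<eta>') \<in> Au" "\<eta> * \<eta>' = 1\<^sub>m n" "\<eta>' * \<eta> = 1\<^sub>m n"
proof -
  note a = assms[unfolded Au_iff]
  obtain M where M: "M \<in> carrier_mat n n" "\<eta> * M = 1\<^sub>m n" "M * \<eta> = 1\<^sub>m n"
    using a by (auto elim: invertible_matE)
  define \<phi>' where "\<phi>' = (\<lambda>x\<in>carrier G. inv_into (carrier G) \<phi> x)"
  have bij: "bij_betw \<phi> (carrier G) (carrier G)" using a by (auto simp: auto_def Bij_def)
  have f': "\<phi>' g \<in> carrier G" "\<phi> (\<phi>' g) = g" if "g \<in> carrier G" for g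
    using that bij by (auto simp: \<phi>'_def bij_betw_def inv_into_into f_inv_into_f)
  have e: "\<eta> \<in> carrier_mat n n" using a by auto
  have "M * \<rho> g = \<rho> (\<phi>' g) * M" if g: "g \<in> carrier G" for g
  proof -
    have c: "\<rho> g \<in> carrier_mat n n" "\<rho> (\<phi>' g) \<in> carrier_mat n n" using g f' by auto
    have "\<eta> * \<rho> (\<phi>' g) = \<rho> g * \<eta>" using a f'[OF g] by auto
    then have "M * (\<eta> * \<rho> (\<phi>' g)) * M = M * (\<rho> g * \<eta>) * M" by simp
    moreover have "M * (\<eta> * \<rho> (\<phi>' g)) * M = (M * \<eta>) * \<rho> (\<phi>' g) * M"
      using e c M(1) by (simp add: assoc_mult_mat[of _ n n _ n _ n])
    moreover have "M * (\<rho> g * \<eta>) * M = M * \<rho> g * (\<eta> * M)"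
      using e c M(1) by (simp add: assoc_mult_mat[of _ n n _ n _ n])
    ultimately show ?thesis using M c by simp
  qed
  moreover have "\<phi>' u = u"
    using f'[OF uG] a bij by (metis bij_betw_def inj_onD uG)
  moreover have "\<phi>' \<in> auto G"
    unfolding \<phi>'_def using a by (intro restrict_inv_into_auto is_group) auto
  ultimately have "(\<phi>', M) \<in> Au"
    using M invertible_matI[OF M(1) e M(3,2)] by (simp add: Au_iff)
  then show ?thesis using that M by blast
qed

text \<open>Naturality of the coboundary: \<eta> carries the action of g^-1 to that of
  \<phi>(g)^-1.\<close>

lemma coc_tensor_act:
  assumes "(\<phi>, \<eta>) \<in> Au" "B \<in> carrier_mat n n" "g \<in> carrier G"
  shows "coc (tensor_act \<eta> B) (\<phi> g) = tensor_act \<eta> (coc B g)"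
proof -
  note a = assms(1)[unfolded Au_iff]
  have hom: "\<phi> \<in> hom G G" using a by (simp add: auto_def)
  have "\<phi> (inv g) = inv (\<phi> g)"
    using hom assms(3) is_group group_hom.hom_inv[of G G \<phi>]
    by (simp add: group_hom_def group_hom_axioms_def)
  then have e: "\<rho> (inv (\<phi> g)) * \<eta> = \<eta> * \<rho> (inv g)" using a assms(3) by (metis inv_closed)
  have c: "\<eta> \<in> carrier_mat n n" "\<rho> (inv g) \<in> carrier_mat n n" "\<rho> (inv (\<phi> g)) \<in> carrier_mat n n"
    using a assms(3) by (auto simp: auto_closed)
  show ?thesis
    using assms(2) c
    by (simp add: coc_def tensor_act_minus tensor_act_carrier tensor_act_comp e)
qed

lemma S2_rel_tensor_act:
  assumes "(\<phi>, \<eta>) \<in> Au" "(B, C) \<in> S2_rel G n \<rho>"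
  shows "(tensor_act \<eta> B, tensor_act \<eta> C) \<in> S2_rel G n \<rho>"
proof -
  note a = assms(1)[unfolded Au_iff]
  have BC: "B \<in> S2 n" "C \<in> S2 n" "\<And>g. g \<in> carrier G \<Longrightarrow> coc B g = coc C g"
    using assms(2) by (auto simp: S2_rel_iff)
  have "coc (tensor_act \<eta> B) h = coc (tensor_act \<eta> C) h" if h: "h \<in> carrier G" for h
  proof -
    obtain g where "g \<in> carrier G" "h = \<phi> g"
      using a h by (auto simp: auto_def Bij_def bij_betw_def)
    then show ?thesis using coc_tensor_act[OF assms(1)] BC by (simp add: S2_D)
  qed
  then show ?thesis using a BC by (auto simp: S2_rel_iff tensor_act_S2)
qed

text \<open>The relation of having classes in the same orbit, stated for representatives; orbits and
  isomorphism classes are each compared with it.\<close>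

definition Rel :: "complex mat \<Rightarrow> complex mat \<Rightarrow> bool" where
  "Rel B C \<longleftrightarrow> B \<in> S2 n \<and> (\<exists>(\<phi>, \<eta>)\<in>Au. (tensor_act \<eta> B, C) \<in> S2_rel G n \<rho>)"

lemma RelI: "B \<in> S2 n \<Longrightarrow> (\<phi>, \<eta>) \<in> Au \<Longrightarrow> (tensor_act \<eta> B, C) \<in> S2_rel G n \<rho> \<Longrightarrow> Rel B C"
  by (auto simp: Rel_def)

lemma RelE:
  assumes "Rel B C"
  obtains \<phi> \<eta> where "B \<in> S2 n" "C \<in> S2 n" "(\<phi>, \<eta>) \<in> Au" "\<eta> \<in> carrier_mat n n"
    "(tensor_act \<eta> B, C) \<in> S2_rel G n \<rho>"
  using assms by (auto simp: Rel_def S2_rel_iff Au_iff)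

lemma Rel_refl: "B \<in> S2 n \<Longrightarrow> Rel B B"
  by (rule RelI[OF _ Au_one]) (simp_all add: tensor_act_one S2_D S2_rel_iff)

lemma Rel_sym: assumes "Rel B C" shows "Rel C B"
proof -
  obtain \<phi> \<eta> where r: "B \<in> S2 n" "C \<in> S2 n" "(\<phi>, \<eta>) \<in> Au" "\<eta> \<in> carrier_mat n n"
    "(tensor_act \<eta> B, C) \<in> S2_rel G n \<rho>"
    using assms by (rule RelE)
  obtain \<phi>' \<eta>' where i: "(\<phi>', \<eta>') \<in> Au" "\<eta>' * \<eta> = 1\<^sub>m n"
    using Au_inv[OF r(3)] by metis
  have "(tensor_act \<eta>' (tensor_act \<eta> B), tensor_act \<eta>' C) \<in> S2_rel G n \<rho>"
    by (rule S2_rel_tensor_act[OF i(1) r(5)])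
  moreover have "tensor_act \<eta>' (tensor_act \<eta> B) = B"
    using i r by (simp add: Au_iff tensor_act_comp S2_D tensor_act_one)
  ultimately have "(tensor_act \<eta>' C, B) \<in> S2_rel G n \<rho>" by (simp add: S2_rel_iff)
  then show ?thesis by (rule RelI[OF r(2) i(1)])
qed

lemma Rel_trans: assumes "Rel B C" "Rel C D" shows "Rel B D"
proof -
  obtain \<phi> \<eta> where r: "B \<in> S2 n" "C \<in> S2 n" "(\<phi>, \<eta>) \<in> Au" "\<eta> \<in> carrier_mat n n"
    "(tensor_act \<eta> B, C) \<in> S2_rel G n \<rho>"
    using assms(1) by (rule RelE)
  obtain \<phi>' \<eta>' where r': "(\<phi>', \<eta>') \<in> Au" "\<eta>' \<in> carrier_mat n n"
    "(tensor_act \<eta>' C, D) \<in> S2_rel G n \<rho>"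
    using assms(2) by (rule RelE)
  have "(tensor_act \<eta>' (tensor_act \<eta> B), tensor_act \<eta>' C) \<in> S2_rel G n \<rho>"
    by (rule S2_rel_tensor_act[OF r'(1) r(5)])
  then have "(tensor_act (\<eta>' * \<eta>) B, D) \<in> S2_rel G n \<rho>"
    using r r' by (simp add: tensor_act_comp S2_D S2_rel_iff)
  then show ?thesis by (rule RelI[OF r(1) Au_mult[OF r'(1) r(3)]])
qed

text \<open>The coproduct involves \<open>B\<close> only through \<open>coc B\<close>, so congruent
  tensors give the same structure and not just an isomorphic one.\<close>

lemma A_hopf_cong:
  assumes "(B, C) \<in> S2_rel G n \<rho>" shows "A_hopf G n \<rho> u B = A_hopf G n \<rho> u C"
proof -
  have BC: "B \<in> carrier_mat n n" "C \<in> carrier_mat n n" "\<And>g. g \<in> carrier G \<Longrightarrow> coc B g = coc C g"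
    using assms by (auto simp: S2_rel_iff S2_D)
  have "ttw B x = ttw C x" for x
    unfolding twisted_comult_eq[OF BC(1)] twisted_comult_eq[OF BC(2)] lin_ext_def
    by (intro ext sum.cong) (auto simp: BC(3) sbasis_def)
  then have "ttw B = ttw C" by (rule ext)
  then have "aco B = aco C" unfolding A_comult_def by (simp only:)
  then show ?thesis by (simp add: A_hopf_def)
qed

lemma Rel_imp_isomorphic:
  assumes "Rel B C" shows "hopf_isomorphic (A_hopf G n \<rho> u B) (A_hopf G n \<rho> u C)"
proof -
  obtain \<phi> \<eta> where r: "B \<in> S2 n" "C \<in> S2 n" "(\<phi>, \<eta>) \<in> Au" "\<eta> \<in> carrier_mat n n"
    "(tensor_act \<eta> B, C) \<in> S2_rel G n \<rho>"
    using assms by (rule RelE)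
  interpret gvaut G n \<rho> u \<phi> \<eta>
    by unfold_locales (use r(3) in \<open>auto simp: Au_iff auto_def\<close>)
  have "hopf_iso (A_hopf G n \<rho> u B) (A_hopf G n \<rho> u (tensor_act \<eta> B)) (fm \<phi> \<eta>)"
    using r by (intro hopf_iso_f) (auto simp: Au_iff auto_def Bij_def S2_D)
  then show ?thesis
    unfolding A_hopf_cong[OF r(5)] by (auto simp: hopf_isomorphic_def)
qed

lemma isomorphic_imp_Rel:
  assumes BS: "B \<in> S2 n" and CS: "C \<in> S2 n"
    and iso: "hopf_isomorphic (A_hopf G n \<rho> u B) (A_hopf G n \<rho> u C)"
  shows "Rel B C"
proof (cases "n = 0")
  \<comment> \<open>An isomorphism of group algebras may move \<open>u\<close>, but in dimension 0
    there is just one tensor.\<close>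
  case True
  then have "B = C" using S2_D(1)[OF BS] S2_D(1)[OF CS] by (auto intro!: eq_matI)
  then show ?thesis using Rel_refl[OF BS] by simp
next
  case False
  obtain F0 where F0: "hopf_iso (A_hopf G n \<rho> u B) (A_hopf G n \<rho> u C) F0"
    using iso by (auto simp: hopf_isomorphic_def)
  have F0': "bij_betw F0 (vspace X) (vspace X)"
    "\<And>c a b. a \<in> vspace X \<Longrightarrow> b \<in> vspace X \<Longrightarrow> F0 (\<lambda>x. c * a x + b x) = (\<lambda>y. c * F0 a y + F0 b y)"
    "\<And>a b. a \<in> vspace X \<Longrightarrow> b \<in> vspace X \<Longrightarrow> F0 (a \<star> b) = F0 a \<star> F0 b"
    "F0 (sgrp \<one>) = sgrp \<one>"
    "\<And>a. a \<in> vspace X \<Longrightarrow> aco C (F0 a) = tensor_sq X F0 (aco B a)"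
    "\<And>a. a \<in> vspace X \<Longrightarrow> scounit G (F0 a) = scounit G a"
    using F0 unfolding hopf_iso_def A_hopf_def by simp_all
  define F where "F = lin_ext X (\<lambda>b. F0 (delta b))"
  have FF0: "F a = F0 a" if "a \<in> vspace X" for a
    unfolding F_def by (rule lin_on_vspace[symmetric, OF F0'(2) finX that])
  have ts: "tensor_sq X F = tensor_sq X F0"
    unfolding tensor_sq_def lin_ext_def by (intro ext sum.cong) (auto simp: FF0)
  interpret gviso G n \<rho> u B C F
  proof unfold_locales
    show "B \<in> carrier_mat n n" "B\<^sup>T = B" "C \<in> carrier_mat n n" "C\<^sup>T = C"
      using BS CS by (simp_all add: S2_D)
    show "clin F" unfolding F_def by (rule clin_lin_ext)
    show "F x \<in> vspace X" if "x \<in> vspace X" for x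
      using F0'(1) that by (auto simp: FF0 bij_betw_def)
    show "\<exists>x\<in>vspace X. F x = y" if "y \<in> vspace X" for y
    proof -
      have "y \<in> F0 ` vspace X" using F0'(1) that by (simp add: bij_betw_def)
      then obtain x where "x \<in> vspace X" "y = F0 x" by blast
      then show ?thesis using FF0 by auto
    qed
    show "F (x \<star> y) = F x \<star> F y" if "x \<in> vspace X" "y \<in> vspace X" for x y
      using that by (simp add: FF0 F0'(3) sm_vspace)
    show "F (sgrp \<one>) = sgrp \<one>" by (simp add: FF0 F0'(4))
    show "aco C (F x) = tensor_sq X F (aco B x)" if "x \<in> vspace X" for x
      using that by (simp add: ts FF0 F0'(5))
    show "scounit G (F x) = scounit G x" if "x \<in> vspace X" for x
      using that by (simp add: FF0 F0'(6))
  qed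
  have n: "0 < n" using False by simp
  have A: "(phi, eta) \<in> Au"
    using phi_auto eta_invertible eta_equiv phi_u[OF n] by (simp add: Au_iff)
  have "coc (tensor_act eta B) h = coc C h" if "h \<in> carrier G" for h
  proof -
    obtain g where g: "g \<in> carrier G" "phi g = h" using phi_surj[OF \<open>h \<in> carrier G\<close>] by blast
    then show ?thesis
      using coc_transport[OF n g(1)] coc_tensor_act[OF A S2_D(1)[OF BS] g(1)] by simp
  qed
  then have "(tensor_act eta B, C) \<in> S2_rel G n \<rho>"
    using BS CS by (simp add: S2_rel_iff tensor_act_S2)
  then show ?thesis by (rule RelI[OF BS A])
qed

text \<open>The image of a class is the whole class of the image: the inverse pair from
  \<open>Au_inv\<close> provides preimages inside the original class.\<close>

lemma class_act_class:
  assumes "(\<phi>, \<eta>) \<in> Au" "B \<in> S2 n"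
  shows "class_act (\<phi>, \<eta>) (S2_rel G n \<rho> `` {B}) = S2_rel G n \<rho> `` {tensor_act \<eta> B}"
proof
  show "class_act (\<phi>, \<eta>) (S2_rel G n \<rho> `` {B}) \<subseteq> S2_rel G n \<rho> `` {tensor_act \<eta> B}"
    using S2_rel_tensor_act[OF assms(1)] by (auto simp: class_act_def)
  show "S2_rel G n \<rho> `` {tensor_act \<eta> B} \<subseteq> class_act (\<phi>, \<eta>) (S2_rel G n \<rho> `` {B})"
  proof
    fix C assume "C \<in> S2_rel G n \<rho> `` {tensor_act \<eta> B}"
    then have C: "(tensor_act \<eta> B, C) \<in> S2_rel G n \<rho>" by simp
    obtain \<phi>' \<eta>' where i: "(\<phi>', \<eta>') \<in> Au" "\<eta> * \<eta>' = 1\<^sub>m n" "\<eta>' * \<eta> = 1\<^sub>m n"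
      using Au_inv[OF assms(1)] by metis
    have c: "\<eta> \<in> carrier_mat n n" "\<eta>' \<in> carrier_mat n n" "C \<in> carrier_mat n n" "B \<in> carrier_mat n n"
      using assms i(1) C by (auto simp: Au_iff S2_rel_iff S2_D)
    have "(tensor_act \<eta>' (tensor_act \<eta> B), tensor_act \<eta>' C) \<in> S2_rel G n \<rho>"
      by (rule S2_rel_tensor_act[OF i(1) C])
    then have "(B, tensor_act \<eta>' C) \<in> S2_rel G n \<rho>"
      using c i by (simp add: tensor_act_comp tensor_act_one)
    moreover have "tensor_act \<eta> (tensor_act \<eta>' C) = C"
      using c i by (simp add: tensor_act_comp tensor_act_one)
    ultimately show "C \<in> class_act (\<phi>, \<eta>) (S2_rel G n \<rho> `` {B})"
      unfolding class_act_def prod.case by (metis Image_singleton_iff imageI)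
  qed
qed

section \<open>Orbits and isomorphism classes in terms of \<open>Rel\<close>\<close>

lemma orbit_class:
  assumes "B \<in> S2 n"
  shows "orbit (AutGVu G n \<rho> u) class_act (S2_rel G n \<rho> `` {B}) =
    {S2_rel G n \<rho> `` {C} | C. Rel B C}"
proof -
  have "\<exists>p\<in>Au. class_act p (S2_rel G n \<rho> `` {B}) = S2_rel G n \<rho> `` {C}" if "Rel B C" for C
  proof -
    obtain \<phi> \<eta> where r: "(\<phi>, \<eta>) \<in> Au" "(tensor_act \<eta> B, C) \<in> S2_rel G n \<rho>"
      using \<open>Rel B C\<close> by (rule RelE)
    then show ?thesis
      using class_act_class[OF r(1) assms] equiv_class_eq[OF equiv_S2_rel r(2)] by metis
  qed
  moreover have "\<exists>C. Rel B C \<and> class_act p (S2_rel G n \<rho> `` {B}) = S2_rel G n \<rho> `` {C}" if "p \<in> Au"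
    for p
  proof -
    obtain \<phi> \<eta> where p: "p = (\<phi>, \<eta>)" by (cases p)
    then have "tensor_act \<eta> B \<in> S2 n" using that assms by (auto simp: Au_iff tensor_act_S2)
    then have "Rel B (tensor_act \<eta> B)" using that assms p
      by (intro RelI[of B \<phi> \<eta>]) (auto simp: S2_rel_iff)
    then show ?thesis using class_act_class[OF that[unfolded p] assms] p by auto
  qed
  ultimately show ?thesis unfolding orbit_def by blast
qed

lemma orbit_eq_iff:
  assumes "B \<in> S2 n" "C \<in> S2 n"
  shows "orbit (AutGVu G n \<rho> u) class_act (S2_rel G n \<rho> `` {B}) =
    orbit (AutGVu G n \<rho> u) class_act (S2_rel G n \<rho> `` {C}) \<longleftrightarrow> Rel B C"
proof
  assume *: "Rel B C"
  then have "Rel B D \<longleftrightarrow> Rel C D" for D by (meson Rel_sym Rel_trans)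
  then show "orbit (AutGVu G n \<rho> u) class_act (S2_rel G n \<rho> `` {B}) =
    orbit (AutGVu G n \<rho> u) class_act (S2_rel G n \<rho> `` {C})"
    unfolding orbit_class[OF assms(1)] orbit_class[OF assms(2)] by simp
next
  assume "orbit (AutGVu G n \<rho> u) class_act (S2_rel G n \<rho> `` {B}) =
    orbit (AutGVu G n \<rho> u) class_act (S2_rel G n \<rho> `` {C})"
  then have "S2_rel G n \<rho> `` {C} \<in> {S2_rel G n \<rho> `` {D} | D. Rel B D}"
    unfolding orbit_class[OF assms(1)] orbit_class[OF assms(2)] using Rel_refl[OF assms(2)] by blast
  \<comment> \<open>The representatives \<open>C\<close> and \<open>D\<close> may differ by an
    invariant tensor, which the identity pair absorbs.\<close>
  then obtain D where D: "Rel B D" "S2_rel G n \<rho> `` {C} = S2_rel G n \<rho> `` {D}" by blast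
  have "D \<in> S2 n" using D(1) by (rule RelE)
  then have "(D, C) \<in> S2_rel G n \<rho>"
    using D(2) assms(2) eq_equiv_class[OF D(2)[symmetric] equiv_S2_rel] by simp
  then have "Rel D C"
    using \<open>D \<in> S2 n\<close> by (intro RelI[OF _ Au_one]) (simp_all add: tensor_act_one S2_D)
  then show "Rel B C" using D(1) Rel_trans by blast
qed

lemma A_iso_rel_iff:
  assumes "B \<in> S2 n" "C \<in> S2 n"
  shows "(A_hopf G n \<rho> u B, A_hopf G n \<rho> u C) \<in> A_iso_rel G n \<rho> u \<longleftrightarrow> Rel B C"
  using assms Rel_imp_isomorphic isomorphic_imp_Rel by (auto simp: A_iso_rel_def A_family_def)

lemma iso_class_eq_iff:
  assumes "B \<in> S2 n" "C \<in> S2 n"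
  shows "A_iso_rel G n \<rho> u `` {A_hopf G n \<rho> u B} = A_iso_rel G n \<rho> u `` {A_hopf G n \<rho> u C} \<longleftrightarrow> Rel B C"
proof
  assume "A_iso_rel G n \<rho> u `` {A_hopf G n \<rho> u B} = A_iso_rel G n \<rho> u `` {A_hopf G n \<rho> u C}"
  moreover have "A_hopf G n \<rho> u C \<in> A_iso_rel G n \<rho> u `` {A_hopf G n \<rho> u C}"
    using A_iso_rel_iff[OF assms(2,2)] Rel_refl[OF assms(2)] by simp
  ultimately have "(A_hopf G n \<rho> u B, A_hopf G n \<rho> u C) \<in> A_iso_rel G n \<rho> u" by blast
  then show "Rel B C" using A_iso_rel_iff[OF assms] by simp
next
  assume "Rel B C"
  then have "Rel B D \<longleftrightarrow> Rel C D" for D by (meson Rel_sym Rel_trans)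
  then have "(A_hopf G n \<rho> u B, K) \<in> A_iso_rel G n \<rho> u \<longleftrightarrow> (A_hopf G n \<rho> u C, K) \<in> A_iso_rel G n \<rho> u"
    if "K \<in> A_family G n \<rho> u" for K
    using that A_iso_rel_iff assms by (auto simp: A_family_def)
  moreover have "K \<in> A_family G n \<rho> u" if "(H, K) \<in> A_iso_rel G n \<rho> u" for H K
    using that by (auto simp: A_iso_rel_def)
  ultimately show "A_iso_rel G n \<rho> u `` {A_hopf G n \<rho> u B} = A_iso_rel G n \<rho> u `` {A_hopf G n \<rho> u C}"
    by blast
qed

end

theorem corollary2p2:
  fixes G :: "('g, 'm) monoid_scheme"
    and n :: nat
    and \<rho> :: "'g \<Rightarrow> complex mat"
    and u :: 'g
  assumes "group G"
    and "finite (carrier G)"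
    and "matrix_rep G n \<rho>"
    and "u \<in> carrier G"
    and "\<forall>g\<in>carrier G. u \<otimes>\<^bsub>G\<^esub> g = g \<otimes>\<^bsub>G\<^esub> u"
    and "u \<otimes>\<^bsub>G\<^esub> u = \<one>\<^bsub>G\<^esub>"
    and "\<rho> u = - 1\<^sub>m n"
  shows "\<exists>\<Phi>. bij_betw \<Phi>
             (orbits (AutGVu G n \<rho> u) (S2 n // S2_rel G n \<rho>) class_act)
             (A_family G n \<rho> u // A_iso_rel G n \<rho> u) \<and>
           (\<forall>B\<in>S2 n.
             \<Phi> (orbit (AutGVu G n \<rho> u) class_act (S2_rel G n \<rho> `` {B})) =
             A_iso_rel G n \<rho> u `` {A_hopf G n \<rho> u B})"
proof -
  interpret gvu G n \<rho> u
    by (intro gvu.intro gv.intro gv_axioms.intro gvu_axioms.intro assms(1-4,6,7) assms(5)[rule_format])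
  let ?f = "\<lambda>B. orbit (AutGVu G n \<rho> u) class_act (S2_rel G n \<rho> `` {B})"
  let ?g = "\<lambda>B. A_iso_rel G n \<rho> u `` {A_hopf G n \<rho> u B}"
  have "orbits (AutGVu G n \<rho> u) (S2 n // S2_rel G n \<rho>) class_act = ?f ` S2 n"
    by (auto simp: orbits_def quotient_def)
  moreover have "A_family G n \<rho> u // A_iso_rel G n \<rho> u = ?g ` S2 n"
    by (auto simp: A_family_def quotient_def)
  ultimately show ?thesis
    using bij_betw_images[of "S2 n" ?f ?g] orbit_eq_iff iso_class_eq_iff by simp
qed

end
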